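(* Let $f=(f_1,\ldots,f_n)$ be an $n$-tuple of formal power series with the model property and let $\mathbb B_f$ be the corresponding noncommutative domain. Then the following statements hold. (i) $H^\infty(\mathbb B_f)$ coincides with the algebra of bounded left multipliers of $\mathbb H^2(f)$. (ii) If $f\in\mathcal M^{||}$, then $H^\infty(\mathbb B_f)$ can be identified, as an algebra, with the algebra $\mathbb H^\infty(\mathbb B_f^<)$ of all bounded free holomorphic functions on the noncommutative domain $\mathbb B_f^<(\mathcal H)$, which coincides with $$\{\varphi\circ f:\mathbb B_f^<(\mathcal H)\to B(\mathcal H):\ \varphi\in H^\infty_{\bf ball}\}.$$ (iii) If $\psi\in H^\infty(\mathbb B_f)$, then there is a unique $\varphi=\sum_\alpha c_\alpha S_\alpha$ in the noncommutative analytic Toeplitz algebra $F_n^\infty$ such that $$\psi=\text{SOT-}\lim_{r\to1}\sum_{k=0}^\infty\sum_{|\alpha|=k}c_\alpha r^{|\alpha|}[f(M_Z)]_\alpha,\qquad c_\alpha\in\mathbb C,$$ where $M_Z=(M_{Z_1},\ldots,M_{Z_n})$ and, for each $r\in[0,1)$, the series converges in the operator norm topology.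
   Context: Notation. $\mathbb F_n^+$ is the free semigroup on $g_1,\ldots,g_n$ with identity $g_0$ and length $|\cdot|$. For an $n$-tuple $X$ of elements of a unital algebra, $X_\alpha=X_{i_1}\cdots X_{i_k}$ if $\alpha=g_{i_1}\cdots g_{i_k}$, $X_{g_0}=I$; $[f(X)]_\alpha$ is the corresponding product of $f_1(X),\ldots,f_n(X)$. A tuple $X\in B(\mathcal H)^n$ is viewed as a row operator, so $\|X\|=\|\sum X_iX_i^*\|^{1/2}$; $[B(\mathcal H)^n]_\gamma=\{X:\|X\|<\gamma\}$. A free holomorphic function on $[B(\mathcal H)^n]_\gamma$ is a formal power series $\sum a_\alpha Z_\alpha$ in noncommuting indeterminates (complex coefficients) with radius of convergence $r$, $r^{-1}=\limsup_k(\sum_{|\alpha|=k}|a_\alpha|^2)^{1/2k}$, at least $\gamma$, identified with the map $X\mapsto\sum_k\sum_{|\alpha|=k}a_\alpha X_\alpha$ (norm convergence; $\mathcal H$ separable infinite-dimensional). $H^2_{\bf ball}$ is the Hilbert space of series with $\sum|a_\alpha|^2<\infty$ (the $Z_\alpha$ being orthonormal); $H^\infty_{\bf ball}$ is the algebra of free holomorphic functions $\varphi$ on $[B(\mathcal H)^n]_1$ with $\sup_{\|X\|<1}\|\varphi(X)\|<\infty$. Convergence sets. For an $n$-tuple $f$ of formal power series $f_j=\sum c^{(j)}_\alpha Z_\alpha$ and a Hilbert space $\mathcal H$: $\mathcal C_f^{SOT}(\mathcal H)$ is the set of $X\in B(\mathcal H)^n$ such that each series $f_j(X):=\sum_k\sum_{|\alpha|=k}c^{(j)}_\alpha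 X_\alpha$ is SOT-convergent; $\mathcal C_f^{rad}(\mathcal H)$ is the set of $X$ such that for some $\delta\in(0,1)$ these series converge in norm at $rX$ for all $r\in(\delta,1)$ and $f_j(X):=\text{SOT-}\lim_{r\to1}f_j(rX)$ exists for each $j$. Model property. $f=(f_1,\ldots,f_n)$ has the model property if one of the following holds. (A) $f$ is an $n$-tuple of noncommutative polynomials for which there is an $n$-tuple $g$ of noncommutative polynomials with $f\circ g=g\circ f=\mathrm{id}$. Then $\{f_\alpha\}$ is a linear basis of $\mathbb C[Z_1,\ldots,Z_n]$ and $\mathbb H^2(f)$ is the completion of $\mathbb C[Z_1,\ldots,Z_n]$ for the inner product $\langle f_\alpha,f_\beta\rangle=\delta_{\alpha\beta}$. (S) $f$ is an $n$-tuple of formal power series with $f(0)=0$, nonzero radius of convergence and $\det J_f(0)\neq0$ ($J_f(0)_{ij}$ is the coefficient of $Z_j$ in $f_i$); $\mathbb H^2(f)$ is the Hilbert space of formal power series $\sum a_\alpha f_\alpha$, $\sum|a_\alpha|^2<\infty$, with $\{f_\alpha\}$ orthonormal; $Z_1,\ldots,Z_n\in\mathbb H^2(f)$; left multiplication $M_{Z_i}$ by $Z_i$ is bounded on $\mathbb H^2(f)$; and $M_Z=(M_{Z_1},\ldots,M_{Z_n})$ belongs to $\mathcal C_f^{SOT}(\mathbb H^2(f))$ or $\mathcal C_f^{rad}(\mathbb H^2(f))$ with $f_j(M_Z)=M_{f_j}$ (left multiplication by $f_j$), $j=1,\ldots,n$. (F) $f$ is an $n$-tuple of free holomorphic functions on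 some $[B(\mathcal H)^n]_\gamma$, $\gamma>0$, with range in $[B(\mathcal H)^n]_1$, such that $G\circ f\not\equiv0$ for every nonzero free holomorphic $G$ on $[B(\mathcal H)^n]_1$; $\mathbb H^2(f)=\{G\circ f:G\in H^2_{\bf ball}\}$ with $\langle F\circ f,G\circ f\rangle=\langle F,G\rangle$; the coordinate functions $Z_1,\ldots,Z_n$ lie in $\mathbb H^2(f)$, left multiplications $M_{Z_i}$ by them are bounded on $\mathbb H^2(f)$, and $M_Z$ is in $\mathcal C_f^{SOT}(\mathbb H^2(f))$ or $\mathcal C_f^{rad}(\mathbb H^2(f))$ with $f_j(M_Z)=M_{f_j}$ for all $j$. In all cases $\{f_\alpha\}_{\alpha\in\mathbb F_n^+}$ is an orthonormal basis of $\mathbb H^2(f)$, and $M_Z$ is called the universal model. Writing $Z_i=\sum_\alpha a^{(i)}_\alpha f_\alpha$ in $\mathbb H^2(f)$, one has $M_{Z_i}f_\beta=\sum_\alpha a^{(i)}_\alpha f_{\alpha\beta}$, and $g_i:=\sum_\alpha a^{(i)}_\alpha Z_\alpha$ defines the inverse $g=(g_1,\ldots,g_n)$ of $f$ with respect to composition. Domain. $X\in B(\mathcal H)^n$ satisfies $g(f(X))=X$ if $X\in\mathcal C_f^{SOT}(\mathcal H)\cup\mathcal C_f^{rad}(\mathcal H)$ and either (for all $i$) $X_i=\sum_k\sum_{|\alpha|=k}a^{(i)}_\alpha[f(X)]_\alpha$ in the SOT, or (for all $i$) $X_i=\text{SOT-}\lim_{r\to1}\sum_k\sum_{|\alpha|=k}a^{(i)}_\alpha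 r^{|\alpha|}[f(X)]_\alpha$ (automatic in case (A)). Then $\mathbb B_f^<(\mathcal H):=\{X\in B(\mathcal H)^n:\ g(f(X))=X,\ \|f(X)\|<1\}$. $\mathcal M^{||}$ is the set of $f$ with the model property such that $M_Z$ is in the set of norm-convergence of $f$ (the series $f_j(M_Z)$ converge in operator norm) or of radial norm-convergence of $f$ (the series converge in norm at $rM_Z$ for $r<1$ close to $1$, and $f_j(M_Z)=\lim_{r\to1}f_j(rM_Z)$ in norm). Algebras. $H^\infty(\mathbb B_f)$ is the WOT-closure in $B(\mathbb H^2(f))$ of all noncommutative polynomials in $M_{Z_1},\ldots,M_{Z_n}$ and the identity. A bounded left multiplier of $\mathbb H^2(f)$ is an operator of left multiplication by some $\psi=\sum_\alpha c_\alpha f_\alpha\in\mathbb H^2(f)$, i.e. a bounded operator $M_\psi$ with $M_\psi f_\beta=\sum_\alpha c_\alpha f_{\alpha\beta}$ for all $\beta$. When $f\in\mathcal M^{||}$, a free holomorphic function on $\mathbb B_f^<(\mathcal H)$ is a map $F:\mathbb B_f^<(\mathcal H)\to B(\mathcal H)$ of the form $F(Y)=\sum_{k}\sum_{|\alpha|=k}c_\alpha[f(Y)]_\alpha$ with norm convergence for every $Y$; it is bounded if $\sup_Y\|F(Y)\|<\infty$. $F_n^\infty$ is the WOT-closed algebra generated by the identity and the left creation operators $S_ie_\alpha=e_{g_i\alpha}$ on the full Fock space $F^2(H_n)$ with orthonormal basis $\{e_\alpha\}_{\alpha\in\mathbb F_n^+}$; $\varphi=\sum_\alpha c_\alpha S_\alpha$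 denotes the Fourier representation of $\varphi\in F_n^\infty$, given by $\varphi e_{g_0}=\sum_\alpha c_\alpha e_\alpha$ (and $\varphi=\text{SOT-}\lim_{r\to1}\sum_k\sum_{|\alpha|=k}c_\alpha r^{|\alpha|}S_\alpha$). The identification in (ii) matches $\varphi\circ f$, where $\varphi=\sum c_\alpha Z_\alpha\in H^\infty_{\bf ball}$, with the operator $\text{SOT-}\lim_{r\to1}\sum_k\sum_{|\alpha|=k}c_\alpha r^{|\alpha|}[f(M_Z)]_\alpha$ in $H^\infty(\mathbb B_f)$. *)

theory Defs
  imports "HOL-Analysis.Analysis" "HOL-Library.Groups_Big_Fun"
begin

section \<open>Complex Hilbert spaces\<close>

class scaleC =
  fixes scaleC :: "complex \<Rightarrow> 'a \<Rightarrow> 'a"  (infixr \<open>*\<^sub>C\<close> 75)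

text \<open>The complex inner product is linear in its first argument; its real part is the inner
  product of the underlying real Hilbert space, so that both induce the same norm.\<close>

class chilbert_space = scaleC + real_inner + banach +
  fixes cinner :: "'a \<Rightarrow> 'a \<Rightarrow> complex"
  assumes scaleC_add_right: "c *\<^sub>C (x + y) = c *\<^sub>C x + c *\<^sub>C y"
    and scaleC_add_left: "(c + d) *\<^sub>C x = c *\<^sub>C x + d *\<^sub>C x"
    and scaleC_scaleC: "c *\<^sub>C (d *\<^sub>C x) = (c * d) *\<^sub>C x"
    and scaleR_scaleC: "r *\<^sub>R x = complex_of_real r *\<^sub>C x"
    and cinner_commute: "cinner x y = cnj (cinner y x)"
    and cinner_add_left: "cinner (x + y) z = cinner x z + cinner y z"
    and cinner_scaleC_left: "cinner (c *\<^sub>C x) y = c * cinner x y"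
    and inner_eq_Re_cinner: "inner x y = Re (cinner x y)"

lemma cinner_scaleC_right:
  fixes x y :: "'a::chilbert_space"
  shows "cinner x (c *\<^sub>C y) = cnj c * cinner x y"
  by (metis cinner_commute cinner_scaleC_left complex_cnj_mult)

lemma norm_scaleC:
  fixes x :: "'a::chilbert_space"
  shows "norm (c *\<^sub>C x) = cmod c * norm x"
proof -
  have "inner (c *\<^sub>C x) (c *\<^sub>C x) = Re ((c * cnj c) * cinner x x)"
    by (simp only: inner_eq_Re_cinner cinner_scaleC_left cinner_scaleC_right mult_ac)
  also have "\<dots> = (cmod c)\<^sup>2 * inner x x"
    by (simp only: complex_norm_square[symmetric] inner_eq_Re_cinner times_complex.sel
        Re_complex_of_real Im_complex_of_real mult_zero_left diff_zero)
  finally show ?thesis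
    by (simp add: norm_eq_sqrt_inner real_sqrt_mult)
qed

lemma bounded_linear_scaleC:
  "bounded_linear (\<lambda>x::'a::chilbert_space. c *\<^sub>C x)"
proof (rule bounded_linear_intro[where K = "cmod c"])
  fix x y :: 'a and r :: real
  show "c *\<^sub>C (x + y) = c *\<^sub>C x + c *\<^sub>C y" by (rule scaleC_add_right)
  show "c *\<^sub>C (r *\<^sub>R x) = r *\<^sub>R (c *\<^sub>C x)"
    by (simp add: scaleR_scaleC scaleC_scaleC mult.commute)
  show "norm (c *\<^sub>C x) \<le> norm x * cmod c" by (simp add: norm_scaleC mult.commute)
qed

instantiation blinfun :: (real_normed_vector, chilbert_space) scaleC
begin

lift_definition scaleC_blinfun :: "complex \<Rightarrow> 'a \<Rightarrow>\<^sub>L 'b \<Rightarrow> 'a \<Rightarrow>\<^sub>L 'b"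
  is "\<lambda>c A x. c *\<^sub>C A x"
  by (rule bounded_linear_compose[OF bounded_linear_scaleC])

instance ..

end


section \<open>The Hilbert space of square-summable families\<close>

typedef 'a ell2 = "{x :: 'a \<Rightarrow> complex. (\<lambda>i. (cmod (x i))\<^sup>2) summable_on UNIV}"
  morphisms ell2_coeff Abs_ell2
  by (rule exI[of _ "\<lambda>_. 0"]) simp

setup_lifting type_definition_ell2

lemma ell2_coeff_summable: "(\<lambda>i. (cmod (ell2_coeff x i))\<^sup>2) summable_on UNIV"
  using ell2_coeff[of x] by simp

lemma ell2_mult_summable:
  assumes "(\<lambda>i. (cmod (x i))\<^sup>2) summable_on UNIV" "(\<lambda>i. (cmod (y i))\<^sup>2) summable_on UNIV"
  shows "(\<lambda>i. x i * cnj (y i)) summable_on (UNIV :: 'a set)"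
proof -
  have "(\<lambda>i. (cmod (x i))\<^sup>2 + (cmod (y i))\<^sup>2) summable_on UNIV"
    by (intro summable_on_add assms)
  then have "(\<lambda>i. norm (x i * cnj (y i))) summable_on UNIV"
  proof (rule summable_on_comparison_test)
    fix i
    have "2 * (cmod (x i) * cmod (y i)) \<le> (cmod (x i))\<^sup>2 + (cmod (y i))\<^sup>2"
      using sum_squares_bound[of "cmod (x i)" "cmod (y i)"] by simp
    moreover have "0 \<le> cmod (x i) * cmod (y i)" by simp
    ultimately show "norm (x i * cnj (y i)) \<le> (cmod (x i))\<^sup>2 + (cmod (y i))\<^sup>2"
      unfolding norm_mult complex_mod_cnj by linarith
  qed simp
  then show ?thesis by (rule abs_summable_summable)
qed

lemma ell2_add_summable:
  assumes "(\<lambda>i. (cmod (x i))\<^sup>2) summable_on UNIV" "(\<lambda>i. (cmod (y i))\<^sup>2) summable_on UNIV"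
  shows "(\<lambda>i. (cmod (x i + y i))\<^sup>2) summable_on (UNIV :: 'a set)"
proof -
  have "(\<lambda>i. 2 * ((cmod (x i))\<^sup>2 + (cmod (y i))\<^sup>2)) summable_on UNIV"
    by (intro summable_on_cmult_right summable_on_add assms)
  then show ?thesis
  proof (rule summable_on_comparison_test)
    fix i
    have "(cmod (x i + y i))\<^sup>2 \<le> (cmod (x i) + cmod (y i))\<^sup>2"
      by (intro power_mono norm_triangle_ineq) simp
    also have "\<dots> \<le> 2 * ((cmod (x i))\<^sup>2 + (cmod (y i))\<^sup>2)"
      using sum_squares_bound[of "cmod (x i)" "cmod (y i)"] by (simp add: power2_sum)
    finally show "(cmod (x i + y i))\<^sup>2 \<le> 2 * ((cmod (x i))\<^sup>2 + (cmod (y i))\<^sup>2)" .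
  qed simp
qed

lemma ell2_scale_summable:
  assumes "(\<lambda>i. (cmod (x i))\<^sup>2) summable_on UNIV"
  shows "(\<lambda>i. (cmod (c * x i))\<^sup>2) summable_on (UNIV :: 'a set)"
  using summable_on_cmult_right[OF assms, of "(cmod c)\<^sup>2"]
  by (simp add: norm_mult power_mult_distrib)

instantiation ell2 :: (type) scaleC
begin

lift_definition scaleC_ell2 :: "complex \<Rightarrow> 'a ell2 \<Rightarrow> 'a ell2" is "\<lambda>c x i. c * x i"
  by (rule ell2_scale_summable)

instance ..

end

instantiation ell2 :: (type) real_vector
begin

lift_definition zero_ell2 :: "'a ell2" is "\<lambda>_. 0" by simp

lift_definition plus_ell2 :: "'a ell2 \<Rightarrow> 'a ell2 \<Rightarrow> 'a ell2" is "\<lambda>x y i. x i + y i"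
  by (rule ell2_add_summable)

lift_definition uminus_ell2 :: "'a ell2 \<Rightarrow> 'a ell2" is "\<lambda>x i. - x i" by simp

lift_definition minus_ell2 :: "'a ell2 \<Rightarrow> 'a ell2 \<Rightarrow> 'a ell2" is "\<lambda>x y i. x i - y i"
proof -
  fix x y :: "'a \<Rightarrow> complex"
  assume "(\<lambda>i. (cmod (x i))\<^sup>2) summable_on UNIV" "(\<lambda>i. (cmod (y i))\<^sup>2) summable_on UNIV"
  then show "(\<lambda>i. (cmod (x i - y i))\<^sup>2) summable_on UNIV"
    using ell2_add_summable[of x "\<lambda>i. - y i"] by simp
qed

lift_definition scaleR_ell2 :: "real \<Rightarrow> 'a ell2 \<Rightarrow> 'a ell2" is "\<lambda>r x i. complex_of_real r * x i"
  by (rule ell2_scale_summable)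

instance
  by standard (transfer; simp add: algebra_simps)+

end

lemma ell2_coeff_simps [simp]:
  "ell2_coeff 0 i = 0"
  "ell2_coeff (x + y) i = ell2_coeff x i + ell2_coeff y i"
  "ell2_coeff (x - y) i = ell2_coeff x i - ell2_coeff y i"
  "ell2_coeff (- x) i = - ell2_coeff x i"
  "ell2_coeff (c *\<^sub>C x) i = c * ell2_coeff x i"
  "ell2_coeff (r *\<^sub>R x) i = complex_of_real r * ell2_coeff x i"
  by (transfer; simp)+

lemma ell2_eqI: "(\<And>i. ell2_coeff x i = ell2_coeff y i) \<Longrightarrow> x = y"
  by (metis ell2_coeff_inject ext)

definition cinner_ell2_aux :: "'a ell2 \<Rightarrow> 'a ell2 \<Rightarrow> complex"
  where "cinner_ell2_aux x y = (\<Sum>\<^sub>\<infinity>i. ell2_coeff x i * cnj (ell2_coeff y i))"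

lemma cinner_ell2_aux_commute: "cinner_ell2_aux x y = cnj (cinner_ell2_aux y x)"
  unfolding cinner_ell2_aux_def infsum_cnj[symmetric] by (simp add: mult.commute)

lemma cinner_ell2_aux_add: "cinner_ell2_aux (x + y) z = cinner_ell2_aux x z + cinner_ell2_aux y z"
  unfolding cinner_ell2_aux_def
  by (simp add: distrib_right infsum_add ell2_mult_summable ell2_coeff_summable)

lemma cinner_ell2_aux_scale: "cinner_ell2_aux (c *\<^sub>C x) y = c * cinner_ell2_aux x y"
  unfolding cinner_ell2_aux_def by (simp add: mult.assoc infsum_cmult_right')

lemma scaleR_ell2: "r *\<^sub>R (x :: 'a ell2) = complex_of_real r *\<^sub>C x"
  by (rule ell2_eqI) simp

lemma Re_cinner_ell2_aux_self:
  "Re (cinner_ell2_aux x x) = (\<Sum>\<^sub>\<infinity>i. (cmod (ell2_coeff x i))\<^sup>2)"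
proof -
  have "Re (ell2_coeff x i * cnj (ell2_coeff x i)) = (cmod (ell2_coeff x i))\<^sup>2" for i
    by (subst complex_norm_square[symmetric]) simp
  moreover have "(\<lambda>i. ell2_coeff x i * cnj (ell2_coeff x i)) summable_on UNIV"
    by (intro ell2_mult_summable ell2_coeff_summable)
  ultimately show ?thesis
    unfolding cinner_ell2_aux_def by (subst infsum_Re[symmetric]) simp_all
qed

instantiation ell2 :: (type) real_inner
begin

definition inner_ell2 :: "'a ell2 \<Rightarrow> 'a ell2 \<Rightarrow> real"
  where "inner_ell2 x y = Re (cinner_ell2_aux x y)"

definition norm_ell2 :: "'a ell2 \<Rightarrow> real"
  where "norm_ell2 x = sqrt (inner x x)"

definition sgn_ell2 :: "'a ell2 \<Rightarrow> 'a ell2"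
  where "sgn_ell2 x = x /\<^sub>R norm x"

definition dist_ell2 :: "'a ell2 \<Rightarrow> 'a ell2 \<Rightarrow> real"
  where "dist_ell2 x y = norm (x - y)"

definition uniformity_ell2 :: "('a ell2 \<times> 'a ell2) filter"
  where "uniformity_ell2 = (INF e\<in>{0<..}. principal {(x, y). dist x y < e})"

definition open_ell2 :: "'a ell2 set \<Rightarrow> bool"
  where "open_ell2 U \<longleftrightarrow> (\<forall>x\<in>U. \<forall>\<^sub>F (x', y) in uniformity. x' = x \<longrightarrow> y \<in> U)"

instance
proof
  fix x y z :: "'a ell2" and r :: real and U :: "'a ell2 set"
  show "dist x y = norm (x - y)" by (rule dist_ell2_def)
  show "sgn x = x /\<^sub>R norm x" by (rule sgn_ell2_def)
  show "uniformity = (INF e\<in>{0<..}. principal {(x :: 'a ell2, y). dist x y < e})"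
    by (rule uniformity_ell2_def)
  show "open U \<longleftrightarrow> (\<forall>x\<in>U. \<forall>\<^sub>F (x', y) in uniformity. x' = x \<longrightarrow> y \<in> U)"
    by (rule open_ell2_def)
  show "inner x y = inner y x"
    unfolding inner_ell2_def by (subst cinner_ell2_aux_commute) simp
  show "inner (x + y) z = inner x z + inner y z"
    by (simp add: inner_ell2_def cinner_ell2_aux_add)
  show "inner (r *\<^sub>R x) y = r * inner x y"
    by (simp add: inner_ell2_def scaleR_ell2 cinner_ell2_aux_scale)
  show "0 \<le> inner x x"
    by (simp add: inner_ell2_def Re_cinner_ell2_aux_self infsum_nonneg)
  show "inner x x = 0 \<longleftrightarrow> x = 0"
  proof
    assume "inner x x = 0"
    then have *: "(\<Sum>\<^sub>\<infinity>i. (cmod (ell2_coeff x i))\<^sup>2) \<le> 0"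
      by (simp add: inner_ell2_def Re_cinner_ell2_aux_self)
    have "(cmod (ell2_coeff x i))\<^sup>2 = 0" for i
      by (rule nonneg_infsum_le_0D[OF * ell2_coeff_summable]) simp_all
    then show "x = 0" by (intro ell2_eqI) simp
  qed (simp add: inner_ell2_def Re_cinner_ell2_aux_self)
  show "norm x = sqrt (inner x x)" by (rule norm_ell2_def)
qed

end

lemma norm_ell2_squared: "(norm x)\<^sup>2 = (\<Sum>\<^sub>\<infinity>i. (cmod (ell2_coeff x i))\<^sup>2)"
  by (simp add: power2_norm_eq_inner inner_ell2_def Re_cinner_ell2_aux_self)

lemma sum_ell2_coeff_le: "finite F \<Longrightarrow> (\<Sum>i\<in>F. (cmod (ell2_coeff x i))\<^sup>2) \<le> (norm x)\<^sup>2"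
  unfolding norm_ell2_squared
  by (rule finite_sum_le_infsum[OF ell2_coeff_summable]) simp_all

lemma cmod_ell2_coeff_le: "cmod (ell2_coeff x i) \<le> norm x"
  using sum_ell2_coeff_le[of "{i}" x] by (simp add: power2_le_iff_abs_le)

instance ell2 :: (type) banach
proof
  fix X :: "nat \<Rightarrow> 'a ell2"
  assume X: "Cauchy X"
  define l where "l i = lim (\<lambda>m. ell2_coeff (X m) i)" for i
  have "Cauchy (\<lambda>m. ell2_coeff (X m) i)" for i
  proof (rule metric_CauchyI)
    fix e :: real assume "0 < e"
    obtain N where N: "\<And>m n. N \<le> m \<Longrightarrow> N \<le> n \<Longrightarrow> dist (X m) (X n) < e"
      using metric_CauchyD[OF X \<open>0 < e\<close>] by blast
    have "dist (ell2_coeff (X m) i) (ell2_coeff (X n) i) < e" if "N \<le> m" "N \<le> n" for m n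
      using cmod_ell2_coeff_le[of "X m - X n" i] N[OF that] by (simp add: dist_norm)
    then show "\<exists>N. \<forall>m\<ge>N. \<forall>n\<ge>N. dist (ell2_coeff (X m) i) (ell2_coeff (X n) i) < e"
      by blast
  qed
  then have l: "(\<lambda>m. ell2_coeff (X m) i) \<longlonglongrightarrow> l i" for i
    unfolding l_def by (intro Cauchy_convergent convergent_LIMSEQ_iff[THEN iffD1])
  have fin: "\<exists>N. \<forall>m\<ge>N. \<forall>F. finite F \<longrightarrow> (\<Sum>i\<in>F. (cmod (ell2_coeff (X m) i - l i))\<^sup>2) \<le> e\<^sup>2"
    if "0 < e" for e :: real
  proof -
    obtain N where N: "\<And>m n. N \<le> m \<Longrightarrow> N \<le> n \<Longrightarrow> dist (X m) (X n) < e"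
      using metric_CauchyD[OF X \<open>0 < e\<close>] by blast
    have "(\<Sum>i\<in>F. (cmod (ell2_coeff (X m) i - l i))\<^sup>2) \<le> e\<^sup>2" if "N \<le> m" "finite F" for m F
    proof (rule tendsto_upperbound)
      show "(\<lambda>n. \<Sum>i\<in>F. (cmod (ell2_coeff (X m) i - ell2_coeff (X n) i))\<^sup>2)
          \<longlonglongrightarrow> (\<Sum>i\<in>F. (cmod (ell2_coeff (X m) i - l i))\<^sup>2)"
        by (intro tendsto_intros l)
      show "\<forall>\<^sub>F n in sequentially.
          (\<Sum>i\<in>F. (cmod (ell2_coeff (X m) i - ell2_coeff (X n) i))\<^sup>2) \<le> e\<^sup>2"
      proof (rule eventually_sequentiallyI[of N])
        fix n assume "N \<le> n"
        then have "(norm (X m - X n))\<^sup>2 \<le> e\<^sup>2"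
          using N[OF \<open>N \<le> m\<close> \<open>N \<le> n\<close>] by (intro power_mono) (simp_all add: dist_norm)
        then show "(\<Sum>i\<in>F. (cmod (ell2_coeff (X m) i - ell2_coeff (X n) i))\<^sup>2) \<le> e\<^sup>2"
          using sum_ell2_coeff_le[OF \<open>finite F\<close>, of "X m - X n"] by simp
      qed
    qed simp
    then show ?thesis by blast
  qed
  have summable: "(\<lambda>i. (cmod (ell2_coeff (X m) i - l i))\<^sup>2) summable_on UNIV"
    if "\<forall>F. finite F \<longrightarrow> (\<Sum>i\<in>F. (cmod (ell2_coeff (X m) i - l i))\<^sup>2) \<le> e" for m e
    using that by (intro nonneg_bdd_above_summable_on bdd_aboveI[of _ e]) auto
  obtain m where "\<forall>F. finite F \<longrightarrow> (\<Sum>i\<in>F. (cmod (ell2_coeff (X m) i - l i))\<^sup>2) \<le> 1\<^sup>2"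
    using fin[of 1] by auto
  then have "(\<lambda>i. (cmod (- 1 * (ell2_coeff (X m) i - l i)))\<^sup>2) summable_on UNIV"
    by (intro ell2_scale_summable summable)
  from ell2_add_summable[OF ell2_coeff_summable[of "X m"] this]
  have "(\<lambda>i. (cmod (l i))\<^sup>2) summable_on UNIV" by simp
  then have L: "ell2_coeff (Abs_ell2 l) = l"
    by (intro Abs_ell2_inverse) simp
  have "X \<longlonglongrightarrow> Abs_ell2 l"
  proof (rule metric_LIMSEQ_I)
    fix e :: real assume "0 < e"
    then obtain N where N: "\<And>m F. N \<le> m \<Longrightarrow> finite F
        \<Longrightarrow> (\<Sum>i\<in>F. (cmod (ell2_coeff (X m) i - l i))\<^sup>2) \<le> (e / 2)\<^sup>2"
      using fin[of "e / 2"] by auto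
    have "dist (X m) (Abs_ell2 l) < e" if "N \<le> m" for m
    proof -
      have "(norm (X m - Abs_ell2 l))\<^sup>2 \<le> (e / 2)\<^sup>2"
        unfolding norm_ell2_squared using N[OF that] L
        by (intro infsum_le_finite_sums ell2_coeff_summable) auto
      then have "norm (X m - Abs_ell2 l) \<le> e / 2"
        by (rule power2_le_imp_le) (use \<open>0 < e\<close> in simp)
      then show ?thesis using \<open>0 < e\<close> by (simp add: dist_norm)
    qed
    then show "\<exists>N. \<forall>m\<ge>N. dist (X m) (Abs_ell2 l) < e" by blast
  qed
  then show "convergent X" by (rule convergentI)
qed

instantiation ell2 :: (type) chilbert_space
begin

definition cinner_ell2 :: "'a ell2 \<Rightarrow> 'a ell2 \<Rightarrow> complex"
  where "cinner_ell2 x y = (\<Sum>\<^sub>\<infinity>i. ell2_coeff x i * cnj (ell2_coeff y i))"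

instance
proof
  fix x y z :: "'a ell2" and c d :: complex and r :: real
  have aux: "cinner = (cinner_ell2_aux :: 'a ell2 \<Rightarrow> _)"
    by (simp add: fun_eq_iff cinner_ell2_def cinner_ell2_aux_def)
  show "c *\<^sub>C (x + y) = c *\<^sub>C x + c *\<^sub>C y" "(c + d) *\<^sub>C x = c *\<^sub>C x + d *\<^sub>C x"
    "c *\<^sub>C (d *\<^sub>C x) = (c * d) *\<^sub>C x"
    by (rule ell2_eqI; simp add: algebra_simps)+
  show "r *\<^sub>R x = complex_of_real r *\<^sub>C x" by (rule scaleR_ell2)
  show "cinner x y = cnj (cinner y x)" unfolding aux by (rule cinner_ell2_aux_commute)
  show "cinner (x + y) z = cinner x z + cinner y z" unfolding aux by (rule cinner_ell2_aux_add)
  show "cinner (c *\<^sub>C x) y = c * cinner x y" unfolding aux by (rule cinner_ell2_aux_scale)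
  show "inner x y = Re (cinner x y)" unfolding aux by (rule inner_ell2_def)
qed

end

lift_definition ell2_basis :: "'a \<Rightarrow> 'a ell2" is "\<lambda>i j. if j = i then 1 else 0"
proof -
  fix i :: 'a
  have "(\<lambda>j. (cmod (if j = i then 1 else 0))\<^sup>2) summable_on {i}" by simp
  then show "(\<lambda>j. (cmod (if j = i then 1 else 0))\<^sup>2) summable_on UNIV"
    by (rule summable_on_cong_neutral[THEN iffD1, rotated -1]) auto
qed

lemma infsum_Cons_shift:
  fixes g :: "'a list \<Rightarrow> real" and i :: 'a
  assumes "\<And>v. g v \<ge> 0" "g summable_on UNIV"
  defines "h \<equiv> \<lambda>w. case w of [] \<Rightarrow> 0 | j # v \<Rightarrow> if j = i then g v else 0"
  shows "h summable_on UNIV" "infsum h UNIV = infsum g UNIV"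
proof -
  have 1: "(h summable_on range ((#) i)) = (h summable_on UNIV)"
    by (rule summable_on_cong_neutral) (auto simp: h_def split: list.splits)
  have 2: "infsum h (range ((#) i)) = infsum h UNIV"
    by (rule infsum_cong_neutral) (auto simp: h_def split: list.splits)
  have comp: "h \<circ> (#) i = g"
    by (auto simp: h_def fun_eq_iff)
  show "h summable_on UNIV"
    using assms(2) summable_on_reindex[of "(#) i" UNIV h] by (simp add: 1 comp)
  show "infsum h UNIV = infsum g UNIV"
    using infsum_reindex[of "(#) i" UNIV h] by (simp add: 2 comp)
qed

lift_definition ell2_shift :: "'n \<Rightarrow> 'n list ell2 \<Rightarrow> 'n list ell2"
  is "\<lambda>i x w. case w of [] \<Rightarrow> 0 | j # v \<Rightarrow> if j = i then x v else 0"
proof -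
  fix i :: 'n and x :: "'n list \<Rightarrow> complex"
  assume x: "(\<lambda>w. (cmod (x w))\<^sup>2) summable_on UNIV"
  have "(\<lambda>w. (cmod (case w of [] \<Rightarrow> 0 | j # v \<Rightarrow> if j = i then x v else 0))\<^sup>2)
      = (\<lambda>w. case w of [] \<Rightarrow> 0 | j # v \<Rightarrow> if j = i then (cmod (x v))\<^sup>2 else 0)"
    by (auto simp: fun_eq_iff split: list.splits)
  then show "(\<lambda>w. (cmod (case w of [] \<Rightarrow> 0 | j # v \<Rightarrow> if j = i then x v else 0))\<^sup>2)
      summable_on UNIV"
    using infsum_Cons_shift(1)[OF _ x] by simp
qed

lemma norm_ell2_shift: "norm (ell2_shift i x) = norm x"
proof -
  have "(norm (ell2_shift i x))\<^sup>2 = (norm x)\<^sup>2"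
    unfolding norm_ell2_squared
    by (subst infsum_Cons_shift(2)[OF _ ell2_coeff_summable, of x i, symmetric, simplified])
      (auto simp: ell2_shift.rep_eq intro!: infsum_cong split: list.splits)
  then show ?thesis by simp
qed

text \<open>The left creation operator \<open>S\<^sub>i\<close> on the full Fock space, i.e. \<open>S\<^sub>i e\<^sub>\<alpha> = e\<^bsub>g\<^sub>i \<alpha>\<^esub>\<close>.\<close>

lift_definition left_creation :: "'n \<Rightarrow> 'n list ell2 \<Rightarrow>\<^sub>L 'n list ell2" is ell2_shift
proof (rule bounded_linear_intro[where K = 1])
  fix i :: 'n and x y :: "'n list ell2" and r :: real
  show "ell2_shift i (x + y) = ell2_shift i x + ell2_shift i y"
    by (rule ell2_eqI) (simp add: ell2_shift.rep_eq split: list.splits)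
  show "ell2_shift i (r *\<^sub>R x) = r *\<^sub>R ell2_shift i x"
    by (rule ell2_eqI) (simp add: ell2_shift.rep_eq split: list.splits)
  show "norm (ell2_shift i x) \<le> norm x * 1"
    by (simp add: norm_ell2_shift)
qed

lemma left_creation_basis: "left_creation i (ell2_basis w) = ell2_basis (i # w)"
  by (rule ell2_eqI)
    (simp add: left_creation.rep_eq ell2_shift.rep_eq ell2_basis.rep_eq split: list.splits)


section \<open>Formal power series in noncommuting indeterminates\<close>

text \<open>The free semigroup on \<open>n\<close> generators is the type \<open>'n list\<close> over a finite index type, the
  product being concatenation. A series \<open>\<Sum>\<^sub>\<alpha> c\<^sub>\<alpha> Z\<^sub>\<alpha>\<close> is its coefficient function.\<close>

type_synonym 'n ncps = "'n list \<Rightarrow> complex"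

definition ncps_one :: "'n ncps"
  where "ncps_one w = (if w = [] then 1 else 0)"

definition ncps_var :: "'n \<Rightarrow> 'n ncps"
  where "ncps_var i w = (if w = [i] then 1 else 0)"

definition ncps_mult :: "'n ncps \<Rightarrow> 'n ncps \<Rightarrow> 'n ncps"
  where "ncps_mult p q w = (\<Sum>k\<le>length w. p (take k w) * q (drop k w))"

definition ncps_word :: "('n \<Rightarrow> 'n ncps) \<Rightarrow> 'n list \<Rightarrow> 'n ncps"
  where "ncps_word f \<alpha> = foldr (\<lambda>i. ncps_mult (f i)) \<alpha> ncps_one"

text \<open>The series \<open>\<Sum>\<^sub>\<alpha> a\<^sub>\<alpha> f\<^sub>\<alpha>\<close>. It is only used when either \<open>a\<close> is a polynomial or \<open>f(0) = 0\<close>; in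
  both cases every coefficient is a finite sum, which is what \<^const>\<open>Sum_any\<close> computes.\<close>

definition ncps_compose :: "'n ncps \<Rightarrow> ('n \<Rightarrow> 'n ncps) \<Rightarrow> 'n ncps"
  where "ncps_compose a f w = Sum_any (\<lambda>\<alpha>. a \<alpha> * ncps_word f \<alpha> w)"

definition nc_polynomial :: "'n ncps \<Rightarrow> bool"
  where "nc_polynomial p \<longleftrightarrow> finite {\<alpha>. p \<alpha> \<noteq> 0}"

definition ncps_radius :: "'n::finite ncps \<Rightarrow> ereal"
  where "ncps_radius c =
    inverse (limsup (\<lambda>k. ereal (root (2 * k) (\<Sum>\<alpha> | length \<alpha> = k. (cmod (c \<alpha>))\<^sup>2))))"


section \<open>Tuples of operators\<close>

text \<open>The type of continuous real-linear maps is provided by the library; the bounded operators of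
  a complex Hilbert space are the complex-linear ones among them.\<close>

definition BH :: "('h::chilbert_space \<Rightarrow>\<^sub>L 'h) set"
  where "BH = {A. \<forall>c x. blinfun_apply A (c *\<^sub>C x) = c *\<^sub>C blinfun_apply A x}"

definition weak_operator_topology :: "('h::chilbert_space \<Rightarrow>\<^sub>L 'h) topology"
  where "weak_operator_topology =
    pullback_topology UNIV (\<lambda>A (x, y). cinner (blinfun_apply A x) y) euclidean"

definition op_word :: "('n \<Rightarrow> 'h::real_normed_vector \<Rightarrow>\<^sub>L 'h) \<Rightarrow> 'n list \<Rightarrow> 'h \<Rightarrow>\<^sub>L 'h"
  where "op_word X \<alpha> = foldr (\<lambda>i A. X i o\<^sub>L A) \<alpha> id_blinfun"

text \<open>\<^const>\<open>adjoint\<close> refers to the real inner product; for complex-linear operators it is the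
  Hilbert space adjoint, since the real inner product is the real part of the complex one.\<close>

definition row_norm :: "('n::finite \<Rightarrow> 'h::chilbert_space \<Rightarrow>\<^sub>L 'h) \<Rightarrow> real"
  where "row_norm X = sqrt (onorm (\<lambda>x. \<Sum>i\<in>UNIV. X i (adjoint (blinfun_apply (X i)) x)))"

definition op_ball :: "real \<Rightarrow> ('n::finite \<Rightarrow> 'h::chilbert_space \<Rightarrow>\<^sub>L 'h) set"
  where "op_ball \<gamma> = {X. (\<forall>i. X i \<in> BH) \<and> row_norm X < \<gamma>}"

definition nc_term :: "'n::finite ncps \<Rightarrow> ('n \<Rightarrow> 'h::chilbert_space \<Rightarrow>\<^sub>L 'h) \<Rightarrow> nat \<Rightarrow> 'h \<Rightarrow>\<^sub>L 'h"
  where "nc_term c X k = (\<Sum>\<alpha> | length \<alpha> = k. c \<alpha> *\<^sub>C op_word X \<alpha>)"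

text \<open>Evaluation of a series by norm convergence.\<close>

definition nc_eval :: "'n::finite ncps \<Rightarrow> ('n \<Rightarrow> 'h::chilbert_space \<Rightarrow>\<^sub>L 'h) \<Rightarrow> 'h \<Rightarrow>\<^sub>L 'h"
  where "nc_eval c X = suminf (nc_term c X)"

definition sot_sums :: "'n::finite ncps \<Rightarrow> ('n \<Rightarrow> 'h::chilbert_space \<Rightarrow>\<^sub>L 'h) \<Rightarrow> ('h \<Rightarrow>\<^sub>L 'h) \<Rightarrow> bool"
  where "sot_sums c X L \<longleftrightarrow>
    limitin strong_operator_topology (\<lambda>N. \<Sum>k<N. nc_term c X k) L sequentially"

definition radially_summable :: "'n::finite ncps \<Rightarrow> ('n \<Rightarrow> 'h::chilbert_space \<Rightarrow>\<^sub>L 'h) \<Rightarrow> bool"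
  where "radially_summable c X \<longleftrightarrow>
    (\<exists>\<delta>. 0 < \<delta> \<and> \<delta> < 1 \<and> (\<forall>r. \<delta> < r \<and> r < 1 \<longrightarrow> summable (nc_term c (\<lambda>i. r *\<^sub>R X i))))"

definition rad_sums :: "'n::finite ncps \<Rightarrow> ('n \<Rightarrow> 'h::chilbert_space \<Rightarrow>\<^sub>L 'h) \<Rightarrow> ('h \<Rightarrow>\<^sub>L 'h) \<Rightarrow> bool"
  where "rad_sums c X L \<longleftrightarrow> radially_summable c X \<and>
    limitin strong_operator_topology (\<lambda>r. nc_eval c (\<lambda>i. r *\<^sub>R X i)) L (at_left 1)"

text \<open>\<open>L\<close> is the limit in the strong operator topology, as \<open>r \<rightarrow> 1\<close>, of the norm-convergent series
  \<open>\<Sum>\<^sub>k \<Sum>\<^bsub>|\<alpha>| = k\<^esub> c\<^sub>\<alpha> r\<^bsup>|\<alpha>|\<^esup> X\<^sub>\<alpha>\<close>, \<open>0 \<le> r < 1\<close>.\<close>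

definition abel_sums :: "'n::finite ncps \<Rightarrow> ('n \<Rightarrow> 'h::chilbert_space \<Rightarrow>\<^sub>L 'h) \<Rightarrow> ('h \<Rightarrow>\<^sub>L 'h) \<Rightarrow> bool"
  where "abel_sums c X L \<longleftrightarrow>
    (\<forall>r. 0 \<le> r \<and> r < 1 \<longrightarrow> summable (nc_term (\<lambda>\<alpha>. c \<alpha> * complex_of_real r ^ length \<alpha>) X)) \<and>
    limitin strong_operator_topology
      (\<lambda>r. nc_eval (\<lambda>\<alpha>. c \<alpha> * complex_of_real r ^ length \<alpha>) X) L (at_left 1)"

definition conv_sot :: "('n::finite \<Rightarrow> 'n ncps) \<Rightarrow> ('n \<Rightarrow> 'h::chilbert_space \<Rightarrow>\<^sub>L 'h) set"
  where "conv_sot f = {X. (\<forall>i. X i \<in> BH) \<and> (\<forall>j. \<exists>L. sot_sums (f j) X L)}"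

definition conv_rad :: "('n::finite \<Rightarrow> 'n ncps) \<Rightarrow> ('n \<Rightarrow> 'h::chilbert_space \<Rightarrow>\<^sub>L 'h) set"
  where "conv_rad f = {X. (\<forall>i. X i \<in> BH) \<and> (\<forall>j. \<exists>L. rad_sums (f j) X L)}"

text \<open>The value \<open>f(X)\<close> on \<open>conv_sot f \<union> conv_rad f\<close>. On the intersection both prescriptions agree, by
  Abel's theorem.\<close>

definition tuple_value ::
    "('n::finite \<Rightarrow> 'n ncps) \<Rightarrow> ('n \<Rightarrow> 'h::chilbert_space \<Rightarrow>\<^sub>L 'h) \<Rightarrow> 'n \<Rightarrow> 'h \<Rightarrow>\<^sub>L 'h"
  where "tuple_value f X j =
    (if X \<in> conv_sot f then THE L. sot_sums (f j) X L else THE L. rad_sums (f j) X L)"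


section \<open>The model property\<close>

text \<open>Since \<open>{f\<^sub>\<alpha>}\<close> is an orthonormal basis of \<open>\<H>\<^sup>2(f)\<close>, an element \<open>\<Sum>\<^sub>\<alpha> b\<^sub>\<alpha> f\<^sub>\<alpha>\<close> is represented by its
  square-summable coordinates \<open>b\<close>, and \<open>f\<^sub>\<alpha>\<close> by \<open>ell2_basis \<alpha>\<close>. The object which \<open>b\<close> stands for is
  the polynomial \<open>ncps_compose b f\<close> for finitely supported \<open>b\<close> in case (A), the
  formal power series \<open>ncps_compose b f\<close> in case (S), and the function \<open>X \<mapsto> nc_eval b (f(X))\<close>, that
  is \<open>G \<circ> f\<close> with \<open>G = \<Sum>\<^sub>\<alpha> b\<^sub>\<alpha> Z\<^sub>\<alpha>\<close>, in case (F).

  In the three predicates below, \<open>a i\<close> are the coordinates of \<open>Z\<^sub>i\<close>, and \<open>M i\<close> is the bounded operator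
  of left multiplication by \<open>Z\<^sub>i\<close>.\<close>

definition model_A ::
    "('n::finite \<Rightarrow> 'n ncps) \<Rightarrow> ('n \<Rightarrow> 'n list ell2) \<Rightarrow> ('n \<Rightarrow> 'n list ell2 \<Rightarrow>\<^sub>L 'n list ell2) \<Rightarrow> bool"
  where "model_A f a M \<longleftrightarrow>
    (\<forall>j. nc_polynomial (f j)) \<and>
    (\<exists>g. (\<forall>j. nc_polynomial (g j)) \<and>
      (\<forall>j. ncps_compose (f j) g = ncps_var j \<and> ncps_compose (g j) f = ncps_var j)) \<and>
    (\<forall>i. nc_polynomial (ell2_coeff (a i)) \<and> ncps_compose (ell2_coeff (a i)) f = ncps_var i) \<and>
    (\<forall>i. M i \<in> BH) \<and>
    (\<forall>i b. nc_polynomial (ell2_coeff b) \<longrightarrow>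
      nc_polynomial (ell2_coeff (M i b)) \<and>
      ncps_compose (ell2_coeff (M i b)) f = ncps_mult (ncps_var i) (ncps_compose (ell2_coeff b) f))"

definition model_S ::
    "('n::finite \<Rightarrow> 'n ncps) \<Rightarrow> ('n \<Rightarrow> 'n list ell2) \<Rightarrow> ('n \<Rightarrow> 'n list ell2 \<Rightarrow>\<^sub>L 'n list ell2) \<Rightarrow> bool"
  where "model_S f a M \<longleftrightarrow>
    (\<forall>j. f j [] = 0 \<and> ncps_radius (f j) > 0) \<and>
    det (\<chi> i j. f i [j]) \<noteq> 0 \<and>
    (\<forall>i. ncps_compose (ell2_coeff (a i)) f = ncps_var i) \<and>
    (\<forall>i. M i \<in> BH) \<and>
    (\<forall>i b. ncps_compose (ell2_coeff (M i b)) f =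
      ncps_mult (ncps_var i) (ncps_compose (ell2_coeff b) f)) \<and>
    M \<in> conv_sot f \<union> conv_rad f \<and>
    (\<forall>j b. ncps_compose (ell2_coeff (tuple_value f M j b)) f =
      ncps_mult (f j) (ncps_compose (ell2_coeff b) f))"

definition model_F ::
    "'h::chilbert_space itself \<Rightarrow>
      ('n::finite \<Rightarrow> 'n ncps) \<Rightarrow> ('n \<Rightarrow> 'n list ell2) \<Rightarrow> ('n \<Rightarrow> 'n list ell2 \<Rightarrow>\<^sub>L 'n list ell2) \<Rightarrow> bool"
  where "model_F _ f a M \<longleftrightarrow> (\<exists>\<gamma>>0.
    let ball = (op_ball \<gamma> :: ('n \<Rightarrow> 'h \<Rightarrow>\<^sub>L 'h) set); F = (\<lambda>X j. nc_eval (f j) X) in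
    (\<forall>j. ereal \<gamma> \<le> ncps_radius (f j)) \<and>
    (\<forall>X\<in>ball. F X \<in> op_ball 1) \<and>
    (\<forall>G. 1 \<le> ncps_radius G \<and> G \<noteq> (\<lambda>_. 0) \<longrightarrow> (\<exists>X\<in>ball. nc_eval G (F X) \<noteq> 0)) \<and>
    (\<forall>i. \<forall>X\<in>ball. nc_eval (ell2_coeff (a i)) (F X) = X i) \<and>
    (\<forall>i. M i \<in> BH) \<and>
    (\<forall>i b. \<forall>X\<in>ball. nc_eval (ell2_coeff (M i b)) (F X) = X i o\<^sub>L nc_eval (ell2_coeff b) (F X)) \<and>
    M \<in> conv_sot f \<union> conv_rad f \<and>
    (\<forall>j b. \<forall>X\<in>ball. nc_eval (ell2_coeff (tuple_value f M j b)) (F X) =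
      F X j o\<^sub>L nc_eval (ell2_coeff b) (F X)))"

text \<open>\<open>f\<close> has the model property, \<open>M\<close> is its universal model \<open>M\<^sub>Z\<close>, and \<open>a\<close> are the coordinates of
  \<open>Z\<^sub>1, \<dots>, Z\<^sub>n\<close>, i.e. the coefficients of the inverse \<open>g\<close>. The type argument is the Hilbert
  space on which the free holomorphic functions of case (F) are evaluated.\<close>

definition model_property ::
    "'h::chilbert_space itself \<Rightarrow>
      ('n::finite \<Rightarrow> 'n ncps) \<Rightarrow> ('n \<Rightarrow> 'n list ell2) \<Rightarrow> ('n \<Rightarrow> 'n list ell2 \<Rightarrow>\<^sub>L 'n list ell2) \<Rightarrow> bool"
  where "model_property H f a M \<longleftrightarrow> model_A f a M \<or> model_S f a M \<or> model_F H f a M"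

definition model_norm_conv ::
    "('n::finite \<Rightarrow> 'n ncps) \<Rightarrow> ('n \<Rightarrow> 'n list ell2 \<Rightarrow>\<^sub>L 'n list ell2) \<Rightarrow> bool"
  where "model_norm_conv f M \<longleftrightarrow>
    (\<forall>j. summable (nc_term (f j) M)) \<or>
    (\<forall>j. radially_summable (f j) M \<and>
      ((\<lambda>r. nc_eval (f j) (\<lambda>i. r *\<^sub>R M i)) \<longlongrightarrow> tuple_value f M j) (at_left 1))"


section \<open>The noncommutative domain and the algebras\<close>

definition nc_domain ::
    "('n::finite \<Rightarrow> 'n ncps) \<Rightarrow> ('n \<Rightarrow> 'n list ell2) \<Rightarrow> ('n \<Rightarrow> 'h::chilbert_space \<Rightarrow>\<^sub>L 'h) set"
  where "nc_domain f a = {X \<in> conv_sot f \<union> conv_rad f.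
    ((\<forall>i. sot_sums (ell2_coeff (a i)) (tuple_value f X) (X i)) \<or>
     (\<forall>i. abel_sums (ell2_coeff (a i)) (tuple_value f X) (X i))) \<and>
    row_norm (tuple_value f X) < 1}"

definition op_polynomials :: "('n \<Rightarrow> 'h::chilbert_space \<Rightarrow>\<^sub>L 'h) \<Rightarrow> ('h \<Rightarrow>\<^sub>L 'h) set"
  where "op_polynomials X = {\<Sum>\<alpha> | p \<alpha> \<noteq> 0. p \<alpha> *\<^sub>C op_word X \<alpha> | p. nc_polynomial p}"

text \<open>\<open>wot_algebra M\<^sub>Z\<close> is \<open>H\<^sup>\<infinity>(\<B>\<^sub>f)\<close>, and \<open>wot_algebra left_creation\<close> is the noncommutative analytic
  Toeplitz algebra.\<close>

definition wot_algebra :: "('n \<Rightarrow> 'h::chilbert_space \<Rightarrow>\<^sub>L 'h) \<Rightarrow> ('h \<Rightarrow>\<^sub>L 'h) set"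
  where "wot_algebra X = weak_operator_topology closure_of (op_polynomials X)"

definition left_multipliers :: "('n list ell2 \<Rightarrow>\<^sub>L 'n list ell2) set"
  where "left_multipliers = {T \<in> BH. \<exists>c :: 'n list ell2. \<forall>\<beta>.
    ((\<lambda>\<alpha>. ell2_coeff c \<alpha> *\<^sub>C ell2_basis (\<alpha> @ \<beta>)) has_sum T (ell2_basis \<beta>)) UNIV}"

definition fourier_coeff :: "('n list ell2 \<Rightarrow>\<^sub>L 'n list ell2) \<Rightarrow> 'n ncps"
  where "fourier_coeff \<phi> \<alpha> = ell2_coeff (\<phi> (ell2_basis [])) \<alpha>"

definition Hinf_ball :: "'h::chilbert_space itself \<Rightarrow> 'n::finite ncps set"
  where "Hinf_ball _ =
    {\<phi>. 1 \<le> ncps_radius \<phi> \<and> bounded (nc_eval \<phi> ` (op_ball 1 :: ('n \<Rightarrow> 'h \<Rightarrow>\<^sub>L 'h) set))}"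

text \<open>Functions on a subset \<open>D\<close> of a type are rendered as elements of \<^term>\<open>extensional D\<close>.\<close>

definition Hinf_domain ::
    "('n::finite \<Rightarrow> 'n ncps) \<Rightarrow> ('n \<Rightarrow> 'n list ell2) \<Rightarrow>
      (('n \<Rightarrow> 'h::chilbert_space \<Rightarrow>\<^sub>L 'h) \<Rightarrow> 'h \<Rightarrow>\<^sub>L 'h) set"
  where "Hinf_domain f a = {F \<in> extensional (nc_domain f a).
    (\<exists>c. \<forall>Y\<in>nc_domain f a. nc_term c (tuple_value f Y) sums F Y) \<and>
    bounded (F ` nc_domain f a)}"

definition compose_on_domain ::
    "('n::finite \<Rightarrow> 'n ncps) \<Rightarrow> ('n \<Rightarrow> 'n list ell2) \<Rightarrow> 'n ncps \<Rightarrow>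
      ('n \<Rightarrow> 'h::chilbert_space \<Rightarrow>\<^sub>L 'h) \<Rightarrow> 'h \<Rightarrow>\<^sub>L 'h"
  where "compose_on_domain f a \<phi> = (\<lambda>Y\<in>nc_domain f a. nc_eval \<phi> (tuple_value f Y))"

definition operator_algebra :: "('k::chilbert_space \<Rightarrow>\<^sub>L 'k) set \<Rightarrow> bool"
  where "operator_algebra \<A> \<longleftrightarrow> id_blinfun \<in> \<A> \<and>
    (\<forall>S\<in>\<A>. \<forall>T\<in>\<A>. S + T \<in> \<A> \<and> S o\<^sub>L T \<in> \<A>) \<and> (\<forall>c. \<forall>T\<in>\<A>. c *\<^sub>C T \<in> \<A>)"

definition function_algebra :: "'x set \<Rightarrow> ('x \<Rightarrow> 'h::chilbert_space \<Rightarrow>\<^sub>L 'h) set \<Rightarrow> bool"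
  where "function_algebra D \<F> \<longleftrightarrow> (\<lambda>Y\<in>D. id_blinfun) \<in> \<F> \<and>
    (\<forall>F\<in>\<F>. \<forall>G\<in>\<F>. (\<lambda>Y\<in>D. F Y + G Y) \<in> \<F> \<and> (\<lambda>Y\<in>D. F Y o\<^sub>L G Y) \<in> \<F>) \<and>
    (\<forall>c. \<forall>F\<in>\<F>. (\<lambda>Y\<in>D. c *\<^sub>C F Y) \<in> \<F>)"

definition algebra_isomorphism ::
    "'x set \<Rightarrow> ('x \<Rightarrow> 'h::chilbert_space \<Rightarrow>\<^sub>L 'h) set \<Rightarrow> ('k::chilbert_space \<Rightarrow>\<^sub>L 'k) set \<Rightarrow>
      (('x \<Rightarrow> 'h \<Rightarrow>\<^sub>L 'h) \<Rightarrow> 'k \<Rightarrow>\<^sub>L 'k) \<Rightarrow> bool"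
  where "algebra_isomorphism D \<F> \<A> \<Phi> \<longleftrightarrow>
    function_algebra D \<F> \<and> operator_algebra \<A> \<and> bij_betw \<Phi> \<F> \<A> \<and>
    \<Phi> (\<lambda>Y\<in>D. id_blinfun) = id_blinfun \<and>
    (\<forall>F\<in>\<F>. \<forall>G\<in>\<F>. \<Phi> (\<lambda>Y\<in>D. F Y + G Y) = \<Phi> F + \<Phi> G \<and>
      \<Phi> (\<lambda>Y\<in>D. F Y o\<^sub>L G Y) = \<Phi> F o\<^sub>L \<Phi> G) \<and>
    (\<forall>c. \<forall>F\<in>\<F>. \<Phi> (\<lambda>Y\<in>D. c *\<^sub>C F Y) = c *\<^sub>C \<Phi> F)"

end

(* In the coordinates of the orthonormal basis {f_alpha}, left multiplication by f_j is the left
   creation operator S_j, so the model property says that f_j(M_Z) = S_j, while M_Z commutes with the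
   right creation operators. The operators commuting with the right creations are exactly the left
   multipliers; they form a WOT-closed algebra, and each is the radial SOT-limit of its series in
   S = f(M_Z). Since S_j is itself a limit of polynomials in M_Z, both M_Z and S generate the algebra of
   all left multipliers. This gives (i) and (iii).

   The radial limit and the bounded functions of (ii) rest on the von Neumann inequality
   |phi(X)| <= |phi(S)| for |X| < 1. It is proved without a Poisson kernel: the positive form
   D(x, y) = <x, y> - sum_i <X_i* x, X_i* y> satisfies sum_beta D(X_beta* x, X_beta* y) = <x, y>, whence
   <phi(X) x, y> = sum_(alpha, beta) <phi(S) e_beta, e_alpha> D(X_beta* x, X_alpha* y), and such a sum is
   bounded by applying Gram-Schmidt to D on finitely many vectors.

   For (ii), evaluating symbols at W, |W| < 1, is a norm continuous homomorphism, which carries the norm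
   convergent series for f_j(M_Z) = S_j to f(g(W)) = W. Hence f maps the domain onto the whole open ball,
   and everything reduces to the ball, where W may be taken to be a copy of r S on the given Hilbert space. *)

theory Submission
  imports Defs
begin

section \<open>Complex inner products and adjoints\<close>

text \<open>In coordinates right multiplication by f_j is the right creation operator, so that M_Z
  commutes with the right creations is the associativity law Z_i (h f_j) = (Z_i h) f_j, provided a
  coordinate vector is determined by the object it represents. The three cases of the model property
  differ only in the source of this injectivity: a polynomial inverse, an invertible Jacobian, or
  separation by values.

  Gram-Schmidt allows only finitely many vectors, so the identity for the defect form is truncated
  to words of length < N. Telescoping then leaves an error of order N \<rho>^N, where \<rho> is the
  row norm of X; it vanishes in the limit because \<rho> < 1.

  The symbol of a multiplier is its image of the vacuum vector e_[], and the von Neumann inequality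
  bounds the radial approximants uniformly, so convergence on basis vectors becomes strong
  convergence.

  Infinite dimension of the given space provides an orthonormal family indexed by words, hence an
  isometric image of Fock space; the values of a function there determine its coefficients.

  Since \<open>blinfun\<close> consists of real-linear maps, complex linearity is carried along
  explicitly.\<close>

lemma cinner_add_right: "cinner x (y + z) = cinner x y + cinner (x :: 'a::chilbert_space) z"
  by (metis cinner_add_left cinner_commute complex_cnj_add)

lemma cinner_eq_inner: "cinner x y = Complex (inner x y) (inner x (\<i> *\<^sub>C (y :: 'a::chilbert_space)))"
  by (simp add: complex_eq_iff inner_eq_Re_cinner cinner_scaleC_right)

lemma cinner_self: "cinner x x = complex_of_real ((norm (x :: 'a::chilbert_space))\<^sup>2)"
proof -
  have "Im (cinner x x) = 0"
    using cinner_commute[of x x] by (metis complex_cnj_cancel_iff complex_is_Real_iff Reals_cnj_iff)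
  then show ?thesis
    by (simp add: complex_eq_iff inner_eq_Re_cinner[symmetric] power2_norm_eq_inner)
qed

lemma cinner_scaleR:
  "cinner (r *\<^sub>R x) y = r *\<^sub>R cinner (x :: 'a::chilbert_space) y"
  "cinner x (r *\<^sub>R y) = r *\<^sub>R cinner x y"
  by (simp_all add: scaleR_scaleC cinner_scaleC_left cinner_scaleC_right scaleR_conv_of_real)

lemma scaleC_one [simp]: "1 *\<^sub>C x = (x :: 'a::chilbert_space)"
  using scaleR_scaleC[of 1 x] by simp

lemma scaleC_zero_left [simp]: "0 *\<^sub>C x = (0 :: 'a::chilbert_space)"
  using scaleR_scaleC[of 0 x] by simp

lemma norm_cinner_le: "cmod (cinner x y) \<le> norm (x :: 'a::chilbert_space) * norm y"
proof (cases "cinner x y = 0")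
  case False
  \<comment> \<open>The unimodular factor u rotates \<open>cinner x y\<close> onto the positive real
    axis, where the real Cauchy-Schwarz inequality applies.\<close>
  define u where "u = cnj (cinner x y) / complex_of_real (cmod (cinner x y))"
  have u: "cmod u = 1"
    using False by (simp add: u_def norm_divide)
  have "cinner (u *\<^sub>C x) y = complex_of_real (cmod (cinner x y))"
    using False complex_norm_square[of "cinner x y"]
    by (simp add: u_def cinner_scaleC_left field_simps power2_eq_square)
  then have "cmod (cinner x y) = inner (u *\<^sub>C x) y"
    by (simp add: inner_eq_Re_cinner)
  also have "\<dots> \<le> norm (u *\<^sub>C x) * norm y"
    by (rule norm_cauchy_schwarz)
  finally show ?thesis
    by (simp add: norm_scaleC u)
qed simp

interpretation cinner: bounded_bilinear "cinner :: 'a::chilbert_space \<Rightarrow> 'a \<Rightarrow> complex"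
proof
  show "\<exists>K. \<forall>a b :: 'a. cmod (cinner a b) \<le> norm a * norm b * K"
    by (rule exI[of _ 1]) (simp add: norm_cinner_le)
qed (simp_all add: cinner_add_left cinner_add_right cinner_scaleR)

interpretation scaleC: bounded_bilinear "scaleC :: complex \<Rightarrow> 'a::chilbert_space \<Rightarrow> 'a"
proof
  fix r :: real and c :: complex and x :: 'a
  show "(r *\<^sub>R c) *\<^sub>C x = r *\<^sub>R c *\<^sub>C x" "c *\<^sub>C (r *\<^sub>R x) = r *\<^sub>R c *\<^sub>C x"
    by (simp_all add: scaleR_scaleC scaleC_scaleC scaleR_conv_of_real mult.commute)
  show "\<exists>K. \<forall>a (b :: 'a). norm (a *\<^sub>C b) \<le> cmod a * norm b * K"
    by (rule exI[of _ 1]) (simp add: norm_scaleC)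
qed (simp_all add: scaleC_add_left scaleC_add_right)

lemma cinner_eqI:
  assumes "\<And>z. cinner x z = cinner (y :: 'a::chilbert_space) z"
  shows "x = y"
proof -
  have "cinner (x - y) (x - y) = 0"
    using assms by (simp add: cinner.diff_left)
  then show ?thesis by (simp add: cinner_self)
qed

lemma norm_le_cinner:
  assumes "\<And>y. cmod (cinner x y) \<le> C * norm (y :: 'a::chilbert_space)" "0 \<le> C"
  shows "norm x \<le> C"
proof (cases "x = 0")
  case False
  have "norm x * norm x \<le> C * norm x"
    using assms(1)[of x] by (simp add: cinner_self norm_mult power2_eq_square)
  with False show ?thesis by simp
qed (use assms in simp)

lemma norm_sum_orthonormal:
  fixes x :: "'i \<Rightarrow> 'a::chilbert_space"
  assumes "finite F" "\<And>i j. i \<in> F \<Longrightarrow> j \<in> F \<Longrightarrow> cinner (x i) (x j) = (if i = j then 1 else 0)"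
  shows "(norm (\<Sum>i\<in>F. c i *\<^sub>C x i))\<^sup>2 = (\<Sum>i\<in>F. (cmod (c i))\<^sup>2)"
proof -
  have "complex_of_real ((norm (\<Sum>i\<in>F. c i *\<^sub>C x i))\<^sup>2)
      = (\<Sum>i\<in>F. \<Sum>j\<in>F. c i * cnj (c j) * cinner (x i) (x j))"
    unfolding cinner_self[symmetric] cinner.sum_left unfolding cinner.sum_right
    by (simp add: cinner_scaleC_left cinner_scaleC_right mult_ac)
  also have "\<dots> = (\<Sum>i\<in>F. \<Sum>j\<in>F. if i = j then c i * cnj (c i) else 0)"
    by (intro sum.cong refl) (simp add: assms(2))
  also have "\<dots> = (\<Sum>i\<in>F. complex_of_real ((cmod (c i))\<^sup>2))"
    using assms(1) by (intro sum.cong) (simp_all add: complex_norm_square del: of_real_power)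
  finally show ?thesis
    by (simp only: of_real_sum[symmetric] of_real_eq_iff)
qed

section \<open>Riesz representation and real adjoints\<close>

lemma inner_zero_of_minimal_norm:
  fixes x y :: "'a::real_inner"
  assumes min: "\<And>t. (norm x)\<^sup>2 \<le> (norm (x + t *\<^sub>R y))\<^sup>2"
  shows "inner y x = 0"
proof (cases "y = 0")
  case False
  \<comment> \<open>The minimiser of the quadratic polynomial |x + t y|^2 in t; its value there lies
    below |x|^2 by (x, y)^2 / |y|^2.\<close>
  define t where "t = - inner x y / (norm y)\<^sup>2"
  have "(norm (x + t *\<^sub>R y))\<^sup>2 = (norm x)\<^sup>2 + (2 * t * inner x y + t\<^sup>2 * (norm y)\<^sup>2)"
    unfolding power2_norm_eq_inner
    by (simp add: inner_add_left inner_add_right inner_commute power2_eq_square)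
  also have "2 * t * inner x y + t\<^sup>2 * (norm y)\<^sup>2 = - ((inner x y)\<^sup>2 / (norm y)\<^sup>2)"
    using False by (simp add: t_def power2_eq_square field_simps)
  finally have "(inner x y)\<^sup>2 / (norm y)\<^sup>2 \<le> 0"
    using min[of t] by simp
  then show ?thesis
    using False by (simp add: divide_le_0_iff inner_commute)
qed simp

text \<open>The representing vector is a multiple of the vector of minimal norm in the hyperplane
  \<open>\<phi> = 1\<close>; a minimising sequence is Cauchy by the parallelogram law.\<close>

lemma riesz_representation:
  fixes \<phi> :: "'a::{real_inner,banach} \<Rightarrow> real"
  assumes "bounded_linear \<phi>"
  shows "\<exists>v. \<forall>x. \<phi> x = inner x v"
proof (cases "\<exists>x. \<phi> x \<noteq> 0")
  case True
  interpret \<phi>: bounded_linear \<phi> by (rule assms)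
  define S where "S = {x. \<phi> x = 1}"
  define q where "q = (INF x\<in>S. (norm x)\<^sup>2)"
  obtain x0 where "\<phi> x0 \<noteq> 0" using True by blast
  then have "x0 /\<^sub>R \<phi> x0 \<in> S" by (simp add: S_def \<phi>.scaleR)
  then have ne: "S \<noteq> {}" by blast
  have bdd: "bdd_below ((\<lambda>x. (norm x)\<^sup>2) ` S)" by (rule bdd_belowI[of _ 0]) auto
  have q: "q \<le> (norm x)\<^sup>2" if "x \<in> S" for x
    unfolding q_def by (rule cINF_lower[OF bdd that])
  have "\<exists>x\<in>S. (norm x)\<^sup>2 < q + 1 / Suc n" for n
    using cINF_less_iff[OF ne bdd, of "q + 1 / Suc n"] by (simp add: q_def[symmetric])
  then obtain x where x: "\<And>n. x n \<in> S" "\<And>n. (norm (x n))\<^sup>2 < q + 1 / Suc n" by metis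
  \<comment> \<open>Midpoints of points of S lie in S, so |x_i + x_j|^2 is at least 4q, and the
    parallelogram law leaves only the two excesses over q.\<close>
  have par: "(norm (x i - x j))\<^sup>2 \<le> 2 * (1 / Suc i) + 2 * (1 / Suc j)" for i j
  proof -
    have "(1 / 2) *\<^sub>R (x i + x j) \<in> S"
      using x(1)[of i] x(1)[of j] by (simp add: S_def \<phi>.scaleR \<phi>.add)
    from q[OF this] have "4 * q \<le> (norm (x i + x j))\<^sup>2"
      by (simp add: power_divide)
    moreover have "(norm (x i - x j))\<^sup>2 + (norm (x i + x j))\<^sup>2 = 2 * (norm (x i))\<^sup>2 + 2 * (norm (x j))\<^sup>2"
      by (simp add: power2_norm_eq_inner algebra_simps inner_commute)
    ultimately show ?thesis using x(2)[of i] x(2)[of j] by linarith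
  qed
  have "Cauchy x"
  proof (rule metric_CauchyI)
    fix e :: real assume e: "0 < e"
    obtain N :: nat where N: "4 / e\<^sup>2 < N"
      using reals_Archimedean2 by blast
    have N0: "0 < real N"
      by (rule less_trans[OF _ N]) (use e in simp)
    have "dist (x i) (x j) < e" if "N \<le> i" "N \<le> j" for i j
    proof -
      have "1 / real (Suc i) \<le> 1 / N" "1 / real (Suc j) \<le> 1 / N"
        using that N0 by (simp_all add: frac_le)
      then have "(norm (x i - x j))\<^sup>2 \<le> 4 / N"
        using par[of i j] by simp
      also have "\<dots> < e\<^sup>2"
        using N N0 e by (simp add: field_simps)
      finally show ?thesis
        using e by (simp add: dist_norm power2_less_imp_less)
    qed
    then show "\<exists>N. \<forall>i\<ge>N. \<forall>j\<ge>N. dist (x i) (x j) < e" by blast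
  qed
  then obtain u where u: "x \<longlonglongrightarrow> u"
    using Cauchy_convergent convergent_def by blast
  have "(\<lambda>n. \<phi> (x n)) \<longlonglongrightarrow> \<phi> u" by (rule \<phi>.tendsto[OF u])
  then have \<phi>u: "\<phi> u = 1" using x(1) by (simp add: S_def LIMSEQ_const_iff)
  have "(norm u)\<^sup>2 \<le> q"
  proof (rule LIMSEQ_le)
    show "(\<lambda>n. (norm (x n))\<^sup>2) \<longlonglongrightarrow> (norm u)\<^sup>2" by (intro tendsto_intros u)
    show "(\<lambda>n. q + 1 / real (Suc n)) \<longlonglongrightarrow> q"
      using tendsto_add[OF tendsto_const LIMSEQ_inverse_real_of_nat, of q] by (simp add: inverse_eq_divide)
  qed (use x(2) less_imp_le in blast)
  moreover have "u + t *\<^sub>R y \<in> S" if "\<phi> y = 0" for t y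
    using that by (simp add: S_def \<phi>.add \<phi>.scaleR \<phi>u)
  ultimately have orth: "inner y u = 0" if "\<phi> y = 0" for y
    using that by (intro inner_zero_of_minimal_norm order_trans[OF _ q])
  have "u \<noteq> 0" using \<phi>u \<phi>.zero by auto
  \<comment> \<open>The vector y - \<phi>(y) u lies in the kernel of \<phi>; pairing it with u gives
    \<phi>(y) |u|^2 = (y, u).\<close>
  have "\<phi> y = inner y (u /\<^sub>R (norm u)\<^sup>2)" for y
    using orth[of "y - \<phi> y *\<^sub>R u"] \<open>u \<noteq> 0\<close>
    by (simp add: \<phi>.diff \<phi>.scaleR \<phi>u inner_diff_left power2_norm_eq_inner field_simps)
  then show ?thesis by blast
qed (auto intro!: exI[of _ 0])

text \<open>\<open>adjoint\<close> is a choice among maps satisfying the duality identity; the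
  identity is justified only once Riesz representation has produced such a map, which is where
  completeness of the domain enters.\<close>

lemma inner_adjoint:
  fixes A :: "'a::{real_inner,banach} \<Rightarrow> 'b::real_inner"
  assumes "bounded_linear A"
  shows "inner (A x) y = inner x (adjoint A y)"
proof -
  have "\<exists>v. \<forall>x. inner (A x) y = inner x v" for y
    by (rule riesz_representation)
      (intro bounded_linear_compose[OF bounded_linear_inner_left assms])
  then obtain g where "\<forall>x y. inner (A x) y = inner x (g y)" by metis
  then show ?thesis using adjoint_unique by metis
qed

lemma bounded_linear_adjoint:
  fixes A :: "'a::{real_inner,banach} \<Rightarrow> 'b::real_inner"
  assumes "bounded_linear A"
  shows "bounded_linear (adjoint A)"
proof (rule bounded_linear_intro[where K = "onorm A"])
  note adj = inner_adjoint[OF assms]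
  show "adjoint A (x + y) = adjoint A x + adjoint A y" for x y
    by (rule vector_eq_ldot[THEN iffD1]) (metis adj inner_add_right)
  show "adjoint A (r *\<^sub>R x) = r *\<^sub>R adjoint A x" for r x
    by (rule vector_eq_ldot[THEN iffD1]) (metis adj inner_scaleR_right)
  show "norm (adjoint A y) \<le> norm y * onorm A" for y
  proof (cases "adjoint A y = 0")
    case False
    have "norm (adjoint A y) * norm (adjoint A y) = inner (A (adjoint A y)) y"
      by (simp add: adj power2_norm_eq_inner[symmetric] power2_eq_square)
    also have "\<dots> \<le> norm (A (adjoint A y)) * norm y"
      by (rule norm_cauchy_schwarz)
    also have "\<dots> \<le> onorm A * norm (adjoint A y) * norm y"
      by (intro mult_right_mono onorm assms) simp
    finally show ?thesis using False by (simp add: mult_ac)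
  qed (use onorm_pos_le[OF assms] in simp)
qed

section \<open>Bounded adjoints and complex linearity\<close>

lift_definition adj ::
    "('a::{real_inner,banach} \<Rightarrow>\<^sub>L 'b::real_inner) \<Rightarrow> 'b \<Rightarrow>\<^sub>L 'a" is adjoint
  by (rule bounded_linear_adjoint)

text \<open>Unlike \<open>BH\<close>, this covers operators between two different spaces, such as an
  embedding of Fock space into the given Hilbert space.\<close>

definition clinear_op :: "('a::chilbert_space \<Rightarrow>\<^sub>L 'b::chilbert_space) \<Rightarrow> bool"
  where "clinear_op A \<longleftrightarrow> (\<forall>c x. A (c *\<^sub>C x) = c *\<^sub>C A x)"

lemma clinear_opD: "clinear_op A \<Longrightarrow> A (c *\<^sub>C x) = c *\<^sub>C A x"
  by (simp add: clinear_op_def)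

lemma BH_iff: "A \<in> BH \<longleftrightarrow> clinear_op A"
  by (simp add: BH_def clinear_op_def)

text \<open>The duality identity of the real inner product gives the real parts; testing it against
  i y gives the imaginary parts, and there complex linearity of A is used.\<close>

lemma cinner_adj:
  assumes "clinear_op A"
  shows "cinner (A x) y = cinner x (adj A y)"
proof -
  have *: "inner (A u) v = inner u (adj A v)" for u v
    by (simp add: adj.rep_eq inner_adjoint blinfun.bounded_linear_right)
  have "inner (A x) (\<i> *\<^sub>C y) = - inner (\<i> *\<^sub>C A x) y"
    by (simp add: inner_eq_Re_cinner cinner_scaleC_left cinner_scaleC_right)
  also have "\<dots> = - inner (\<i> *\<^sub>C x) (adj A y)"
    by (simp add: clinear_opD[OF assms, symmetric] *)
  also have "\<dots> = inner x (\<i> *\<^sub>C adj A y)"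
    by (simp add: inner_eq_Re_cinner cinner_scaleC_left cinner_scaleC_right)
  finally show ?thesis
    by (simp add: cinner_eq_inner *)
qed

lemma cinner_adj': "clinear_op A \<Longrightarrow> cinner (adj A x) y = cinner x (A y)"
  by (metis cinner_adj cinner_commute)

lemma adj_eqI:
  assumes "clinear_op A" "\<And>x y. cinner (A x) y = cinner x (blinfun_apply B y)"
  shows "adj A = B"
  by (intro blinfun_eqI cinner_eqI) (metis assms cinner_adj cinner_commute)

lemma clinear_op_adj:
  assumes "clinear_op A" shows "clinear_op (adj A)"
  unfolding clinear_op_def
  by (intro allI cinner_eqI) (simp add: cinner_adj'[OF assms] cinner_scaleC_left)

lemma adj_adj: "clinear_op A \<Longrightarrow> adj (adj A) = A"
  by (intro adj_eqI clinear_op_adj cinner_adj')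

lemma adj_compose:
  assumes "clinear_op A" "clinear_op B"
  shows "adj (A o\<^sub>L B) = adj B o\<^sub>L adj A"
  using assms by (intro adj_eqI) (simp_all add: clinear_op_def cinner_adj)

lemma adj_id: "adj id_blinfun = (id_blinfun :: 'a::chilbert_space \<Rightarrow>\<^sub>L 'a)"
  by (rule adj_eqI) (simp_all add: clinear_op_def)

lemma scaleC_blinfun_apply [simp]: "(c *\<^sub>C A) x = c *\<^sub>C A x"
  for A :: "'a::real_normed_vector \<Rightarrow>\<^sub>L 'b::chilbert_space"
  by (simp add: scaleC_blinfun.rep_eq)

interpretation scaleC_blinfun:
  bounded_bilinear "scaleC :: complex \<Rightarrow> ('a::real_normed_vector \<Rightarrow>\<^sub>L 'b::chilbert_space) \<Rightarrow> _"
proof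
  fix r :: real and c d :: complex and A B :: "'a \<Rightarrow>\<^sub>L 'b"
  show "(c + d) *\<^sub>C A = c *\<^sub>C A + d *\<^sub>C A" "c *\<^sub>C (A + B) = c *\<^sub>C A + c *\<^sub>C B"
    "(r *\<^sub>R c) *\<^sub>C A = r *\<^sub>R c *\<^sub>C A" "c *\<^sub>C (r *\<^sub>R A) = r *\<^sub>R c *\<^sub>C A"
    by (intro blinfun_eqI; simp add: blinfun.add_left blinfun.scaleR_left scaleC.add_left
        scaleC.add_right scaleC.scaleR_left scaleC.scaleR_right)+
  have "norm (c *\<^sub>C A) \<le> cmod c * norm A" for c and A :: "'a \<Rightarrow>\<^sub>L 'b"
    by (rule norm_blinfun_bound) (simp_all add: norm_scaleC norm_blinfun mult.assoc mult_left_mono)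
  then show "\<exists>K. \<forall>a (b :: 'a \<Rightarrow>\<^sub>L 'b). norm (a *\<^sub>C b) \<le> cmod a * norm b * K"
    by (intro exI[of _ 1]) simp
qed

lemma clinear_op_intros:
  "clinear_op id_blinfun" "clinear_op 0"
  "clinear_op A \<Longrightarrow> clinear_op B \<Longrightarrow> clinear_op (A + B)"
  "clinear_op A \<Longrightarrow> clinear_op B \<Longrightarrow> clinear_op (A - B)"
  "clinear_op A \<Longrightarrow> clinear_op (c *\<^sub>C A)"
  "clinear_op A \<Longrightarrow> clinear_op (r *\<^sub>R A)"
  "clinear_op A \<Longrightarrow> clinear_op C \<Longrightarrow> clinear_op (A o\<^sub>L C)"
  by (simp_all add: clinear_op_def blinfun.add_left blinfun.diff_left blinfun.scaleR_left
      scaleC.add_right scaleC.diff_right scaleC.scaleR_right scaleC.zero_right scaleC_scaleC mult.commute)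

lemma clinear_op_sum: "(\<And>i. i \<in> F \<Longrightarrow> clinear_op (A i)) \<Longrightarrow> clinear_op (\<Sum>i\<in>F. A i)"
  by (induction F rule: infinite_finite_induct) (simp_all add: clinear_op_intros)

lemma closed_clinear_op: "closed (Collect clinear_op :: ('a::chilbert_space \<Rightarrow>\<^sub>L 'b::chilbert_space) set)"
proof -
  have "Collect clinear_op = (\<Inter>c. \<Inter>x. {A :: 'a \<Rightarrow>\<^sub>L 'b. A (c *\<^sub>C x) = c *\<^sub>C A x})"
    by (auto simp: clinear_op_def)
  moreover have "closed {A :: 'a \<Rightarrow>\<^sub>L 'b. A (c *\<^sub>C x) = c *\<^sub>C A x}" for c x
    by (intro closed_Collect_eq continuous_intros
        bounded_linear.continuous_on[OF bounded_linear_scaleC])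
  ultimately show ?thesis by (simp add: closed_INT)
qed

lemma sum_blinfun_apply: "blinfun_apply (\<Sum>i\<in>F. A i) x = (\<Sum>i\<in>F. blinfun_apply (A i) x)"
  by (induction F rule: infinite_finite_induct) (simp_all add: blinfun.add_left)

lemma CS_sum:
  fixes x y :: "'i \<Rightarrow> real"
  shows "(\<Sum>i\<in>F. \<bar>x i * y i\<bar>) \<le> sqrt (\<Sum>i\<in>F. (x i)\<^sup>2) * sqrt (\<Sum>i\<in>F. (y i)\<^sup>2)"
  using L2_set_mult_ineq[of x y F] by (simp add: L2_set_def abs_mult)

section \<open>Square-summable families and left multipliers\<close>

lemma ell2_coeff_basis: "ell2_coeff (ell2_basis i) j = (if j = i then 1 else 0)"
  by (simp add: ell2_basis.rep_eq)

lemma ell2_coeff_sum: "ell2_coeff (\<Sum>i\<in>F. x i) w = (\<Sum>i\<in>F. ell2_coeff (x i) w)"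
  by (induction F rule: infinite_finite_induct) simp_all

lemma bounded_linear_ell2_coeff: "bounded_linear (\<lambda>x. ell2_coeff x i)"
  by (rule bounded_linear_intro[where K = 1])
    (simp_all add: cmod_ell2_coeff_le scaleR_conv_of_real)

lemma cinner_ell2_basis: "cinner x (ell2_basis i) = ell2_coeff x i"
proof -
  have "cinner x (ell2_basis i) = (\<Sum>\<^sub>\<infinity>j\<in>{i}. ell2_coeff x j * cnj (ell2_coeff (ell2_basis i) j))"
    unfolding cinner_ell2_def by (rule infsum_cong_neutral) (auto simp: ell2_coeff_basis)
  then show ?thesis by (simp add: ell2_coeff_basis)
qed

lemma cinner_basis_basis: "cinner (ell2_basis i) (ell2_basis j) = (if i = j then 1 else 0)"
  by (simp add: cinner_ell2_basis ell2_coeff_basis)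

lemma norm_ell2_basis [simp]: "norm (ell2_basis i) = 1"
proof -
  have "complex_of_real ((norm (ell2_basis i))\<^sup>2) = of_real 1"
    unfolding cinner_self[symmetric] by (simp add: cinner_basis_basis)
  then have "(norm (ell2_basis i))\<^sup>2 = 1\<^sup>2"
    by (simp only: of_real_eq_iff power_one)
  then show ?thesis by (metis abs_1 abs_minus_cancel abs_norm_cancel power2_eq_1_iff power_one)
qed

lemma norm_sum_ell2_basis:
  "finite F \<Longrightarrow> (norm (\<Sum>i\<in>F. c i *\<^sub>C ell2_basis i))\<^sup>2 = (\<Sum>i\<in>F. (cmod (c i))\<^sup>2)"
  by (rule norm_sum_orthonormal) (simp_all add: cinner_basis_basis)

lemma Abs_ell2_of_bound:
  assumes "\<And>F. finite F \<Longrightarrow> (\<Sum>i\<in>F. (cmod (c i))\<^sup>2) \<le> K"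
  obtains x where "ell2_coeff x = c" "(norm x)\<^sup>2 \<le> K"
proof -
  have s: "(\<lambda>i. (cmod (c i))\<^sup>2) summable_on UNIV"
    by (rule nonneg_bdd_above_summable_on) (auto intro!: bdd_aboveI[of _ K] assms)
  then have c: "ell2_coeff (Abs_ell2 c) = c"
    by (intro Abs_ell2_inverse) simp
  moreover have "(norm (Abs_ell2 c))\<^sup>2 \<le> K"
    unfolding norm_ell2_squared c by (rule infsum_le_finite_sums[OF s]) (simp add: assms)
  ultimately show ?thesis by (rule that)
qed

lemma norm_ell2_le_finite:
  assumes "\<And>F. finite F \<Longrightarrow> (\<Sum>i\<in>F. (cmod (ell2_coeff x i))\<^sup>2) \<le> K"
  shows "(norm x)\<^sup>2 \<le> K"
proof -
  obtain y where "ell2_coeff y = ell2_coeff x" "(norm y)\<^sup>2 \<le> K"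
    by (rule Abs_ell2_of_bound[OF assms])
  then show ?thesis by (simp add: ell2_coeff_inject)
qed

lemma ell2_remainder:
  assumes F: "finite F"
  shows "(norm (x - (\<Sum>i\<in>F. ell2_coeff x i *\<^sub>C ell2_basis i)))\<^sup>2
    \<le> (norm x)\<^sup>2 - (\<Sum>i\<in>F. (cmod (ell2_coeff x i))\<^sup>2)"
proof -
  define h where "h i = (cmod (ell2_coeff x i))\<^sup>2" for i
  let ?y = "\<Sum>i\<in>F. ell2_coeff x i *\<^sub>C ell2_basis i"
  have y: "ell2_coeff ?y j = (if j \<in> F then ell2_coeff x j else 0)" for j
    using F by (simp add: ell2_coeff_sum ell2_coeff_basis if_distrib cong: if_cong)
  have "(norm (x - ?y))\<^sup>2 \<le> (norm x)\<^sup>2 - sum h F"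
  proof (rule norm_ell2_le_finite)
    fix G :: "'a set" assume G: "finite G"
    have "(\<Sum>i\<in>G. (cmod (ell2_coeff (x - ?y) i))\<^sup>2) = (\<Sum>i\<in>G. if i \<in> F then 0 else h i)"
      by (intro sum.cong) (simp_all add: y h_def)
    also have "\<dots> = sum h (G - F)"
      using G by (simp add: sum.If_cases Diff_eq)
    also have "\<dots> = sum h (G \<union> F) - sum h F"
      using G F sum.subset_diff[of F "G \<union> F" h] by (simp add: Un_Diff)
    also have "\<dots> \<le> (norm x)\<^sup>2 - sum h F"
      using sum_ell2_coeff_le[of "G \<union> F" x] G F by (simp add: h_def)
    finally show "(\<Sum>i\<in>G. (cmod (ell2_coeff (x - ?y) i))\<^sup>2) \<le> (norm x)\<^sup>2 - sum h F" .
  qed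
  then show ?thesis by (simp add: h_def)
qed

lemma ell2_has_sum: "((\<lambda>i. ell2_coeff x i *\<^sub>C ell2_basis i) has_sum x) UNIV"
  unfolding has_sum_def
proof (rule tendstoI)
  fix e :: real assume e: "0 < e"
  define h where "h i = (cmod (ell2_coeff x i))\<^sup>2" for i
  have "(h has_sum (norm x)\<^sup>2) UNIV"
    unfolding norm_ell2_squared h_def by (intro has_sum_infsum ell2_coeff_summable)
  moreover have "0 < e\<^sup>2" using e by simp
  ultimately have "\<forall>\<^sub>F G in finite_subsets_at_top UNIV. dist (sum h G) ((norm x)\<^sup>2) < e\<^sup>2"
    unfolding has_sum_def using tendstoD by blast
  then obtain F where F: "finite F" "\<And>G. finite G \<Longrightarrow> F \<subseteq> G \<Longrightarrow> dist (sum h G) ((norm x)\<^sup>2) < e\<^sup>2"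
    unfolding eventually_finite_subsets_at_top by auto
  have "dist (\<Sum>i\<in>G. ell2_coeff x i *\<^sub>C ell2_basis i) x < e" if G: "finite G" "F \<subseteq> G" for G
  proof -
    have "(norm (x - (\<Sum>i\<in>G. ell2_coeff x i *\<^sub>C ell2_basis i)))\<^sup>2 \<le> (norm x)\<^sup>2 - sum h G"
      unfolding h_def by (rule ell2_remainder[OF G(1)])
    also have "\<dots> < e\<^sup>2"
      using F(2)[OF G] by (simp add: dist_real_def)
    finally show ?thesis
      using e by (simp add: dist_norm norm_minus_commute power2_less_imp_less)
  qed
  with F(1) show "\<forall>\<^sub>F G in finite_subsets_at_top UNIV.
      dist (\<Sum>i\<in>G. ell2_coeff x i *\<^sub>C ell2_basis i) x < e"
    unfolding eventually_finite_subsets_at_top by blast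
qed

lemma ell2_finite_approx:
  assumes "0 < e"
  obtains F where "finite F" "norm (x - (\<Sum>i\<in>F. ell2_coeff x i *\<^sub>C ell2_basis i)) < e"
proof -
  obtain F where "finite F" "dist (\<Sum>i\<in>F. ell2_coeff x i *\<^sub>C ell2_basis i) x < e"
    using tendstoD[OF ell2_has_sum[of x, unfolded has_sum_def] assms]
    unfolding eventually_finite_subsets_at_top by blast
  then show ?thesis
    using that by (simp add: dist_norm norm_minus_commute)
qed

text \<open>The family \<open>T\<close> may consist of merely real-linear operators, hence the test vectors are all
  complex multiples of the basis.\<close>

lemma tendsto_ell2_of_basis:
  fixes T :: "'t \<Rightarrow> 'i ell2 \<Rightarrow>\<^sub>L 'b::real_normed_vector" and L :: "'i ell2 \<Rightarrow>\<^sub>L 'b"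
  assumes bound: "\<forall>\<^sub>F t in \<F>. norm (T t) \<le> C"
    and basis: "\<And>i z. ((\<lambda>t. T t (z *\<^sub>C ell2_basis i)) \<longlongrightarrow> L (z *\<^sub>C ell2_basis i)) \<F>"
  shows "((\<lambda>t. T t x) \<longlongrightarrow> L x) \<F>"
proof (rule tendstoI)
  fix e :: real assume e: "0 < e"
  \<comment> \<open>Eventually K dominates the sum of the norms of T t and L; the added 1 keeps the
    divisor positive.\<close>
  define K where "K = \<bar>C\<bar> + norm L + 1"
  have K: "0 < K" by (simp add: K_def add_nonneg_pos)
  obtain F where F: "finite F" "norm (x - (\<Sum>i\<in>F. ell2_coeff x i *\<^sub>C ell2_basis i)) < e / (2 * K)"
    using ell2_finite_approx[of "e / (2 * K)" x] e K by (metis divide_pos_pos mult_pos_pos zero_less_numeral)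
  let ?y = "\<Sum>i\<in>F. ell2_coeff x i *\<^sub>C ell2_basis i"
  have "((\<lambda>t. \<Sum>i\<in>F. T t (ell2_coeff x i *\<^sub>C ell2_basis i))
      \<longlongrightarrow> (\<Sum>i\<in>F. L (ell2_coeff x i *\<^sub>C ell2_basis i))) \<F>"
    by (intro tendsto_sum basis)
  then have "((\<lambda>t. T t ?y) \<longlongrightarrow> L ?y) \<F>"
    by (simp add: blinfun.sum_right)
  from tendstoD[OF this, of "e / 2"] e bound
  have "\<forall>\<^sub>F t in \<F>. dist (T t ?y) (L ?y) < e / 2 \<and> norm (T t) \<le> C"
    by (simp add: eventually_conj)
  then show "\<forall>\<^sub>F t in \<F>. dist (T t x) (L x) < e"
  proof eventually_elim
    case (elim t)
    have "T t x - L x = (T t (x - ?y) - L (x - ?y)) + (T t ?y - L ?y)"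
      by (simp add: blinfun.diff_right)
    then have "dist (T t x) (L x) \<le> norm (T t (x - ?y)) + norm (L (x - ?y)) + norm (T t ?y - L ?y)"
      by (simp only: dist_norm)
        (rule order_trans[OF norm_triangle_ineq], intro add_right_mono norm_triangle_ineq4)
    also have "norm (T t (x - ?y)) + norm (L (x - ?y)) \<le> K * norm (x - ?y)"
    proof -
      have "norm (T t (x - ?y)) + norm (L (x - ?y)) \<le> norm (T t) * norm (x - ?y) + norm L * norm (x - ?y)"
        by (intro add_mono norm_blinfun)
      also have "\<dots> = (norm (T t) + norm L) * norm (x - ?y)"
        by (simp add: algebra_simps)
      also have "\<dots> \<le> K * norm (x - ?y)"
        using conjunct2[OF elim] abs_ge_self[of C] by (intro mult_right_mono) (simp_all add: K_def)
      finally show ?thesis .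
    qed
    also have "K * norm (x - ?y) \<le> K * (e / (2 * K))"
      using F(2) K by (intro mult_left_mono) simp_all
    also have "K * (e / (2 * K)) = e / 2"
      using K by simp
    finally show ?case
      using elim by (simp add: dist_norm)
  qed
qed

text \<open>The constant family S converges to T on all multiples of basis vectors, hence everywhere
  by \<open>tendsto_ell2_of_basis\<close>; this is the density of finite combinations.\<close>

lemma blinfun_ell2_eqI:
  fixes S T :: "'i ell2 \<Rightarrow>\<^sub>L 'b::real_normed_vector"
  assumes "\<And>i z. S (z *\<^sub>C ell2_basis i) = T (z *\<^sub>C ell2_basis i)"
  shows "S = T"
proof (rule blinfun_eqI)
  fix x
  have "((\<lambda>_. S x) \<longlongrightarrow> T x) sequentially"
    by (rule tendsto_ell2_of_basis[where C = "norm S"]) (simp_all add: assms)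
  then show "S x = T x" by (simp add: LIMSEQ_const_iff)
qed

lemma clinear_op_ell2_eqI:
  assumes "clinear_op S" "clinear_op T" "\<And>i. S (ell2_basis i) = T (ell2_basis i)"
  shows "S = T"
  by (rule blinfun_ell2_eqI) (simp add: assms clinear_opD)

text \<open>The operator is the adjoint of \<open>y \<mapsto> (\<langle>y, v\<^sub>i\<rangle>)\<^sub>i\<close>.\<close>

lemma synthesis_operator:
  fixes v :: "'i \<Rightarrow> 'a::chilbert_space"
  assumes bound: "\<And>F c. finite F \<Longrightarrow> (norm (\<Sum>i\<in>F. c i *\<^sub>C v i))\<^sup>2 \<le> C\<^sup>2 * (\<Sum>i\<in>F. (cmod (c i))\<^sup>2)"
    and C: "0 \<le> C"
  obtains V where "clinear_op V" "\<And>i. V (ell2_basis i) = v i" "norm V \<le> C"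
    "\<And>y i. ell2_coeff (adj V y) i = cinner y (v i)"
proof -
  \<comment> \<open>The dual form of the hypothesis: with the coefficients <y, v_i> it gives s \<le>
    |y| C sqrt s, and cancelling sqrt s is Bessel's inequality with constant C.\<close>
  have bessel: "(\<Sum>i\<in>F. (cmod (cinner y (v i)))\<^sup>2) \<le> (C * norm y)\<^sup>2" if "finite F" for F y
  proof -
    define s where "s = (\<Sum>i\<in>F. (cmod (cinner y (v i)))\<^sup>2)"
    have s0: "0 \<le> s" by (simp add: s_def sum_nonneg)
    have "complex_of_real s = cinner y (\<Sum>i\<in>F. cinner y (v i) *\<^sub>C v i)"
      by (simp add: s_def cinner.sum_right cinner_scaleC_right complex_norm_square mult.commute del: of_real_power)
    then have "s \<le> norm y * norm (\<Sum>i\<in>F. cinner y (v i) *\<^sub>C v i)"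
      using norm_cinner_le[of y "\<Sum>i\<in>F. cinner y (v i) *\<^sub>C v i"] s0
      by (metis abs_of_nonneg norm_of_real)
    also have "norm (\<Sum>i\<in>F. cinner y (v i) *\<^sub>C v i) \<le> C * sqrt s"
      using real_sqrt_le_mono[OF bound[OF that, of "\<lambda>i. cinner y (v i)"]] C
      by (simp add: s_def real_sqrt_mult)
    finally have le: "s \<le> norm y * (C * sqrt s)" by (simp add: mult_left_mono)
    have "sqrt s \<le> C * norm y"
    proof (cases "s = 0")
      case False
      have "sqrt s * sqrt s \<le> (C * norm y) * sqrt s"
        using le s0 by (simp add: mult_ac)
      then show ?thesis using False s0 by (auto intro: mult_right_le_imp_le[of _ "sqrt s"])
    qed (use C in simp)
    then have "(sqrt s)\<^sup>2 \<le> (C * norm y)\<^sup>2"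
      using s0 by (intro power_mono) simp_all
    then show ?thesis using s0 by (simp add: s_def)
  qed
  have "\<exists>x. ell2_coeff x = (\<lambda>i. cinner y (v i)) \<and> (norm x)\<^sup>2 \<le> (C * norm y)\<^sup>2" for y
  proof -
    obtain x where "ell2_coeff x = (\<lambda>i. cinner y (v i))" "(norm x)\<^sup>2 \<le> (C * norm y)\<^sup>2"
      by (rule Abs_ell2_of_bound[of "\<lambda>i. cinner y (v i)", OF bessel])
    then show ?thesis by blast
  qed
  then have "\<forall>y. \<exists>x. ell2_coeff x = (\<lambda>i. cinner y (v i)) \<and> (norm x)\<^sup>2 \<le> (C * norm y)\<^sup>2"
    by blast
  from choice[OF this] obtain Q where
    Q': "\<forall>y. ell2_coeff (Q y) = (\<lambda>i. cinner y (v i)) \<and> (norm (Q y))\<^sup>2 \<le> (C * norm y)\<^sup>2" ..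
  then have Q: "\<And>y i. ell2_coeff (Q y) i = cinner y (v i)" "\<And>y. (norm (Q y))\<^sup>2 \<le> (C * norm y)\<^sup>2"
    by simp_all
  have nQ: "norm (Q y) \<le> C * norm y" for y
    by (rule power2_le_imp_le[OF Q(2)]) (use C in simp)
  have "bounded_linear Q"
    by (rule bounded_linear_intro[where K = C])
      (use nQ in \<open>auto intro!: ell2_eqI simp: Q(1) cinner_add_left cinner_scaleR scaleR_conv_of_real mult.commute\<close>)
  then have Qb: "blinfun_apply (Blinfun Q) = Q" by (rule bounded_linear_Blinfun_apply)
  have Qc: "clinear_op (Blinfun Q)"
    unfolding clinear_op_def Qb by (auto intro!: ell2_eqI simp: Q(1) cinner_scaleC_left)
  \<comment> \<open>Taking the adjoint defines V on the whole space at once, in place of an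
    extension from finite combinations.\<close>
  define V where "V = adj (Blinfun Q)"
  have Vc: "clinear_op V" unfolding V_def by (rule clinear_op_adj[OF Qc])
  show ?thesis
  proof
    show "clinear_op V" by (rule Vc)
    show "V (ell2_basis i) = v i" for i
      by (rule cinner_eqI)
        (metis Q(1) Qb Qc V_def cinner_adj' cinner_commute cinner_ell2_basis)
    show "ell2_coeff (adj V y) i = cinner y (v i)" for y i
      unfolding V_def adj_adj[OF Qc] Qb by (rule Q(1))
    show "norm V \<le> C"
    proof (rule norm_blinfun_bound[OF C])
      fix x
      show "norm (V x) \<le> C * norm x"
      proof (rule norm_le_cinner)
        show "cmod (cinner (V x) y) \<le> C * norm x * norm y" for y
        proof -
          have "cmod (cinner (V x) y) = cmod (cinner x (Q y))"
            unfolding V_def cinner_adj'[OF Qc] Qb ..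
          also have "\<dots> \<le> norm x * (C * norm y)"
            by (intro order_trans[OF norm_cinner_le] mult_left_mono nQ) simp
          finally show ?thesis by (simp add: mult_ac)
        qed
      qed (use C in simp)
    qed
  qed
qed

section \<open>Left and right creation operators\<close>

lemma clinear_op_left_creation [simp]: "clinear_op (left_creation i)"
  unfolding clinear_op_def left_creation.rep_eq
  by (auto intro!: ell2_eqI simp: ell2_shift.rep_eq split: list.splits)

lemma bij_rev: "bij rev"
  by (rule bij_betw_byWitness[where f' = rev]) auto

lift_definition ell2_rev :: "'n list ell2 \<Rightarrow> 'n list ell2" is "\<lambda>x w. x (rev w)"
proof -
  fix x :: "'n list \<Rightarrow> complex"
  assume "(\<lambda>w. (cmod (x w))\<^sup>2) summable_on UNIV"
  then show "(\<lambda>w. (cmod (x (rev w)))\<^sup>2) summable_on UNIV"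
    using summable_on_reindex_bij_betw[of rev UNIV UNIV "\<lambda>w. (cmod (x w))\<^sup>2"]
    by (simp add: bij_rev)
qed

lemma norm_ell2_rev: "norm (ell2_rev x) = norm x"
proof -
  have "(norm (ell2_rev x))\<^sup>2 = (norm x)\<^sup>2"
    unfolding norm_ell2_squared ell2_rev.rep_eq
    using infsum_reindex_bij_betw[of rev UNIV UNIV "\<lambda>w. (cmod (ell2_coeff x w))\<^sup>2"]
    by (simp add: bij_rev)
  then show ?thesis by simp
qed

lift_definition word_reversal :: "'n list ell2 \<Rightarrow>\<^sub>L 'n list ell2" is ell2_rev
  by (rule bounded_linear_intro[where K = 1])
    (auto intro!: ell2_eqI simp: ell2_rev.rep_eq norm_ell2_rev)

text \<open>Reversing words exchanges their two ends, so appending a letter is prepending it,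
  conjugated by \<open>word_reversal\<close>; boundedness comes with the construction.\<close>

definition right_creation :: "'n \<Rightarrow> 'n list ell2 \<Rightarrow>\<^sub>L 'n list ell2"
  where "right_creation i = word_reversal o\<^sub>L left_creation i o\<^sub>L word_reversal"

lemma clinear_op_word_reversal: "clinear_op word_reversal"
  unfolding clinear_op_def word_reversal.rep_eq
  by (auto intro!: ell2_eqI simp: ell2_rev.rep_eq)

lemma clinear_op_right_creation [simp]: "clinear_op (right_creation i)"
  unfolding right_creation_def by (intro clinear_op_intros clinear_op_word_reversal) simp_all

lemma right_creation_coeff:
  "ell2_coeff (right_creation i x) w = (if w \<noteq> [] \<and> last w = i then ell2_coeff x (butlast w) else 0)"
  by (cases w rule: rev_cases)
    (simp_all add: right_creation_def word_reversal.rep_eq left_creation.rep_eq ell2_rev.rep_eq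
      ell2_shift.rep_eq)

lemma left_creation_coeff:
  "ell2_coeff (left_creation i x) w = (case w of [] \<Rightarrow> 0 | j # v \<Rightarrow> if j = i then ell2_coeff x v else 0)"
  by (simp add: left_creation.rep_eq ell2_shift.rep_eq)

lemma right_creation_basis: "right_creation i (ell2_basis w) = ell2_basis (w @ [i])"
proof (rule ell2_eqI)
  fix u show "ell2_coeff (right_creation i (ell2_basis w)) u = ell2_coeff (ell2_basis (w @ [i])) u"
    by (cases u rule: rev_cases) (auto simp: right_creation_coeff ell2_coeff_basis)
qed

lemma left_right_creation_commute:
  "left_creation i (right_creation j x) = right_creation j (left_creation i x)"
proof (rule ell2_eqI)
  fix u show "ell2_coeff (left_creation i (right_creation j x)) u
      = ell2_coeff (right_creation j (left_creation i x)) u"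
    by (cases u) (auto simp: right_creation_coeff left_creation_coeff split: list.splits)
qed

lemma op_word_Nil [simp]: "op_word X [] = id_blinfun"
  and op_word_Cons [simp]: "op_word X (i # \<alpha>) = X i o\<^sub>L op_word X \<alpha>"
  by (simp_all add: op_word_def)

lemma op_word_append: "op_word X (\<alpha> @ \<beta>) = op_word X \<alpha> o\<^sub>L op_word X \<beta>"
  by (induction \<alpha>) (simp_all add: blinfun_eqI)

lemma clinear_op_word: "(\<And>i. clinear_op (X i)) \<Longrightarrow> clinear_op (op_word X \<alpha>)"
  by (induction \<alpha>) (simp_all add: clinear_op_intros)

text \<open>The reversal compensates for the order of application: the rightmost factor of
  \<open>op_word\<close> acts first, and the first letter of \<beta> has to be appended
  first.\<close>

definition right_mult :: "'n list \<Rightarrow> 'n list ell2 \<Rightarrow>\<^sub>L 'n list ell2"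
  where "right_mult \<beta> = op_word right_creation (rev \<beta>)"

lemma right_mult_basis: "right_mult \<beta> (ell2_basis \<alpha>) = ell2_basis (\<alpha> @ \<beta>)"
proof -
  have "op_word right_creation \<gamma> (ell2_basis \<alpha>) = ell2_basis (\<alpha> @ rev \<gamma>)" for \<gamma> :: "'a list"
    by (induction \<gamma>) (simp_all add: right_creation_basis)
  from this[of "rev \<beta>"] show ?thesis by (simp add: right_mult_def)
qed

lemma clinear_op_right_mult [simp]: "clinear_op (right_mult \<beta>)"
  unfolding right_mult_def by (intro clinear_op_word) simp

lemma right_mult_simps:
  "right_mult [] x = x" "right_mult (\<beta> @ [i]) x = right_creation i (right_mult \<beta> x)"
  by (simp_all add: right_mult_def)

text \<open>Together with \<open>right_mult_coeff_other\<close> this is the matrix of a left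
  multiplier: its column \<beta> is supported on the words ending in \<beta> and carries the symbol
  there.\<close>

lemma right_mult_coeff_append: "ell2_coeff (right_mult \<beta> x) (\<alpha> @ \<beta>) = ell2_coeff x \<alpha>"
  by (induction \<beta> arbitrary: \<alpha> rule: rev_induct)
    (simp_all add: right_mult_simps right_creation_coeff butlast_append)

lemma right_mult_coeff_other:
  assumes "\<nexists>\<alpha>. w = \<alpha> @ \<beta>"
  shows "ell2_coeff (right_mult \<beta> x) w = 0"
  using assms
proof (induction \<beta> arbitrary: w rule: rev_induct)
  case (snoc i \<beta>)
  show ?case
  proof (cases w rule: rev_cases)
    case (snoc u j)
    with snoc.prems have "j = i \<Longrightarrow> \<nexists>\<alpha>. u = \<alpha> @ \<beta>" by auto
    with snoc snoc.IH show ?thesis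
      by (auto simp: right_mult_simps right_creation_coeff)
  qed (simp add: right_mult_simps right_creation_coeff)
qed simp

section \<open>Left multipliers as a commutant\<close>

lemma right_mult_has_sum:
  "((\<lambda>\<alpha>. ell2_coeff c \<alpha> *\<^sub>C ell2_basis (\<alpha> @ \<beta>)) has_sum right_mult \<beta> c) UNIV"
  using has_sum_bounded_linear[OF blinfun.bounded_linear_right ell2_has_sum, of "right_mult \<beta>" c]
  by (simp add: o_def clinear_opD[OF clinear_op_right_mult] right_mult_basis)

text \<open>The series c of the definition is forced by \<beta> = []: it is the image of the vacuum
  vector. All other columns are obtained by appending.\<close>

lemma left_multipliers_iff:
  "T \<in> left_multipliers \<longleftrightarrow> clinear_op T \<and> (\<forall>\<beta>. T (ell2_basis \<beta>) = right_mult \<beta> (T (ell2_basis [])))"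
proof
  assume "T \<in> left_multipliers"
  then obtain c where T: "clinear_op T"
    "\<And>\<beta>. ((\<lambda>\<alpha>. ell2_coeff c \<alpha> *\<^sub>C ell2_basis (\<alpha> @ \<beta>)) has_sum T (ell2_basis \<beta>)) UNIV"
    unfolding left_multipliers_def BH_iff by auto
  then have *: "T (ell2_basis \<beta>) = right_mult \<beta> c" for \<beta>
    using right_mult_has_sum has_sum_unique by blast
  then show "clinear_op T \<and> (\<forall>\<beta>. T (ell2_basis \<beta>) = right_mult \<beta> (T (ell2_basis [])))"
    using T(1) by (simp add: right_mult_simps)
next
  assume T: "clinear_op T \<and> (\<forall>\<beta>. T (ell2_basis \<beta>) = right_mult \<beta> (T (ell2_basis [])))"
  have "((\<lambda>\<alpha>. ell2_coeff (T (ell2_basis [])) \<alpha> *\<^sub>C ell2_basis (\<alpha> @ \<beta>)) has_sum T (ell2_basis \<beta>)) UNIV" for \<beta>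
    by (subst conjunct2[OF T, rule_format]) (rule right_mult_has_sum)
  with T show "T \<in> left_multipliers"
    unfolding left_multipliers_def BH_iff by blast
qed

text \<open>Multipliers are the commutant of the right creations. This condition is linear in T and
  tests single letters only, which makes sums, products and weak limits immediate.\<close>

lemma left_multipliers_commute:
  "T \<in> left_multipliers \<longleftrightarrow> clinear_op T \<and> (\<forall>i x. T (right_creation i x) = right_creation i (T x))"
proof
  assume T: "T \<in> left_multipliers"
  then have c: "clinear_op T" by (simp add: left_multipliers_iff)
  have "T o\<^sub>L right_creation i = right_creation i o\<^sub>L T" for i
  proof (rule clinear_op_ell2_eqI)
    fix \<beta>
    have *: "T (ell2_basis \<gamma>) = right_mult \<gamma> (T (ell2_basis []))" for \<gamma>
      using T unfolding left_multipliers_iff by blast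
    show "(T o\<^sub>L right_creation i) (ell2_basis \<beta>) = (right_creation i o\<^sub>L T) (ell2_basis \<beta>)"
      using *[of "\<beta> @ [i]"] *[of \<beta>] by (simp add: right_creation_basis right_mult_simps)
  qed (auto intro!: clinear_op_intros c)
  then have "T (right_creation i x) = right_creation i (T x)" for i x
    by (metis blinfun_apply_blinfun_compose)
  with c show "clinear_op T \<and> (\<forall>i x. T (right_creation i x) = right_creation i (T x))" by simp
next
  assume T: "clinear_op T \<and> (\<forall>i x. T (right_creation i x) = right_creation i (T x))"
  have "T (right_mult \<beta> x) = right_mult \<beta> (T x)" for \<beta> x
    by (induction \<beta> rule: rev_induct) (use T in \<open>simp_all add: right_mult_simps\<close>)
  from this[of _ "ell2_basis []"] have "T (ell2_basis \<beta>) = right_mult \<beta> (T (ell2_basis []))" for \<beta>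
    by (metis append_Nil right_mult_basis)
  with T show "T \<in> left_multipliers"
    unfolding left_multipliers_iff by blast
qed

lemma left_multipliers_intros:
  "id_blinfun \<in> left_multipliers"
  "S \<in> left_multipliers \<Longrightarrow> T \<in> left_multipliers \<Longrightarrow> S + T \<in> left_multipliers"
  "S \<in> left_multipliers \<Longrightarrow> T \<in> left_multipliers \<Longrightarrow> S o\<^sub>L T \<in> left_multipliers"
  "S \<in> left_multipliers \<Longrightarrow> c *\<^sub>C S \<in> left_multipliers"
  "left_creation i \<in> left_multipliers"
  by (auto simp: left_multipliers_commute clinear_op_intros blinfun.add_left blinfun.add_right
      clinear_opD[OF clinear_op_right_creation] left_right_creation_commute)

lemma left_multipliers_eqI:
  assumes "S \<in> left_multipliers" "T \<in> left_multipliers" "fourier_coeff S = fourier_coeff T"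
  shows "S = T"
proof (rule clinear_op_ell2_eqI)
  have "S (ell2_basis []) = T (ell2_basis [])"
    using assms(3) by (intro ell2_eqI) (metis fourier_coeff_def)
  then show "S (ell2_basis \<beta>) = T (ell2_basis \<beta>)" for \<beta>
    using assms(1,2) by (metis left_multipliers_iff)
qed (use assms in \<open>simp_all add: left_multipliers_iff\<close>)

lemma operator_algebra_left_multipliers: "operator_algebra left_multipliers"
  unfolding operator_algebra_def by (simp add: left_multipliers_intros)

section \<open>Row norms and homogeneous parts\<close>

lemma inner_adj: "inner (blinfun_apply A x) y = inner x (adj A y)"
  by (simp add: adj.rep_eq inner_adjoint blinfun.bounded_linear_right)

lemma row_norm_eq: "row_norm X = sqrt (onorm (blinfun_apply (\<Sum>i\<in>UNIV. X i o\<^sub>L adj (X i))))"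
  by (simp add: row_norm_def adj.rep_eq[symmetric] sum_blinfun_apply[abs_def])

lemma row_norm_nonneg [simp]: "0 \<le> row_norm X"
  by (simp add: row_norm_eq norm_blinfun.rep_eq[symmetric])

text \<open>For Q the sum of the products of X_i with its adjoint, (Q x, x) is the sum of squares,
  and |Q| is the square of the row norm. \<open>row_norm_leI\<close> is the converse.\<close>

lemma sum_norm_adj_le: "(\<Sum>i\<in>UNIV. (norm (adj (X i) x))\<^sup>2) \<le> (row_norm X)\<^sup>2 * (norm x)\<^sup>2"
proof -
  let ?Q = "\<Sum>i\<in>UNIV. X i o\<^sub>L adj (X i)"
  have "(\<Sum>i\<in>UNIV. (norm (adj (X i) x))\<^sup>2) = inner (?Q x) x"
    by (simp add: sum_blinfun_apply inner_sum_left inner_adj power2_norm_eq_inner)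
  also have "\<dots> \<le> norm (?Q x) * norm x" by (rule norm_cauchy_schwarz)
  also have "\<dots> \<le> (norm ?Q * norm x) * norm x"
    by (intro mult_right_mono norm_blinfun) simp
  also have "norm ?Q = (row_norm X)\<^sup>2"
    by (simp add: row_norm_eq norm_blinfun.rep_eq[symmetric])
  finally show ?thesis by (simp add: power2_eq_square mult_ac)
qed

lemma row_norm_leI:
  assumes \<rho>: "0 \<le> \<rho>" and le: "\<And>x. (\<Sum>i\<in>UNIV. (norm (adj (X i) x))\<^sup>2) \<le> \<rho>\<^sup>2 * (norm x)\<^sup>2"
  shows "row_norm X \<le> \<rho>"
proof -
  let ?Q = "\<Sum>i\<in>UNIV. X i o\<^sub>L adj (X i)"
  have le': "sqrt (\<Sum>i\<in>UNIV. (norm (adj (X i) x))\<^sup>2) \<le> \<rho> * norm x" for x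
    using real_sqrt_le_mono[OF le[of x]] \<rho> by (simp add: real_sqrt_mult)
  have "norm ?Q \<le> \<rho>\<^sup>2"
  proof (rule norm_blinfun_bound)
    fix x
    \<comment> \<open>In place of a spectral argument for the positive operator Q, the vector v = Q
      x is tested against itself, and the column bound is used at both x and v.\<close>
    define v where "v = ?Q x"
    have "norm v * norm v = inner (?Q x) v"
      by (simp add: v_def power2_norm_eq_inner[symmetric] power2_eq_square)
    also have "\<dots> = (\<Sum>i\<in>UNIV. inner (adj (X i) x) (adj (X i) v))"
      by (simp add: sum_blinfun_apply inner_sum_left inner_adj)
    also have "\<dots> \<le> (\<Sum>i\<in>UNIV. \<bar>norm (adj (X i) x) * norm (adj (X i) v)\<bar>)"
      by (intro sum_mono) (simp add: abs_mult norm_cauchy_schwarz)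
    also have "\<dots> \<le> (\<rho> * norm x) * (\<rho> * norm v)"
      by (intro order_trans[OF CS_sum] mult_mono le') (simp_all add: \<rho> sum_nonneg)
    finally have *: "norm v * norm v \<le> (\<rho>\<^sup>2 * norm x) * norm v"
      by (simp add: power2_eq_square mult_ac)
    show "norm (?Q x) \<le> \<rho>\<^sup>2 * norm x"
      unfolding v_def[symmetric]
    proof (cases "v = 0")
      case False
      then show "norm v \<le> \<rho>\<^sup>2 * norm x"
        using * by simp
    qed (use \<rho> in simp)
  qed simp
  then have "sqrt (norm ?Q) \<le> sqrt (\<rho>\<^sup>2)" by (rule real_sqrt_le_mono)
  then show ?thesis
    using \<rho> by (simp add: row_norm_eq norm_blinfun.rep_eq)
qed

section \<open>Sums over words of given length\<close>

lemma finite_words [simp]: "finite {\<alpha> :: 'n::finite list. length \<alpha> = k}"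
  using finite_lists_length_eq[of "UNIV :: 'n set" k] by simp

lemma finite_short_words [simp]: "finite {\<alpha> :: 'n::finite list. length \<alpha> < k}"
proof -
  have "{\<alpha> :: 'n list. length \<alpha> < k} = (\<Union>j<k. {\<alpha>. length \<alpha> = j})" by auto
  then show ?thesis by simp
qed

lemma sum_words_Suc:
  "(\<Sum>\<alpha> | length \<alpha> = Suc k. g \<alpha>) = (\<Sum>i\<in>UNIV. \<Sum>\<alpha> | length \<alpha> = k. g (i # \<alpha>))"
  for g :: "'n::finite list \<Rightarrow> 'a::comm_monoid_add"
proof -
  have "{\<alpha> :: 'n list. length \<alpha> = Suc k} = (\<lambda>(i, \<alpha>). i # \<alpha>) ` (UNIV \<times> {\<alpha>. length \<alpha> = k})"
    by (auto simp: length_Suc_conv image_iff)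
  then have "(\<Sum>\<alpha> | length \<alpha> = Suc k. g \<alpha>) = (\<Sum>(i, \<alpha>)\<in>UNIV \<times> {\<alpha>. length \<alpha> = k}. g (i # \<alpha>))"
    by (simp add: sum.reindex inj_on_def o_def case_prod_unfold)
  then show ?thesis by (simp add: sum.cartesian_product)
qed

text \<open>Splitting off the last letter puts its adjoint outermost, acting on the adjoint of
  X_\<alpha> at x; this is the form in which the defect form occurs. Splitting off the first letter
  serves the inductions on word length.\<close>

lemma sum_words_snoc:
  "(\<Sum>\<alpha> | length \<alpha> = Suc k. g \<alpha>) = (\<Sum>\<alpha> | length \<alpha> = k. \<Sum>i\<in>UNIV. g (\<alpha> @ [i]))"
  for g :: "'n::finite list \<Rightarrow> 'a::comm_monoid_add"
proof -
  have "{\<alpha> :: 'n list. length \<alpha> = Suc k} = (\<lambda>(\<alpha>, i). \<alpha> @ [i]) ` ({\<alpha>. length \<alpha> = k} \<times> UNIV)"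
    by (auto simp: length_Suc_conv_rev image_iff)
  then have "(\<Sum>\<alpha> | length \<alpha> = Suc k. g \<alpha>) = (\<Sum>(\<alpha>, i)\<in>{\<alpha>. length \<alpha> = k} \<times> UNIV. g (\<alpha> @ [i]))"
    by (simp add: sum.reindex inj_on_def o_def case_prod_unfold)
  then show ?thesis by (simp add: sum.cartesian_product)
qed

lemma sum_words_by_length:
  "(\<Sum>\<alpha> | length \<alpha> < N. g \<alpha>) = (\<Sum>k<N. \<Sum>\<alpha> | length \<alpha> = k. g \<alpha>)"
  for g :: "'n::finite list \<Rightarrow> 'a::comm_monoid_add"
proof -
  have "{\<alpha> :: 'n list. length \<alpha> < N} = (\<Union>k<N. {\<alpha>. length \<alpha> = k})" by auto
  then show ?thesis by (simp add: sum.UNION_disjoint disjoint_iff)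
qed

text \<open>The adjoint of X_(i\<alpha>) applies the adjoint of X_i first, so the induction
  hypothesis is used at the resulting vector and the sum over i is one application of
  \<open>sum_norm_adj_le\<close>.\<close>

lemma sum_norm_adj_word_le:
  assumes "\<And>i. clinear_op (X i)"
  shows "(\<Sum>\<alpha> | length \<alpha> = k. (norm (adj (op_word X \<alpha>) x))\<^sup>2) \<le> (row_norm X ^ k)\<^sup>2 * (norm x)\<^sup>2"
proof (induction k arbitrary: x)
  case (Suc k)
  have "(\<Sum>\<alpha> | length \<alpha> = Suc k. (norm (adj (op_word X \<alpha>) x))\<^sup>2)
      = (\<Sum>i\<in>UNIV. \<Sum>\<alpha> | length \<alpha> = k. (norm (adj (op_word X \<alpha>) (adj (X i) x)))\<^sup>2)"
    by (simp add: sum_words_Suc adj_compose clinear_op_word assms)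
  also have "\<dots> \<le> (\<Sum>i\<in>UNIV. (row_norm X ^ k)\<^sup>2 * (norm (adj (X i) x))\<^sup>2)"
    by (intro sum_mono Suc.IH)
  also have "\<dots> \<le> (row_norm X ^ k)\<^sup>2 * ((row_norm X)\<^sup>2 * (norm x)\<^sup>2)"
    unfolding sum_distrib_left[symmetric] by (intro mult_left_mono sum_norm_adj_le) simp
  finally show ?case by (simp add: power2_eq_square mult_ac)
qed (simp add: adj_id)

text \<open>The Fock space norm of the part of degree k. For k > 0 its k-th root is the quantity
  whose limit superior defines \<open>ncps_radius\<close>.\<close>

definition hom_norm :: "'n::finite ncps \<Rightarrow> nat \<Rightarrow> real"
  where "hom_norm c k = sqrt (\<Sum>\<alpha> | length \<alpha> = k. (cmod (c \<alpha>))\<^sup>2)"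

lemma hom_norm_nonneg [simp]: "0 \<le> hom_norm c k"
  by (simp add: hom_norm_def sum_nonneg)

lemma hom_norm_ell2_le: "hom_norm (ell2_coeff x) k \<le> norm x"
  using real_sqrt_le_mono[OF sum_ell2_coeff_le[of "{\<alpha>. length \<alpha> = k}" x]]
  by (simp add: hom_norm_def)

lemma sum_hom_norm_le:
  assumes "\<And>i. clinear_op (X i)"
  shows "(\<Sum>\<alpha> | length \<alpha> = k. cmod (c \<alpha>) * norm (adj (op_word X \<alpha>) y))
    \<le> hom_norm c k * (row_norm X ^ k * norm y)"
proof -
  have "(\<Sum>\<alpha> | length \<alpha> = k. cmod (c \<alpha>) * norm (adj (op_word X \<alpha>) y))
      \<le> hom_norm c k * sqrt (\<Sum>\<alpha> | length \<alpha> = k. (norm (adj (op_word X \<alpha>) y))\<^sup>2)"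
    unfolding hom_norm_def by (rule order_trans[OF _ CS_sum]) (simp add: abs_mult)
  also have "\<dots> \<le> hom_norm c k * sqrt ((row_norm X ^ k)\<^sup>2 * (norm y)\<^sup>2)"
    by (intro mult_left_mono real_sqrt_le_mono sum_norm_adj_word_le assms) simp
  finally show ?thesis by (simp add: real_sqrt_mult)
qed

lemma cinner_nc_term:
  assumes "\<And>i. clinear_op (X i)"
  shows "cinner (nc_term c X k h) y = (\<Sum>\<alpha> | length \<alpha> = k. c \<alpha> * cinner h (adj (op_word X \<alpha>) y))"
  by (simp add: nc_term_def sum_blinfun_apply cinner.sum_left cinner_scaleC_left cinner_adj
      clinear_op_word assms)

lemma clinear_op_nc_term: "(\<And>i. clinear_op (X i)) \<Longrightarrow> clinear_op (nc_term c X k)"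
  unfolding nc_term_def by (intro clinear_op_sum clinear_op_intros clinear_op_word)

text \<open>With the words moved to the other side of the inner product, Cauchy-Schwarz pairs the l2
  norm of the coefficients with the column bound; a termwise triangle inequality would bring in the
  number of words.\<close>

lemma norm_nc_term_le:
  assumes "\<And>i. clinear_op (X i)"
  shows "norm (nc_term c X k) \<le> hom_norm c k * row_norm X ^ k"
proof (rule norm_blinfun_bound)
  fix h
  show "norm (nc_term c X k h) \<le> hom_norm c k * row_norm X ^ k * norm h"
  proof (rule norm_le_cinner)
    fix y
    have "cmod (cinner (nc_term c X k h) y)
        \<le> (\<Sum>\<alpha> | length \<alpha> = k. cmod (c \<alpha>) * (norm h * norm (adj (op_word X \<alpha>) y)))"
      unfolding cinner_nc_term[OF assms]
      by (intro sum_norm_le) (simp add: norm_mult mult_left_mono norm_cinner_le)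
    also have "\<dots> = norm h * (\<Sum>\<alpha> | length \<alpha> = k. cmod (c \<alpha>) * norm (adj (op_word X \<alpha>) y))"
      by (simp add: sum_distrib_left mult_ac)
    also have "\<dots> \<le> norm h * (hom_norm c k * (row_norm X ^ k * norm y))"
      by (intro mult_left_mono sum_hom_norm_le assms) simp
    finally show "cmod (cinner (nc_term c X k h) y) \<le> hom_norm c k * row_norm X ^ k * norm h * norm y"
      by (simp add: mult_ac)
  qed simp
qed simp

lemma op_ball_iff: "X \<in> op_ball \<gamma> \<longleftrightarrow> (\<forall>i. clinear_op (X i)) \<and> row_norm X < \<gamma>"
  by (simp add: op_ball_def BH_iff)

lemma nc_term_simps:
  "nc_term (\<lambda>\<alpha>. c \<alpha> + d \<alpha>) X k = nc_term c X k + nc_term d X k"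
  "nc_term (\<lambda>\<alpha>. z * c \<alpha>) X k = z *\<^sub>C nc_term c X k"
  "nc_term (\<lambda>\<alpha>. c \<alpha> * complex_of_real r ^ length \<alpha>) X k = r ^ k *\<^sub>R nc_term c X k"
proof -
  have [simp]: "(z * w) *\<^sub>C A = z *\<^sub>C (w *\<^sub>C A)" for z w and A :: "'a \<Rightarrow>\<^sub>L 'a"
    by (intro blinfun_eqI) (simp add: scaleC_scaleC)
  show "nc_term (\<lambda>\<alpha>. c \<alpha> + d \<alpha>) X k = nc_term c X k + nc_term d X k"
      "nc_term (\<lambda>\<alpha>. z * c \<alpha>) X k = z *\<^sub>C nc_term c X k"
    by (simp_all add: nc_term_def scaleC_blinfun.add_left sum.distrib scaleC_blinfun.sum_right)
  show "nc_term (\<lambda>\<alpha>. c \<alpha> * complex_of_real r ^ length \<alpha>) X k = r ^ k *\<^sub>R nc_term c X k"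
    unfolding nc_term_def scaleR_sum_right
    by (intro sum.cong refl blinfun_eqI)
      (simp add: blinfun.scaleR_left scaleR_scaleC scaleC_scaleC mult.commute)
qed

lemma op_word_scaleR: "op_word (\<lambda>i. r *\<^sub>R X i) \<alpha> = r ^ length \<alpha> *\<^sub>R op_word X \<alpha>"
  by (induction \<alpha>) (auto intro!: blinfun_eqI simp: blinfun.scaleR_left blinfun.scaleR_right)

lemma nc_term_scaleR: "nc_term c (\<lambda>i. r *\<^sub>R X i) k = r ^ k *\<^sub>R nc_term c X k"
  unfolding nc_term_def op_word_scaleR scaleR_sum_right
  by (intro sum.cong refl) (simp add: scaleC_blinfun.scaleR_right)

section \<open>Cauchy-Hadamard estimates\<close>

lemma summable_hom_norm:
  assumes c: "1 \<le> ncps_radius c" and r: "0 \<le> r" "r < 1"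
  shows "summable (\<lambda>k. hom_norm c k * r ^ k)"
proof -
  define s where "s k = (\<Sum>\<alpha> | length \<alpha> = k. (cmod (c \<alpha>))\<^sup>2)" for k
  have s0: "0 \<le> s k" for k by (simp add: s_def sum_nonneg)
  \<comment> \<open>The gap between r and q turns the root bound q^(-k) into the geometric majorant
    (r/q)^k.\<close>
  obtain q where q: "r < q" "q < 1" using dense[OF r(2)] by blast
  with r have q0: "0 < q" by simp
  define L where "L = limsup (\<lambda>k. ereal (root (2 * k) (s k)))"
  have "1 \<le> inverse L" using c by (simp add: ncps_radius_def L_def s_def)
  then have "L \<le> 1"
    by (cases L) (auto simp: inverse_eq_divide le_divide_eq_1 one_ereal_def split: if_splits)
  also have "1 < ereal (1 / q)"
    using q q0 by (simp add: one_ereal_def)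
  finally have "\<forall>\<^sub>F k in sequentially. ereal (root (2 * k) (s k)) < ereal (1 / q)"
    unfolding L_def by (rule Limsup_lessD)
  then have "\<forall>\<^sub>F k in sequentially. norm (hom_norm c k * r ^ k) \<le> (r / q) ^ k"
    \<comment> \<open>Degree 0 is excluded: \<open>root 0\<close> is constantly 0 and carries no
      information.\<close>
    using eventually_gt_at_top[of 0]
  proof eventually_elim
    case (elim k)
    have "root (2 * k) (s k) ^ (2 * k) \<le> (1 / q) ^ (2 * k)"
      using elim s0 by (intro power_mono) simp_all
    then have "s k \<le> ((1 / q) ^ k)\<^sup>2"
      using elim s0 by (simp add: power_mult[symmetric] mult.commute)
    then have "hom_norm c k \<le> (1 / q) ^ k"
      using q0 real_le_lsqrt[of "(1 / q) ^ k" "s k"] by (simp add: hom_norm_def s_def)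
    then have "hom_norm c k * r ^ k \<le> (1 / q) ^ k * r ^ k"
      using r by (intro mult_right_mono) simp_all
    then show ?case
      using r by (simp add: power_divide)
  qed
  then show ?thesis
    by (rule summable_comparison_test_ev) (use r q q0 in \<open>simp add: summable_geometric\<close>)
qed

text \<open>A bound C at the radius 1/y with 1 < y < x suffices for the comparison with x: C (y/x)^k
  tends to 0, so the constant does not survive the k-th root.\<close>

lemma ncps_radius_ge_one:
  assumes bound: "\<And>r. 0 < r \<Longrightarrow> r < 1 \<Longrightarrow> \<exists>C. \<forall>k. hom_norm c k * r ^ k \<le> C"
  shows "1 \<le> ncps_radius c"
proof -
  define s where "s k = (\<Sum>\<alpha> | length \<alpha> = k. (cmod (c \<alpha>))\<^sup>2)" for k
  have s0: "0 \<le> s k" for k by (simp add: s_def sum_nonneg)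
  define L where "L = limsup (\<lambda>k. ereal (root (2 * k) (s k)))"
  have L1: "L \<le> ereal x" if x: "1 < x" for x
    unfolding L_def
  proof (rule Limsup_bounded)
    obtain y where y: "1 < y" "y < x" using dense[OF x] by blast
    obtain C where C: "\<And>k. hom_norm c k * (1 / y) ^ k \<le> C"
      using bound[of "1 / y"] y by auto
    have "(\<lambda>k. C * (y / x) ^ k) \<longlonglongrightarrow> C * 0"
      using y by (intro tendsto_mult tendsto_const LIMSEQ_power_zero) simp
    then have "\<forall>\<^sub>F k in sequentially. C * (y / x) ^ k < 1"
      by (rule order_tendstoD) simp
    then show "\<forall>\<^sub>F k in sequentially. ereal (root (2 * k) (s k)) \<le> ereal x"
      using eventually_gt_at_top[of 0]
    proof eventually_elim
      case (elim k)
      have "hom_norm c k \<le> C * y ^ k"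
        using C[of k] y by (simp add: field_simps power_divide)
      also have "\<dots> = C * (y / x) ^ k * x ^ k"
        using x by (simp add: power_divide)
      also have "\<dots> \<le> 1 * x ^ k"
        using elim x by (intro mult_right_mono) simp_all
      finally have "(hom_norm c k)\<^sup>2 \<le> (x ^ k)\<^sup>2"
        by (intro power_mono) simp_all
      then have "s k \<le> x ^ (2 * k)"
        using s0 by (simp add: hom_norm_def s_def power_mult[symmetric] mult.commute)
      then have "root (2 * k) (s k) \<le> root (2 * k) (x ^ (2 * k))"
        using elim by simp
      then show ?case
        using elim x by (simp add: real_root_power_cancel)
    qed
  qed
  have "L \<le> 1"
  proof (rule ccontr)
    assume "\<not> L \<le> 1"
    then obtain x where "1 < ereal x" "ereal x < L"
      using ereal_dense2[of 1 L] by (auto simp: not_le)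
    with L1[of x] show False by (simp add: one_ereal_def)
  qed
  \<comment> \<open>Inversion of extended reals is antitone only on the nonnegative side.\<close>
  moreover have "0 \<le> L"
    unfolding L_def by (rule le_Limsup) (simp_all add: s0 real_root_ge_zero)
  ultimately have "inverse 1 \<le> inverse L"
    by (rule ereal_inverse_antimono[rotated])
  then show ?thesis by (simp add: ncps_radius_def L_def s_def)
qed

lemma ncps_radius_ell2: "1 \<le> ncps_radius (ell2_coeff x)"
proof (rule ncps_radius_ge_one)
  fix r :: real assume r: "0 < r" "r < 1"
  have "hom_norm (ell2_coeff x) k * r ^ k \<le> norm x * 1" for k
    using r by (intro mult_mono hom_norm_ell2_le power_le_one) simp_all
  then show "\<exists>C. \<forall>k. hom_norm (ell2_coeff x) k * r ^ k \<le> C" by blast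
qed

lemma summable_norm_nc_term:
  assumes "1 \<le> ncps_radius c" "X \<in> op_ball 1"
  shows "summable (\<lambda>k. norm (nc_term c X k))"
proof (rule summable_comparison_test)
  show "summable (\<lambda>k. hom_norm c k * row_norm X ^ k)"
    using assms by (intro summable_hom_norm) (simp_all add: op_ball_iff)
  show "\<exists>N. \<forall>k\<ge>N. norm (norm (nc_term c X k)) \<le> hom_norm c k * row_norm X ^ k"
    using assms(2) by (simp add: norm_nc_term_le op_ball_iff)
qed

lemma summable_nc_term: "1 \<le> ncps_radius c \<Longrightarrow> X \<in> op_ball 1 \<Longrightarrow> summable (nc_term c X)"
  by (rule summable_norm_cancel[OF summable_norm_nc_term])

lemma clinear_op_suminf:
  assumes "summable A" "\<And>k. clinear_op (A k)"
  shows "clinear_op (suminf A)"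
proof -
  have "suminf A \<in> Collect clinear_op"
  proof (rule Lim_in_closed_set[OF closed_clinear_op])
    show "(\<lambda>n. sum A {..<n}) \<longlonglongrightarrow> suminf A"
      using assms(1) by (rule summable_LIMSEQ)
  qed (auto intro!: always_eventually clinear_op_sum assms(2))
  then show ?thesis by simp
qed

lemma clinear_op_nc_eval:
  "1 \<le> ncps_radius c \<Longrightarrow> X \<in> op_ball 1 \<Longrightarrow> clinear_op (nc_eval c X)"
  unfolding nc_eval_def
  by (rule clinear_op_suminf[OF summable_nc_term]) (auto simp: op_ball_iff intro!: clinear_op_nc_term)

section \<open>The von Neumann inequality\<close>

locale positive_form =
  fixes D :: "'a::chilbert_space \<Rightarrow> 'a \<Rightarrow> complex"
  assumes add_left: "D (x + y) z = D x z + D y z"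
    and scaleC_left: "D (c *\<^sub>C x) y = c * D x y"
    and commute: "D x y = cnj (D y x)"
    and nonneg: "0 \<le> Re (D x x)"
begin

lemma add_right: "D x (y + z) = D x y + D x z"
  by (metis add_left commute complex_cnj_add)

lemma scaleC_right: "D x (c *\<^sub>C y) = cnj c * D x y"
  by (metis scaleC_left commute complex_cnj_mult)

lemma zero_left [simp]: "D 0 y = 0"
  using scaleC_left[of 0 0 y] by simp

lemma diff_left: "D (x - y) z = D x z - D y z"
  using add_left[of "x - y" y z] by simp

lemma sum_left: "D (\<Sum>i\<in>F. x i) y = (\<Sum>i\<in>F. D (x i) y)"
  by (induction F rule: infinite_finite_induct) (simp_all add: add_left)

lemma self_real: "D x x = complex_of_real (Re (D x x))"
  using commute[of x x] by (metis Reals_cnj_iff of_real_Re)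

lemma null:
  assumes "D x x = 0"
  shows "D x y = 0"
proof (rule ccontr)
  assume ne: "D x y \<noteq> 0"
  \<comment> \<open>Chosen so that the form would take the value -1 at t x + y.\<close>
  define s where "s = (Re (D y y) + 1) / (2 * (cmod (D x y))\<^sup>2)"
  define t where "t = - complex_of_real s * cnj (D x y)"
  have "D (t *\<^sub>C x + y) (t *\<^sub>C x + y) = t * D x y + cnj (t * D x y) + D y y"
    using commute[of y x] by (simp add: add_left add_right scaleC_left scaleC_right assms)
  moreover have "t * D x y = - complex_of_real (s * (cmod (D x y))\<^sup>2)"
    using complex_norm_square[of "D x y"] by (simp add: t_def mult_ac)
  ultimately have "Re (D (t *\<^sub>C x + y) (t *\<^sub>C x + y)) = - 2 * s * (cmod (D x y))\<^sup>2 + Re (D y y)"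
    by (simp del: of_real_mult of_real_power)
  also have "\<dots> = - 1"
    using ne by (simp add: s_def field_simps)
  finally show False
    using nonneg[of "t *\<^sub>C x + y"] by simp
qed

text \<open>Only the values of D are expanded, not the vectors: a residual r with D r r = 0 is
  invisible to D by \<open>null\<close> and is dropped. Degenerate forms and dependent vectors are
  thereby covered.\<close>

lemma gram_schmidt:
  assumes "finite A"
  shows "\<exists>B. finite B \<and> (\<forall>b\<in>B. \<forall>b'\<in>B. D b b' = (if b = b' then 1 else 0)) \<and>
    (\<forall>u\<in>A. \<forall>y. D u y = (\<Sum>b\<in>B. D u b * D b y))"
  using assms
proof (induction A)
  case (insert a A)
  then obtain B where B: "finite B" "\<And>b b'. b \<in> B \<Longrightarrow> b' \<in> B \<Longrightarrow> D b b' = (if b = b' then 1 else 0)"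
    and A: "\<And>u y. u \<in> A \<Longrightarrow> D u y = (\<Sum>b\<in>B. D u b * D b y)"
    by metis
  define r where "r = a - (\<Sum>b\<in>B. D a b *\<^sub>C b)"
  have Dr: "D r y = D a y - (\<Sum>b\<in>B. D a b * D b y)" for y
    by (simp add: r_def diff_left sum_left scaleC_left)
  have r_orth: "D r b = 0" if "b \<in> B" for b
  proof -
    have "(\<Sum>b'\<in>B. D a b' * D b' b) = (\<Sum>b'\<in>B. if b' = b then D a b' else 0)"
      using that by (intro sum.cong) (simp_all add: B(2))
    then show ?thesis using that B(1) by (simp add: Dr)
  qed
  show ?case
  proof (cases "D r r = 0")
    case True
    have "D a y = (\<Sum>b\<in>B. D a b * D b y)" for y
      using null[OF True, of y] Dr[of y] by simp
    then have "\<forall>u\<in>insert a A. \<forall>y. D u y = (\<Sum>b\<in>B. D u b * D b y)"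
      using A by blast
    then show ?thesis
    proof (intro exI[of _ B] conjI)
      show "\<forall>b\<in>B. \<forall>b'\<in>B. D b b' = (if b = b' then 1 else 0)" using B(2) by blast
    qed (rule B(1))
  next
    case False
    define n where "n = Re (D r r)"
    have n: "D r r = complex_of_real n" "0 < n"
      using False nonneg[of r] self_real[of r] by (auto simp: n_def less_le)
    define w where "w = complex_of_real (1 / sqrt n)"
    have w: "cnj w = w" "w * w * complex_of_real n = 1"
    proof -
      have "w * w * complex_of_real n = complex_of_real (1 / sqrt n * (1 / sqrt n) * n)"
        by (simp only: w_def of_real_mult)
      also have "1 / sqrt n * (1 / sqrt n) * n = 1"
        using n(2) by (simp add: field_simps)
      finally show "w * w * complex_of_real n = 1" by simp
    qed (simp add: w_def)
    define b0 where "b0 = w *\<^sub>C r"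
    have b0b0: "D b0 b0 = 1"
      using w by (simp add: b0_def scaleC_left scaleC_right n mult_ac)
    have b0B: "D b0 b = 0" if "b \<in> B" for b
      using r_orth[OF that] by (simp add: b0_def scaleC_left)
    have Bb0: "D b b0 = 0" if "b \<in> B" for b
      using b0B[OF that] commute[of b b0] by simp
    have "b0 \<notin> B" using b0b0 b0B by force
    have "D u y = (\<Sum>b\<in>insert b0 B. D u b * D b y)" if "u \<in> insert a A" for u y
    proof (cases "u \<in> A")
      case True
      then have "D u b0 = 0"
        using A[of u b0] Bb0 by (simp add: sum.neutral)
      then show ?thesis
        using \<open>b0 \<notin> B\<close> B(1) A[OF True, of y] by simp
    next
      case False
      with that have [simp]: "u = a" by simp
      have "D a b0 = D r b0"
        using Dr[of b0] Bb0 by (simp add: sum.neutral)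
      then have "D a b0 = w * complex_of_real n"
        using w(1) unfolding b0_def scaleC_right[of r] n(1) by simp
      moreover have "D b0 y = w * D r y"
        by (simp add: b0_def scaleC_left)
      ultimately have "D a b0 * D b0 y = (w * w * complex_of_real n) * D r y"
        by simp
      then have "D a b0 * D b0 y = D r y"
        by (simp only: w(2) mult_1)
      then show ?thesis
        using \<open>b0 \<notin> B\<close> B(1) by (simp add: Dr)
    qed
    moreover have "D b b' = (if b = b' then 1 else 0)" if "b \<in> insert b0 B" "b' \<in> insert b0 B" for b b'
      using that B(2) b0b0 b0B Bb0 \<open>b0 \<notin> B\<close> by auto
    ultimately show ?thesis
      using B(1) by (intro exI[of _ "insert b0 B"] conjI ballI allI) simp_all
  qed
qed (auto intro!: exI[of _ "{}"])

text \<open>In D-orthonormal coordinates the sum splits into the pairings of T x_b with y_b, one for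
  each b. This is the action of T tensored with the identity, and Cauchy-Schwarz over b keeps the
  constant |T|.\<close>

lemma matrix_bound:
  assumes T: "clinear_op T" and A: "finite A" and B: "finite B"
  shows "cmod (\<Sum>\<alpha>\<in>A. \<Sum>\<beta>\<in>B. ell2_coeff (T (ell2_basis \<beta>)) \<alpha> * D (u \<beta>) (v \<alpha>))
    \<le> norm T * (sqrt (\<Sum>\<beta>\<in>B. Re (D (u \<beta>) (u \<beta>))) * sqrt (\<Sum>\<alpha>\<in>A. Re (D (v \<alpha>) (v \<alpha>))))"
proof -
  obtain G where G: "finite G"
    "\<And>w y. w \<in> u ` B \<union> v ` A \<Longrightarrow> D w y = (\<Sum>b\<in>G. D w b * D b y)"
    using gram_schmidt[of "u ` B \<union> v ` A"] A B by blast
  have sq: "Re (D w w) = (\<Sum>b\<in>G. (cmod (D w b))\<^sup>2)" if "w \<in> u ` B \<union> v ` A" for w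
  proof -
    have "D w w = (\<Sum>b\<in>G. complex_of_real ((cmod (D w b))\<^sup>2))"
      unfolding G(2)[OF that, of w] by (intro sum.cong refl) (metis commute complex_norm_square)
    then show ?thesis by simp
  qed
  define x where "x b = (\<Sum>\<beta>\<in>B. D (u \<beta>) b *\<^sub>C ell2_basis \<beta>)" for b
  define y where "y b = (\<Sum>\<alpha>\<in>A. D (v \<alpha>) b *\<^sub>C ell2_basis \<alpha>)" for b
  have nx: "(\<Sum>b\<in>G. (norm (x b))\<^sup>2) = (\<Sum>\<beta>\<in>B. Re (D (u \<beta>) (u \<beta>)))"
    by (simp add: x_def norm_sum_ell2_basis[OF B] sq sum.swap[of _ _ G])
  have ny: "(\<Sum>b\<in>G. (norm (y b))\<^sup>2) = (\<Sum>\<alpha>\<in>A. Re (D (v \<alpha>) (v \<alpha>)))"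
    by (simp add: y_def norm_sum_ell2_basis[OF A] sq sum.swap[of _ _ G])
  have "(\<Sum>b\<in>G. cinner (T (x b)) (y b))
      = (\<Sum>b\<in>G. \<Sum>\<alpha>\<in>A. \<Sum>\<beta>\<in>B. ell2_coeff (T (ell2_basis \<beta>)) \<alpha> * (D (u \<beta>) b * D b (v \<alpha>)))"
  proof (intro sum.cong refl)
    fix b
    have "cinner (T (x b)) (y b)
        = (\<Sum>\<alpha>\<in>A. \<Sum>\<beta>\<in>B. D (u \<beta>) b * (cnj (D (v \<alpha>) b) * cinner (T (ell2_basis \<beta>)) (ell2_basis \<alpha>)))"
      unfolding x_def y_def blinfun.sum_right cinner.sum_right unfolding cinner.sum_left
      by (simp add: clinear_opD[OF T] cinner_scaleC_left cinner_scaleC_right mult_ac)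
    then show "cinner (T (x b)) (y b)
        = (\<Sum>\<alpha>\<in>A. \<Sum>\<beta>\<in>B. ell2_coeff (T (ell2_basis \<beta>)) \<alpha> * (D (u \<beta>) b * D b (v \<alpha>)))"
      using commute[of b] by (simp add: cinner_ell2_basis mult_ac)
  qed
  also have "\<dots> = (\<Sum>\<alpha>\<in>A. \<Sum>\<beta>\<in>B. \<Sum>b\<in>G. ell2_coeff (T (ell2_basis \<beta>)) \<alpha> * (D (u \<beta>) b * D b (v \<alpha>)))"
    by (simp add: sum.swap[of _ _ G])
  also have "\<dots> = (\<Sum>\<alpha>\<in>A. \<Sum>\<beta>\<in>B. ell2_coeff (T (ell2_basis \<beta>)) \<alpha> * D (u \<beta>) (v \<alpha>))"
    by (intro sum.cong refl) (simp add: sum_distrib_left[symmetric] G(2)[symmetric])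
  finally have "cmod (\<Sum>\<alpha>\<in>A. \<Sum>\<beta>\<in>B. ell2_coeff (T (ell2_basis \<beta>)) \<alpha> * D (u \<beta>) (v \<alpha>))
      = cmod (\<Sum>b\<in>G. cinner (T (x b)) (y b))" by simp
  also have "\<dots> \<le> (\<Sum>b\<in>G. norm T * \<bar>norm (x b) * norm (y b)\<bar>)"
  proof (rule sum_norm_le)
    fix b
    have "cmod (cinner (T (x b)) (y b)) \<le> norm T * norm (x b) * norm (y b)"
      by (rule order_trans[OF norm_cinner_le]) (intro mult_right_mono norm_blinfun norm_ge_zero)
    then show "cmod (cinner (T (x b)) (y b)) \<le> norm T * \<bar>norm (x b) * norm (y b)\<bar>"
      by (simp add: abs_mult mult_ac)
  qed
  also have "\<dots> \<le> norm T * (sqrt (\<Sum>b\<in>G. (norm (x b))\<^sup>2) * sqrt (\<Sum>b\<in>G. (norm (y b))\<^sup>2))"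
    unfolding sum_distrib_left[symmetric] by (intro mult_left_mono CS_sum) simp
  finally show ?thesis by (simp add: nx ny)
qed

end

section \<open>The defect form of a row contraction\<close>

lemma blinfun_compose_id [simp]: "A o\<^sub>L id_blinfun = A" "id_blinfun o\<^sub>L A = A"
  by (rule blinfun_eqI; simp)+

text \<open>The form of \<Phi>^k(I), where \<Phi>(A) is the sum of X_i A X_i^* over i;
  \<open>defect_form\<close> is the form of I - \<Phi>(I).\<close>

definition word_form ::
    "('n::finite \<Rightarrow> 'h::chilbert_space \<Rightarrow>\<^sub>L 'h) \<Rightarrow> nat \<Rightarrow> 'h \<Rightarrow> 'h \<Rightarrow> complex"
  where "word_form X k x y = (\<Sum>\<alpha> | length \<alpha> = k. cinner (adj (op_word X \<alpha>) x) (adj (op_word X \<alpha>) y))"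

definition defect_form ::
    "('n::finite \<Rightarrow> 'h::chilbert_space \<Rightarrow>\<^sub>L 'h) \<Rightarrow> 'h \<Rightarrow> 'h \<Rightarrow> complex"
  where "defect_form X x y = cinner x y - (\<Sum>i\<in>UNIV. cinner (adj (X i) x) (adj (X i) y))"

context
  fixes X :: "'n::finite \<Rightarrow> 'h::chilbert_space \<Rightarrow>\<^sub>L 'h"
  assumes X: "\<And>i. clinear_op (X i)" and X1: "row_norm X \<le> 1"
begin

lemma positive_form_defect: "positive_form (defect_form X)"
proof
  fix x y z :: 'h and c :: complex
  note adjc = clinear_opD[OF clinear_op_adj[OF X]]
  show "defect_form X (x + y) z = defect_form X x z + defect_form X y z"
    by (simp add: defect_form_def cinner_add_left blinfun.add_right sum.distrib)
  show "defect_form X (c *\<^sub>C x) y = c * defect_form X x y"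
    by (simp add: defect_form_def cinner_scaleC_left adjc sum_distrib_left right_diff_distrib)
  show "defect_form X x y = cnj (defect_form X y x)"
    by (simp add: defect_form_def cinner_commute[of x] cinner_commute[of "adj (X _) x"])
  have "(\<Sum>i\<in>UNIV. (norm (adj (X i) x))\<^sup>2) \<le> (row_norm X)\<^sup>2 * (norm x)\<^sup>2"
    by (rule sum_norm_adj_le)
  also have "\<dots> \<le> 1\<^sup>2 * (norm x)\<^sup>2"
    using X1 by (intro mult_right_mono power_mono) simp_all
  finally have "(\<Sum>i\<in>UNIV. (norm (adj (X i) x))\<^sup>2) \<le> (norm x)\<^sup>2" by simp
  moreover have "Re (cinner x x) = (norm x)\<^sup>2" for x :: 'h
    by (simp add: cinner_self)
  ultimately show "0 \<le> Re (defect_form X x x)"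
    by (simp add: defect_form_def)
qed

text \<open>Splitting off the last letter shows that the words of length k contribute \<Phi>^k(I) -
  \<Phi>^(k+1)(I), with \<Phi> the map behind \<open>word_form\<close>; the sum telescopes.\<close>

lemma sum_defect_word:
  "(\<Sum>\<alpha> | length \<alpha> < N. defect_form X (adj (op_word X \<alpha>) x) (adj (op_word X \<alpha>) y))
    = cinner x y - word_form X N x y"
proof -
  have "(\<Sum>\<alpha> | length \<alpha> = k. defect_form X (adj (op_word X \<alpha>) x) (adj (op_word X \<alpha>) y))
      = word_form X k x y - word_form X (Suc k) x y" for k
    unfolding word_form_def sum_words_snoc
    by (simp add: defect_form_def sum_subtractf op_word_append adj_compose clinear_op_word X)
  then have "(\<Sum>\<alpha> | length \<alpha> < N. defect_form X (adj (op_word X \<alpha>) x) (adj (op_word X \<alpha>) y))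
      = (\<Sum>k<N. word_form X k x y - word_form X (Suc k) x y)"
    by (simp only: sum_words_by_length)
  also have "\<dots> = word_form X 0 x y - word_form X N x y"
    by (rule sum_lessThan_telescope')
  finally show ?thesis by (simp add: word_form_def adj_id)
qed

lemma norm_word_form_le: "cmod (word_form X k x y) \<le> (row_norm X ^ k)\<^sup>2 * (norm x * norm y)"
proof -
  have sq: "sqrt (\<Sum>\<alpha> | length \<alpha> = k. (norm (adj (op_word X \<alpha>) x))\<^sup>2) \<le> row_norm X ^ k * norm x" for x
    using real_sqrt_le_mono[OF sum_norm_adj_word_le[where X = X and k = k and x = x, OF X]] by (simp add: real_sqrt_mult)
  have "cmod (word_form X k x y)
      \<le> (\<Sum>\<alpha> | length \<alpha> = k. \<bar>norm (adj (op_word X \<alpha>) x) * norm (adj (op_word X \<alpha>) y)\<bar>)"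
    unfolding word_form_def by (intro sum_norm_le) (simp add: abs_mult norm_cinner_le)
  also have "\<dots> \<le> (row_norm X ^ k * norm x) * (row_norm X ^ k * norm y)"
    by (intro order_trans[OF CS_sum] mult_mono sq) (simp_all add: sum_nonneg)
  finally show ?thesis by (simp add: power2_eq_square mult_ac)
qed

text \<open>A truncated Poisson formula: the matrix of T on words shorter than N is paired with the
  defect form. For a fixed \<gamma> only the \<beta> with |\<gamma>| + |\<beta>| < N remain, so the
  telescoping stops at length N - |\<gamma>| and leaves the subtracted term.\<close>

lemma von_Neumann_finite:
  assumes T: "T \<in> left_multipliers"
  shows "cmod (\<Sum>\<gamma> | length \<gamma> < N. fourier_coeff T \<gamma> * (cinner x (adj (op_word X \<gamma>) y) -
      word_form X (N - length \<gamma>) x (adj (op_word X \<gamma>) y))) \<le> norm T * (norm x * norm y)"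
proof -
  interpret positive_form "defect_form X" by (rule positive_form_defect)
  define W where "W = {\<alpha> :: 'n list. length \<alpha> < N}"
  define u where "u \<beta> = adj (op_word X \<beta>) x" for \<beta>
  define v where "v \<alpha> = adj (op_word X \<alpha>) y" for \<alpha>
  have [simp]: "finite W" by (simp add: W_def)
  have le: "(\<Sum>\<alpha>\<in>W. Re (defect_form X (adj (op_word X \<alpha>) z) (adj (op_word X \<alpha>) z))) \<le> (norm z)\<^sup>2" for z
  proof -
    have "0 \<le> Re (word_form X N z z)"
      by (simp add: word_form_def cinner_self sum_nonneg)
    moreover have "Re (cinner z z) = (norm z)\<^sup>2"
      by (simp add: cinner_self)
    ultimately show ?thesis
      using arg_cong[OF sum_defect_word[where N = N and x = z and y = z], of Re] by (simp add: W_def)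
  qed
  have T': "ell2_coeff (T (ell2_basis \<beta>)) (\<gamma> @ \<beta>) = fourier_coeff T \<gamma>" for \<beta> \<gamma>
    using T unfolding left_multipliers_iff fourier_coeff_def by (metis right_mult_coeff_append)
  have T0: "ell2_coeff (T (ell2_basis \<beta>)) \<alpha> = 0" if "\<nexists>\<gamma>. \<alpha> = \<gamma> @ \<beta>" for \<alpha> \<beta>
    using T right_mult_coeff_other[OF that] unfolding left_multipliers_iff by metis
  \<comment> \<open>Column \<beta> of T lives on the words ending in \<beta>, so \<alpha> is
    replaced by \<gamma> @ \<beta>; the bound on the lengths is what truncation to W leaves.\<close>
  have row: "(\<Sum>\<alpha>\<in>W. ell2_coeff (T (ell2_basis \<beta>)) \<alpha> * defect_form X (u \<beta>) (v \<alpha>))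
      = (\<Sum>\<gamma> | \<gamma> \<in> W \<and> length \<gamma> + length \<beta> < N. fourier_coeff T \<gamma> * defect_form X (u \<beta>) (v (\<gamma> @ \<beta>)))" for \<beta>
  proof -
    define R where "R = {\<gamma> \<in> W. length \<gamma> + length \<beta> < N}"
    have "(\<Sum>\<alpha>\<in>W. ell2_coeff (T (ell2_basis \<beta>)) \<alpha> * defect_form X (u \<beta>) (v \<alpha>))
        = (\<Sum>\<alpha>\<in>(\<lambda>\<gamma>. \<gamma> @ \<beta>) ` R. ell2_coeff (T (ell2_basis \<beta>)) \<alpha> * defect_form X (u \<beta>) (v \<alpha>))"
    proof (rule sum.mono_neutral_right)
      show "(\<lambda>\<gamma>. \<gamma> @ \<beta>) ` R \<subseteq> W" by (auto simp: R_def W_def)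
      show "\<forall>\<alpha>\<in>W - (\<lambda>\<gamma>. \<gamma> @ \<beta>) ` R.
          ell2_coeff (T (ell2_basis \<beta>)) \<alpha> * defect_form X (u \<beta>) (v \<alpha>) = 0"
      proof
        fix \<alpha> assume "\<alpha> \<in> W - (\<lambda>\<gamma>. \<gamma> @ \<beta>) ` R"
        then have "\<nexists>\<gamma>. \<alpha> = \<gamma> @ \<beta>" by (auto simp: R_def W_def)
        then show "ell2_coeff (T (ell2_basis \<beta>)) \<alpha> * defect_form X (u \<beta>) (v \<alpha>) = 0"
          by (simp add: T0)
      qed
    qed simp
    also have "\<dots> = (\<Sum>\<gamma>\<in>R. fourier_coeff T \<gamma> * defect_form X (u \<beta>) (v (\<gamma> @ \<beta>)))"
      by (subst sum.reindex) (auto simp: inj_on_def T')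
    finally show ?thesis by (simp add: R_def)
  qed
  \<comment> \<open>The adjoint of X_(\<gamma>\<beta>) is that of X_\<beta> after that of
    X_\<gamma>, so the sum over \<beta> telescopes for the pair x and X_\<gamma>^* y.\<close>
  have col: "(\<Sum>\<beta> | \<beta> \<in> W \<and> length \<gamma> + length \<beta> < N. fourier_coeff T \<gamma> * defect_form X (u \<beta>) (v (\<gamma> @ \<beta>)))
      = fourier_coeff T \<gamma> * (cinner x (adj (op_word X \<gamma>) y) -
          word_form X (N - length \<gamma>) x (adj (op_word X \<gamma>) y))" for \<gamma>
  proof -
    have "{\<beta>. \<beta> \<in> W \<and> length \<gamma> + length \<beta> < N} = {\<beta>. length \<beta> < N - length \<gamma>}"
      by (auto simp: W_def)
    then show ?thesis
      by (simp add: sum_distrib_left[symmetric] u_def v_def op_word_append adj_compose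
          clinear_op_word X sum_defect_word)
  qed
  have "(\<Sum>\<alpha>\<in>W. \<Sum>\<beta>\<in>W. ell2_coeff (T (ell2_basis \<beta>)) \<alpha> * defect_form X (u \<beta>) (v \<alpha>))
      = (\<Sum>\<beta>\<in>W. \<Sum>\<gamma> | \<gamma> \<in> W \<and> length \<gamma> + length \<beta> < N.
          fourier_coeff T \<gamma> * defect_form X (u \<beta>) (v (\<gamma> @ \<beta>)))"
    by (subst sum.swap) (simp add: row)
  also have "\<dots> = (\<Sum>\<gamma>\<in>W. \<Sum>\<beta> | \<beta> \<in> W \<and> length \<gamma> + length \<beta> < N.
          fourier_coeff T \<gamma> * defect_form X (u \<beta>) (v (\<gamma> @ \<beta>)))"
    by (rule sum.swap_restrict) simp_all
  finally have "(\<Sum>\<gamma>\<in>W. fourier_coeff T \<gamma> * (cinner x (adj (op_word X \<gamma>) y) -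
      word_form X (N - length \<gamma>) x (adj (op_word X \<gamma>) y)))
      = (\<Sum>\<alpha>\<in>W. \<Sum>\<beta>\<in>W. ell2_coeff (T (ell2_basis \<beta>)) \<alpha> * defect_form X (u \<beta>) (v \<alpha>))"
    by (simp add: col)
  moreover have "cmod \<dots> \<le> norm T * (sqrt (\<Sum>\<beta>\<in>W. Re (defect_form X (u \<beta>) (u \<beta>))) *
      sqrt (\<Sum>\<alpha>\<in>W. Re (defect_form X (v \<alpha>) (v \<alpha>))))"
    using T by (intro matrix_bound) (simp_all add: left_multipliers_commute)
  moreover have "\<dots> \<le> norm T * (sqrt ((norm x)\<^sup>2) * sqrt ((norm y)\<^sup>2))"
    unfolding u_def v_def
    by (intro mult_left_mono mult_mono real_sqrt_le_mono le) (simp_all add: sum_nonneg nonneg)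
  ultimately show ?thesis by (simp add: W_def)
qed

end

theorem von_Neumann_inequality:
  assumes T: "T \<in> left_multipliers" and X: "X \<in> op_ball 1"
  shows "norm (nc_eval (fourier_coeff T) X) \<le> norm T"
proof -
  define c where "c = fourier_coeff T"
  define \<rho> where "\<rho> = row_norm X"
  have Xc: "clinear_op (X i)" for i using X by (simp add: op_ball_iff)
  have \<rho>: "0 \<le> \<rho>" "\<rho> < 1" using X by (simp_all add: op_ball_iff \<rho>_def)
  have cT: "c = ell2_coeff (T (ell2_basis []))"
    by (simp add: c_def fourier_coeff_def[abs_def])
  have sm: "summable (nc_term c X)"
    unfolding cT by (rule summable_nc_term[OF ncps_radius_ell2 X])
  have main: "cmod (cinner (nc_eval c X x) y) \<le> norm T * (norm x * norm y)" for x y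
  proof -
    define P where "P N = (\<Sum>\<gamma> | length \<gamma> < N. c \<gamma> * cinner x (adj (op_word X \<gamma>) y))" for N
    define E where "E N = (\<Sum>\<gamma> | length \<gamma> < N. c \<gamma> * word_form X (N - length \<gamma>) x (adj (op_word X \<gamma>) y))" for N
    have PE: "cmod (P N - E N) \<le> norm T * (norm x * norm y)" for N
      using von_Neumann_finite[where X = X and N = N and x = x and y = y, OF Xc _ T] \<rho>
      by (simp add: P_def E_def c_def \<rho>_def right_diff_distrib sum_subtractf)
    have "P N = (\<Sum>k<N. cinner (nc_term c X k x) y)" for N
      by (simp add: P_def sum_words_by_length cinner_nc_term[where X = X, OF Xc])
    moreover have "(\<lambda>N. \<Sum>k<N. cinner (nc_term c X k x) y) \<longlonglongrightarrow> cinner (nc_eval c X x) y"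
    proof -
      have "(\<lambda>N. cinner ((\<Sum>k<N. nc_term c X k) x) y) \<longlonglongrightarrow> cinner (nc_eval c X x) y"
        unfolding nc_eval_def
        by (intro cinner.tendsto tendsto_const blinfun.tendsto summable_LIMSEQ sm)
      then show ?thesis by (simp add: sum_blinfun_apply cinner.sum_left)
    qed
    ultimately have P: "P \<longlonglongrightarrow> cinner (nc_eval c X x) y"
      by (simp add: P_def[abs_def])
    define K where "K = norm (T (ell2_basis [])) * (norm x * norm y)"
    \<comment> \<open>In degree j the truncation error has a factor \<rho>^(2(N-j)) from
      \<open>word_form\<close> and a factor \<rho>^j from the words of length j. Together they are
      at most \<rho>^N, and there are N degrees.\<close>
    have E: "cmod (E N) \<le> (real N * \<rho> ^ N) * K" for N
    proof -
      have "cmod (E N) \<le> (\<Sum>j<N. \<Sum>\<gamma> | length \<gamma> = j.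
          cmod (c \<gamma>) * ((\<rho> ^ (N - j))\<^sup>2 * (norm x * norm (adj (op_word X \<gamma>) y))))"
        unfolding E_def sum_words_by_length
        using norm_word_form_le[where X = X, OF Xc] \<rho>
        by (intro sum_norm_le) (simp add: norm_mult \<rho>_def mult_left_mono less_imp_le)
      also have "\<dots> = (\<Sum>j<N. (\<rho> ^ (N - j))\<^sup>2 * norm x *
          (\<Sum>\<gamma> | length \<gamma> = j. cmod (c \<gamma>) * norm (adj (op_word X \<gamma>) y)))"
        by (simp add: sum_distrib_left mult_ac)
      also have "\<dots> \<le> (\<Sum>j<N. \<rho> ^ N * K)"
      proof (intro sum_mono)
        fix j assume j: "j \<in> {..<N}"
        have "(\<Sum>\<gamma> | length \<gamma> = j. cmod (c \<gamma>) * norm (adj (op_word X \<gamma>) y))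
            \<le> norm (T (ell2_basis [])) * (\<rho> ^ j * norm y)"
          unfolding \<rho>_def
          by (rule order_trans[OF sum_hom_norm_le[where X = X, OF Xc]])
            (auto intro!: mult_right_mono simp: cT hom_norm_ell2_le)
        then have "(\<rho> ^ (N - j))\<^sup>2 * norm x *
            (\<Sum>\<gamma> | length \<gamma> = j. cmod (c \<gamma>) * norm (adj (op_word X \<gamma>) y))
            \<le> (\<rho> ^ (N - j))\<^sup>2 * norm x * (norm (T (ell2_basis [])) * (\<rho> ^ j * norm y))"
          by (intro mult_left_mono) simp_all
        also have "\<dots> = \<rho> ^ (2 * (N - j) + j) * K"
          by (simp add: K_def power_add power_mult[symmetric] mult_ac power_even_eq)
        also have "\<dots> \<le> \<rho> ^ N * K"
          using j \<rho> by (intro mult_right_mono power_decreasing) (simp_all add: K_def)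
        finally show "(\<rho> ^ (N - j))\<^sup>2 * norm x *
            (\<Sum>\<gamma> | length \<gamma> = j. cmod (c \<gamma>) * norm (adj (op_word X \<gamma>) y)) \<le> \<rho> ^ N * K" .
      qed
      finally show ?thesis by simp
    qed
    have "(\<lambda>N. (real N * \<rho> ^ N) * K) \<longlonglongrightarrow> 0 * K"
      using \<rho> by (intro tendsto_mult tendsto_const powser_times_n_limit_0) simp
    then have "E \<longlonglongrightarrow> 0"
      using E by (intro Lim_null_comparison[of E]) (simp_all add: always_eventually)
    from tendsto_diff[OF P this] have "(\<lambda>N. P N - E N) \<longlonglongrightarrow> cinner (nc_eval c X x) y"
      by simp
    from tendsto_upperbound[OF tendsto_norm[OF this]] PE show ?thesis by simp
  qed
  show ?thesis
    unfolding c_def[symmetric]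
  proof (rule norm_blinfun_bound)
    show "norm (nc_eval c X x) \<le> norm T * norm x" for x
    proof (rule norm_le_cinner)
      show "cmod (cinner (nc_eval c X x) y) \<le> norm T * norm x * norm y" for y
        using main[of x y] by (simp add: mult.assoc)
    qed simp
  qed simp
qed

section \<open>Operator topologies\<close>

lemma limitin_pullback_topology:
  "limitin (pullback_topology UNIV g T) f l F \<longleftrightarrow> limitin T (\<lambda>t. g (f t)) (g l) F"
  by (auto simp: limitin_def topspace_pullback_topology openin_pullback_topology)

lemma tendsto_fun_iff:
  "(f \<longlongrightarrow> l) F \<longleftrightarrow> (\<forall>x. ((\<lambda>t. f t x) \<longlongrightarrow> l x) F)"
  for f :: "'t \<Rightarrow> 'a \<Rightarrow> 'b::topological_space"
  unfolding limitin_canonical_iff[symmetric] euclidean_product_topology[symmetric]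
    limitin_componentwise by simp

lemma limitin_sot_iff:
  "limitin strong_operator_topology f L F \<longleftrightarrow> (\<forall>x. ((\<lambda>t. f t x) \<longlongrightarrow> L x) F)"
  by (simp add: strong_operator_topology_def limitin_pullback_topology tendsto_fun_iff)

lemma limitin_wot_iff:
  "limitin weak_operator_topology f L F \<longleftrightarrow> (\<forall>x y. ((\<lambda>t. cinner (f t x) y) \<longlongrightarrow> cinner (L x) y) F)"
  by (simp add: weak_operator_topology_def limitin_pullback_topology tendsto_fun_iff)

lemma limitin_sot_imp_wot:
  "limitin strong_operator_topology f L F \<Longrightarrow> limitin weak_operator_topology f L F"
  by (simp add: limitin_sot_iff limitin_wot_iff cinner.tendsto)

lemma tendsto_imp_limitin_sot: "(f \<longlongrightarrow> L) F \<Longrightarrow> limitin strong_operator_topology f L F"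
  by (simp add: limitin_sot_iff blinfun.tendsto)

lemma limitin_sot_unique:
  assumes "limitin strong_operator_topology f L F" "limitin strong_operator_topology f L' F" "F \<noteq> bot"
  shows "L = L'"
  using assms by (intro blinfun_eqI) (auto simp: limitin_sot_iff intro: tendsto_unique)

section \<open>Weakly continuous maps and weakly closed sets\<close>

lemma topspace_wot [simp]: "topspace weak_operator_topology = UNIV"
  by (simp add: weak_operator_topology_def topspace_pullback_topology)

lemma continuous_map_wot_cinner:
  "continuous_map weak_operator_topology euclidean (\<lambda>A. cinner (blinfun_apply A x) y)"
proof -
  have "continuous_map weak_operator_topology euclidean
      ((\<lambda>g. g (x, y)) \<circ> (\<lambda>A (x, y). cinner (blinfun_apply A x) y))"
    unfolding weak_operator_topology_def
    by (intro continuous_map_pullback) (simp add: continuous_on_product_coordinates)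
  then show ?thesis by (simp add: o_def)
qed

lemma continuous_map_into_wot:
  assumes "\<And>x y. continuous_map T euclidean (\<lambda>t. cinner (blinfun_apply (f t) x) y)"
  shows "continuous_map T weak_operator_topology f"
  unfolding weak_operator_topology_def
proof (rule continuous_map_pullback')
  have "continuous_map T (product_topology (\<lambda>_. euclidean) UNIV) ((\<lambda>A (x, y). cinner (blinfun_apply A x) y) \<circ> f)"
    unfolding continuous_map_componentwise_UNIV by (auto simp: assms)
  then show "continuous_map T euclidean ((\<lambda>A (x, y). cinner (blinfun_apply A x) y) \<circ> f)"
    by (simp add: euclidean_product_topology)
qed auto

text \<open>A left factor is moved to the second vector as an adjoint, which is why it has to be
  complex-linear; a right factor merely changes the first vector.\<close>

lemma continuous_map_wot_compose_left:
  assumes "clinear_op B"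
  shows "continuous_map weak_operator_topology weak_operator_topology (\<lambda>A. B o\<^sub>L A)"
  by (rule continuous_map_into_wot) (simp add: cinner_adj[OF assms] continuous_map_wot_cinner)

lemma continuous_map_wot_compose_right:
  "continuous_map weak_operator_topology weak_operator_topology (\<lambda>A. A o\<^sub>L B)"
  by (rule continuous_map_into_wot) (simp add: continuous_map_wot_cinner)

lemma continuous_map_cmult:
  "continuous_map T euclidean f \<Longrightarrow> continuous_map T euclidean (\<lambda>x. c * f x :: complex)"
  by (simp add: continuous_map_atin tendsto_mult_left)

lemma continuous_map_wot_add_scaleC:
  "continuous_map weak_operator_topology weak_operator_topology (\<lambda>A. B + A)"
  "continuous_map weak_operator_topology weak_operator_topology (\<lambda>A. c *\<^sub>C A)"
  by (rule continuous_map_into_wot;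
      simp add: blinfun.add_left cinner_add_left cinner_scaleC_left continuous_map_add
        continuous_map_wot_cinner continuous_map_cmult)+

lemma closedin_wot_eq:
  assumes "continuous_map weak_operator_topology euclidean (f :: _ \<Rightarrow> complex)"
    "continuous_map weak_operator_topology euclidean g"
  shows "closedin weak_operator_topology {A. f A = g A}"
  using closedin_continuous_map_preimage[OF continuous_map_diff[OF assms], of "{0}"] by simp

lemma closedin_clinear_op: "closedin weak_operator_topology {T. clinear_op T}"
proof -
  have "{T. clinear_op T} = (\<Inter>c. \<Inter>x. \<Inter>y. {T :: 'a \<Rightarrow>\<^sub>L 'a. cinner (T (c *\<^sub>C x)) y = c * cinner (T x) y})"
    by (auto simp: clinear_op_def cinner_scaleC_left intro: cinner_eqI)
  moreover have "closedin weak_operator_topology \<dots>"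
    by (intro closedin_INT) (auto intro!: closedin_wot_eq continuous_map_cmult continuous_map_wot_cinner)
  ultimately show ?thesis by simp
qed

text \<open>A commutant is cut out by equations between weakly continuous functions, once the right
  creation acting after T is moved to the second vector.\<close>

lemma closedin_left_multipliers:
  "closedin weak_operator_topology (left_multipliers :: ('n list ell2 \<Rightarrow>\<^sub>L 'n list ell2) set)"
proof -
  let ?B = "\<Inter>i. \<Inter>x. \<Inter>y. {T :: 'n list ell2 \<Rightarrow>\<^sub>L 'n list ell2.
    cinner (T (right_creation i x)) y = cinner (T x) (adj (right_creation i) y)}"
  have "T \<in> left_multipliers \<longleftrightarrow> T \<in> {T. clinear_op T} \<inter> ?B" for T :: "'n list ell2 \<Rightarrow>\<^sub>L 'n list ell2"
  proof -
    have "T \<in> ?B \<longleftrightarrow> (\<forall>i x y. cinner (T (right_creation i x)) y = cinner (right_creation i (T x)) y)"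
      by (simp add: cinner_adj)
    also have "\<dots> \<longleftrightarrow> (\<forall>i x. T (right_creation i x) = right_creation i (T x))"
      using cinner_eqI by metis
    finally show ?thesis
      by (simp only: left_multipliers_commute Int_iff mem_Collect_eq)
  qed
  then have "left_multipliers = {T. clinear_op T} \<inter> ?B" by (rule set_eqI)
  moreover have "closedin weak_operator_topology ?B"
    by (intro closedin_INT) (auto intro!: closedin_wot_eq continuous_map_wot_cinner)
  ultimately show ?thesis using closedin_Int[OF closedin_clinear_op, of ?B] by simp
qed

section \<open>Weakly closed algebras generated by a tuple\<close>

lemma op_polynomials_iff:
  "T \<in> op_polynomials X \<longleftrightarrow> (\<exists>F p. finite F \<and> T = (\<Sum>\<alpha>\<in>F. p \<alpha> *\<^sub>C op_word X \<alpha>))"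
proof
  assume "T \<in> op_polynomials X"
  then show "\<exists>F p. finite F \<and> T = (\<Sum>\<alpha>\<in>F. p \<alpha> *\<^sub>C op_word X \<alpha>)"
    by (auto simp: op_polynomials_def nc_polynomial_def)
next
  assume "\<exists>F p. finite F \<and> T = (\<Sum>\<alpha>\<in>F. p \<alpha> *\<^sub>C op_word X \<alpha>)"
  then obtain F p where F: "finite F" and T: "T = (\<Sum>\<alpha>\<in>F. p \<alpha> *\<^sub>C op_word X \<alpha>)" by blast
  define q where "q \<alpha> = (if \<alpha> \<in> F then p \<alpha> else 0)" for \<alpha>
  have sub: "{\<alpha>. q \<alpha> \<noteq> 0} \<subseteq> F" by (auto simp: q_def)
  have "T = (\<Sum>\<alpha>\<in>F. q \<alpha> *\<^sub>C op_word X \<alpha>)" by (simp add: T q_def)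
  also have "\<dots> = (\<Sum>\<alpha> | q \<alpha> \<noteq> 0. q \<alpha> *\<^sub>C op_word X \<alpha>)"
    using F sub by (intro sum.mono_neutral_right) (auto simp: scaleC_blinfun.zero_left)
  finally show "T \<in> op_polynomials X"
    using finite_subset[OF sub F] by (auto simp: op_polynomials_def nc_polynomial_def)
qed

lemma op_polynomials_word: "z *\<^sub>C op_word X \<alpha> \<in> op_polynomials X"
  unfolding op_polynomials_iff
  by (intro exI[of _ "{\<alpha>}"] exI[of _ "\<lambda>_. z"]) simp

lemma op_polynomials_add:
  assumes "S \<in> op_polynomials X" "T \<in> op_polynomials X"
  shows "S + T \<in> op_polynomials X"
proof -
  obtain p q where pq: "finite {\<alpha>. p \<alpha> \<noteq> 0}" "S = (\<Sum>\<alpha> | p \<alpha> \<noteq> 0. p \<alpha> *\<^sub>C op_word X \<alpha>)"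
    "finite {\<alpha>. q \<alpha> \<noteq> 0}" "T = (\<Sum>\<alpha> | q \<alpha> \<noteq> 0. q \<alpha> *\<^sub>C op_word X \<alpha>)"
    using assms by (auto simp: op_polynomials_def nc_polynomial_def)
  let ?F = "{\<alpha>. p \<alpha> \<noteq> 0} \<union> {\<alpha>. q \<alpha> \<noteq> 0}"
  have "S = (\<Sum>\<alpha>\<in>?F. p \<alpha> *\<^sub>C op_word X \<alpha>)" "T = (\<Sum>\<alpha>\<in>?F. q \<alpha> *\<^sub>C op_word X \<alpha>)"
    unfolding pq by (intro sum.mono_neutral_left; use pq in \<open>auto simp: scaleC_blinfun.zero_left\<close>)+
  then have "S + T = (\<Sum>\<alpha>\<in>?F. (p \<alpha> + q \<alpha>) *\<^sub>C op_word X \<alpha>)"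
    by (simp add: scaleC_blinfun.add_left sum.distrib)
  then show ?thesis
    unfolding op_polynomials_iff using pq by (intro exI[of _ ?F] exI[of _ "\<lambda>\<alpha>. p \<alpha> + q \<alpha>"]) simp
qed

lemma op_polynomials_sum:
  "(\<And>i. i \<in> F \<Longrightarrow> S i \<in> op_polynomials X) \<Longrightarrow> (\<Sum>i\<in>F. S i) \<in> op_polynomials X"
proof (induction F rule: infinite_finite_induct)
qed (use op_polynomials_word[of 0 X "[]"] in \<open>simp_all add: op_polynomials_add scaleC_blinfun.zero_left\<close>)

lemma scaleC_scaleC_blinfun: "z *\<^sub>C w *\<^sub>C A = (z * w) *\<^sub>C A"
  for A :: "'a::real_normed_vector \<Rightarrow>\<^sub>L 'b::chilbert_space"
  by (rule blinfun_eqI) (simp add: scaleC_scaleC)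

lemma op_polynomials_scaleC:
  assumes "S \<in> op_polynomials X"
  shows "z *\<^sub>C S \<in> op_polynomials X"
  using assms unfolding op_polynomials_iff[of S]
  by (auto simp: scaleC_blinfun.sum_right scaleC_scaleC_blinfun intro!: op_polynomials_sum op_polynomials_word)

lemma op_polynomials_compose:
  assumes "S \<in> op_polynomials X" "T \<in> op_polynomials X" "\<And>i. clinear_op (X i)"
  shows "S o\<^sub>L T \<in> op_polynomials X"
proof -
  obtain F p G q where S: "S = (\<Sum>\<alpha>\<in>F. p \<alpha> *\<^sub>C op_word X \<alpha>)" and T: "T = (\<Sum>\<beta>\<in>G. q \<beta> *\<^sub>C op_word X \<beta>)"
    using assms(1,2) unfolding op_polynomials_iff by metis
  have "S o\<^sub>L T = (\<Sum>\<alpha>\<in>F. \<Sum>\<beta>\<in>G. (p \<alpha> * q \<beta>) *\<^sub>C op_word X (\<alpha> @ \<beta>))"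
    by (rule blinfun_eqI)
      (simp add: S T sum_blinfun_apply blinfun.sum_right op_word_append scaleC.sum_right scaleC_scaleC
        clinear_opD[OF clinear_op_word[OF assms(3)]], rule sum.swap)
  then show ?thesis
    by (simp add: op_polynomials_sum op_polynomials_word)
qed

lemma wot_algebra_image:
  assumes "continuous_map weak_operator_topology weak_operator_topology f"
    and "\<And>T. T \<in> op_polynomials X \<Longrightarrow> f T \<in> wot_algebra X" and "T \<in> wot_algebra X"
  shows "f T \<in> wot_algebra X"
proof -
  have "f ` wot_algebra X \<subseteq> weak_operator_topology closure_of (f ` op_polynomials X)"
    unfolding wot_algebra_def by (rule continuous_map_image_closure_subset[OF assms(1)])
  also have "\<dots> \<subseteq> wot_algebra X"
    unfolding wot_algebra_def
    by (rule closure_of_minimal) (use assms(2) in \<open>auto simp: wot_algebra_def\<close>)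
  finally show ?thesis using assms(3) by blast
qed

lemma op_polynomials_subset: "op_polynomials X \<subseteq> wot_algebra X"
  unfolding wot_algebra_def by (rule closure_of_subset) simp

lemma wot_algebra_scaleC: "T \<in> wot_algebra X \<Longrightarrow> z *\<^sub>C T \<in> wot_algebra X"
  by (rule wot_algebra_image[OF continuous_map_wot_add_scaleC(2)])
    (use op_polynomials_scaleC op_polynomials_subset in blast)

lemma wot_algebra_add:
  assumes "S \<in> wot_algebra X" "T \<in> wot_algebra X"
  shows "S + T \<in> wot_algebra X"
proof -
  have *: "S + T \<in> wot_algebra X" if "S \<in> op_polynomials X" "T \<in> wot_algebra X" for S T
    by (rule wot_algebra_image[OF continuous_map_wot_add_scaleC(1) _ that(2)])
      (use op_polynomials_add[OF that(1)] op_polynomials_subset in blast)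
  have "T + S \<in> wot_algebra X"
    by (rule wot_algebra_image[OF continuous_map_wot_add_scaleC(1) _ assms(1)])
      (use *[OF _ assms(2)] in \<open>simp add: add.commute\<close>)
  then show ?thesis by (simp add: add.commute)
qed

lemma clinear_op_wot_algebra:
  assumes "T \<in> wot_algebra X" and X: "\<And>i. clinear_op (X i)"
  shows "clinear_op T"
proof -
  have "op_polynomials X \<subseteq> {T. clinear_op T}"
    by (auto simp: op_polynomials_iff intro!: clinear_op_sum clinear_op_intros clinear_op_word X)
  then show ?thesis
    using assms(1) closure_of_minimal[OF _ closedin_clinear_op] unfolding wot_algebra_def by blast
qed

text \<open>Separate weak continuity of the product is used in two passes: first S is a polynomial
  while T is carried to the closure, and only then is S carried to the closure with T fixed.\<close>

lemma wot_algebra_compose: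
  assumes "S \<in> wot_algebra X" "T \<in> wot_algebra X" and X: "\<And>i. clinear_op (X i)"
  shows "S o\<^sub>L T \<in> wot_algebra X"
proof -
  have *: "S o\<^sub>L T \<in> wot_algebra X" if "S \<in> op_polynomials X" "T \<in> wot_algebra X" for S T
  proof (rule wot_algebra_image[OF continuous_map_wot_compose_left _ that(2)])
    show "clinear_op S"
      by (rule clinear_op_wot_algebra[of _ X]) (use that(1) op_polynomials_subset X in auto)
  qed (use op_polynomials_compose[OF that(1) _ X] op_polynomials_subset in blast)
  show ?thesis
    by (rule wot_algebra_image[OF continuous_map_wot_compose_right _ assms(1)])
      (rule *[OF _ assms(2)])
qed

lemma wot_algebra_sum:
  "(\<And>i. i \<in> F \<Longrightarrow> S i \<in> wot_algebra X) \<Longrightarrow> (\<Sum>i\<in>F. S i) \<in> wot_algebra X"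
proof (induction F rule: infinite_finite_induct)
qed (use op_polynomials_sum[of "{}" _ X] op_polynomials_subset in \<open>auto simp: wot_algebra_add\<close>)

lemma wot_algebra_word:
  assumes "\<And>i. Y i \<in> wot_algebra X" and X: "\<And>i. clinear_op (X i)"
  shows "op_word Y \<alpha> \<in> wot_algebra X"
proof (induction \<alpha>)
  case Nil
  show ?case
    using op_polynomials_word[of 1 X "[]"] op_polynomials_subset
    by (auto simp: blinfun_eqI[of "1 *\<^sub>C id_blinfun" id_blinfun])
qed (simp add: wot_algebra_compose assms)

lemma wot_algebra_nc_term:
  assumes "\<And>i. Y i \<in> wot_algebra X" "\<And>i. clinear_op (X i)"
  shows "nc_term c Y k \<in> wot_algebra X"
  unfolding nc_term_def by (intro wot_algebra_sum wot_algebra_scaleC wot_algebra_word assms)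

lemma wot_algebra_gen:
  assumes "\<And>i. clinear_op (X i)"
  shows "X i \<in> wot_algebra X"
  using op_polynomials_word[of 1 X "[i]"] op_polynomials_subset
  by (auto simp: blinfun_eqI[of "1 *\<^sub>C X i" "X i"])

lemma wot_algebra_scaleR: "T \<in> wot_algebra X \<Longrightarrow> r *\<^sub>R T \<in> wot_algebra X"
  using wot_algebra_scaleC[of T X "complex_of_real r"]
  by (simp add: blinfun_eqI[of "r *\<^sub>R T" "complex_of_real r *\<^sub>C T"] blinfun.scaleR_left scaleR_scaleC)

lemma wot_algebra_sot_limit:
  assumes "limitin strong_operator_topology f L F" "F \<noteq> bot" "\<forall>\<^sub>F t in F. f t \<in> wot_algebra X"
  shows "L \<in> wot_algebra X"
  using limitin_closedin[OF limitin_sot_imp_wot[OF assms(1)] _ assms(3,2)]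
  unfolding wot_algebra_def by simp

lemma wot_algebra_suminf:
  assumes "summable A" "\<And>k. A k \<in> wot_algebra X"
  shows "suminf A \<in> wot_algebra X"
  by (rule wot_algebra_sot_limit[OF tendsto_imp_limitin_sot[OF summable_LIMSEQ[OF assms(1)]]])
    (use assms(2) in \<open>auto intro!: always_eventually wot_algebra_sum\<close>)

lemma wot_algebra_subset_left_multipliers:
  fixes X :: "'n \<Rightarrow> 'n list ell2 \<Rightarrow>\<^sub>L 'n list ell2"
  assumes "\<And>i. X i \<in> left_multipliers"
  shows "wot_algebra X \<subseteq> left_multipliers"
proof -
  have "op_word X \<alpha> \<in> left_multipliers" for \<alpha>
    by (induction \<alpha>) (simp_all add: left_multipliers_intros assms)
  moreover have "(\<Sum>i\<in>F. S i) \<in> left_multipliers" if "\<And>i. i \<in> F \<Longrightarrow> S i \<in> left_multipliers"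
    for F and S :: "'n list \<Rightarrow> 'n list ell2 \<Rightarrow>\<^sub>L 'n list ell2"
    using that
  proof (induction F rule: infinite_finite_induct)
  qed (use left_multipliers_intros(4)[OF left_multipliers_intros(1), of 0] in
      \<open>auto simp: scaleC_blinfun.zero_left intro: left_multipliers_intros(2)\<close>)
  ultimately have "op_polynomials X \<subseteq> left_multipliers"
    by (auto simp: op_polynomials_iff left_multipliers_intros(4))
  then show ?thesis
    unfolding wot_algebra_def by (rule closure_of_minimal[OF _ closedin_left_multipliers])
qed

section \<open>Functional calculus on the open unit ball\<close>

lemma bounded_linear_ell2_eqI:
  assumes "bounded_linear f" "bounded_linear g"
    and "\<And>i z. f (z *\<^sub>C ell2_basis i) = g (z *\<^sub>C ell2_basis i)"
  shows "f x = g x"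
  using blinfun_ell2_eqI[of "Blinfun f" "Blinfun g"] assms
  by (metis bounded_linear_Blinfun_apply)

lemma clinear_ell2_eqI:
  assumes f: "bounded_linear f" "\<And>c x. f (c *\<^sub>C x) = c *\<^sub>C f x"
    and g: "bounded_linear g" "\<And>c x. g (c *\<^sub>C x) = c *\<^sub>C g x"
    and eq: "\<And>i. f (ell2_basis i) = g (ell2_basis i)"
  shows "f x = g x"
  by (rule bounded_linear_ell2_eqI[OF f(1) g(1)]) (simp add: f(2) g(2) eq)

text \<open>Bundled as a bounded operator in the symbol b, so that identities in b need checking
  only at basis vectors, where the value is a word in X, and evaluation passes through
  limits.\<close>

definition calculus ::
    "('n::finite \<Rightarrow> 'h::chilbert_space \<Rightarrow>\<^sub>L 'h) \<Rightarrow> 'n list ell2 \<Rightarrow>\<^sub>L ('h \<Rightarrow>\<^sub>L 'h)"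
  where "calculus X = Blinfun (\<lambda>b. nc_eval (ell2_coeff b) X)"

lemma nc_eval_linear:
  assumes X: "X \<in> op_ball 1" and c: "1 \<le> ncps_radius c" and d: "1 \<le> ncps_radius d"
  shows "nc_eval (\<lambda>\<alpha>. c \<alpha> + d \<alpha>) X = nc_eval c X + nc_eval d X"
    "nc_eval (\<lambda>\<alpha>. z * c \<alpha>) X = z *\<^sub>C nc_eval c X"
proof -
  note s = summable_nc_term[OF c X] summable_nc_term[OF d X]
  show "nc_eval (\<lambda>\<alpha>. c \<alpha> + d \<alpha>) X = nc_eval c X + nc_eval d X"
    using suminf_add[OF s] by (simp add: nc_eval_def nc_term_simps(1)[abs_def])
  show "nc_eval (\<lambda>\<alpha>. z * c \<alpha>) X = z *\<^sub>C nc_eval c X"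
    using bounded_linear.suminf[OF scaleC_blinfun.bounded_linear_right s(1), of z]
    by (simp add: nc_eval_def nc_term_simps(2)[abs_def])
qed

text \<open>The homogeneous norms of a square-summable symbol are bounded by |b|, so the series is
  dominated by a geometric one; this gives the constant 1/(1 - |X|).\<close>

lemma calculus_apply:
  assumes X: "X \<in> op_ball 1"
  shows "calculus X b = nc_eval (ell2_coeff b) X"
proof -
  have "bounded_linear (\<lambda>b. nc_eval (ell2_coeff b) X)"
  proof (rule bounded_linear_intro)
    fix b d :: "'a list ell2" and r :: real
    show "nc_eval (ell2_coeff (b + d)) X = nc_eval (ell2_coeff b) X + nc_eval (ell2_coeff d) X"
      using nc_eval_linear(1)[OF X ncps_radius_ell2 ncps_radius_ell2, of b d]
      by (simp add: ell2_coeff_simps(2)[abs_def])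
    have "ell2_coeff (r *\<^sub>R b) = (\<lambda>\<alpha>. complex_of_real r * ell2_coeff b \<alpha>)"
      by (simp add: fun_eq_iff)
    then show "nc_eval (ell2_coeff (r *\<^sub>R b)) X = r *\<^sub>R nc_eval (ell2_coeff b) X"
      using nc_eval_linear(2)[OF X ncps_radius_ell2 ncps_radius_ell2, of "complex_of_real r" b]
      by (simp add: blinfun_eqI blinfun.scaleR_left scaleR_scaleC)
    have X': "\<And>i. clinear_op (X i)" "row_norm X < 1" using X by (simp_all add: op_ball_iff)
    have le: "norm (nc_term (ell2_coeff b) X k) \<le> norm b * row_norm X ^ k" for k
      by (rule order_trans[OF norm_nc_term_le[OF X'(1)] mult_right_mono[OF hom_norm_ell2_le]]) simp
    have s: "summable (\<lambda>k. norm b * row_norm X ^ k)"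
      using X'(2) by (intro summable_mult summable_geometric) simp
    have "norm (nc_eval (ell2_coeff b) X) \<le> suminf (\<lambda>k. norm (nc_term (ell2_coeff b) X k))"
      unfolding nc_eval_def by (rule summable_norm[OF summable_norm_nc_term[OF ncps_radius_ell2 X]])
    also have "\<dots> \<le> suminf (\<lambda>k. norm b * row_norm X ^ k)"
      by (rule suminf_le[OF le summable_norm_nc_term[OF ncps_radius_ell2 X] s])
    also have "\<dots> = norm b * (1 / (1 - row_norm X))"
      using X'(2) by (simp add: suminf_mult summable_geometric suminf_geometric)
    finally show "norm (nc_eval (ell2_coeff b) X) \<le> norm b * (1 / (1 - row_norm X))" .
  qed
  then show ?thesis by (simp add: calculus_def bounded_linear_Blinfun_apply)
qed

lemma calculus_scaleC: "X \<in> op_ball 1 \<Longrightarrow> calculus X (z *\<^sub>C b) = z *\<^sub>C calculus X b"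
  using nc_eval_linear(2)[OF _ ncps_radius_ell2 ncps_radius_ell2, of X z b]
  by (simp add: calculus_apply ell2_coeff_simps(5)[abs_def])

lemma clinear_op_calculus: "X \<in> op_ball 1 \<Longrightarrow> clinear_op (calculus X b)"
  by (simp add: calculus_apply clinear_op_nc_eval ncps_radius_ell2)

lemma nc_term_basis: "nc_term (ell2_coeff (ell2_basis \<alpha>)) X k = (if k = length \<alpha> then op_word X \<alpha> else 0)"
proof -
  have "nc_term (ell2_coeff (ell2_basis \<alpha>)) X k
      = (\<Sum>\<beta> | length \<beta> = k. if \<beta> = \<alpha> then op_word X \<alpha> else 0)"
    unfolding nc_term_def
    by (intro sum.cong refl) (auto simp: ell2_coeff_basis scaleC_blinfun.zero_left intro!: blinfun_eqI)
  then show ?thesis by (auto simp: sum.delta)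
qed

lemma calculus_basis: "X \<in> op_ball 1 \<Longrightarrow> calculus X (ell2_basis \<alpha>) = op_word X \<alpha>"
  using sums_single[of "length \<alpha>" "\<lambda>_. op_word X \<alpha>"]
  by (simp add: calculus_apply nc_eval_def nc_term_basis[abs_def] sums_iff)

lemma bounded_linear_compose_left: "bounded_linear (\<lambda>A. B o\<^sub>L A)"
  and bounded_linear_compose_right: "bounded_linear (\<lambda>A. A o\<^sub>L B)"
  by (rule bounded_bilinear.bounded_linear_right[OF bounded_bilinear_blinfun_compose],
      rule bounded_bilinear.bounded_linear_left[OF bounded_bilinear_blinfun_compose])

lemma scaleC_compose:
  "(z *\<^sub>C A) o\<^sub>L B = z *\<^sub>C (A o\<^sub>L B)" "clinear_op A \<Longrightarrow> A o\<^sub>L (z *\<^sub>C B) = z *\<^sub>C (A o\<^sub>L B)"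
  by (auto intro!: blinfun_eqI simp: clinear_opD)

lemma calculus_right_mult:
  assumes X: "X \<in> op_ball 1"
  shows "calculus X (right_mult \<beta> b) = calculus X b o\<^sub>L op_word X \<beta>"
  by (rule clinear_ell2_eqI[where x = b])
    (auto intro!: bounded_linear_intros bounded_linear_compose[OF bounded_linear_compose_right]
      blinfun.bounded_linear_right
      simp: clinear_opD[OF clinear_op_right_mult] calculus_scaleC[OF X] scaleC_compose
        right_mult_basis calculus_basis[OF X] op_word_append)

text \<open>Both sides are continuous in \<open>b\<close>, and for \<open>b = e\<^sub>\<beta>\<close> the operator \<open>T\<close> acts as right
  multiplication by \<open>\<beta>\<close> on its symbol.\<close>

lemma calculus_multiplier:
  assumes X: "X \<in> op_ball 1" and T: "T \<in> left_multipliers"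
  shows "calculus X (T b) = calculus X (T (ell2_basis [])) o\<^sub>L calculus X b"
proof (rule clinear_ell2_eqI[where x = b])
  fix \<beta>
  have "T (ell2_basis \<beta>) = right_mult \<beta> (T (ell2_basis []))"
    using T unfolding left_multipliers_iff by blast
  then show "calculus X (T (ell2_basis \<beta>)) = calculus X (T (ell2_basis [])) o\<^sub>L calculus X (ell2_basis \<beta>)"
    by (simp add: calculus_right_mult[OF X] calculus_basis[OF X])
next
  have "clinear_op T" using T by (simp add: left_multipliers_commute)
  then show "calculus X (T (c *\<^sub>C x)) = c *\<^sub>C calculus X (T x)" for c x
    by (simp add: clinear_opD calculus_scaleC[OF X])
qed (auto intro!: bounded_linear_intros bounded_linear_compose[OF bounded_linear_compose_left]
      blinfun.bounded_linear_right simp: calculus_scaleC[OF X] scaleC_compose clinear_op_calculus[OF X])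

lemma fourier_coeff_eq: "fourier_coeff T = ell2_coeff (T (ell2_basis []))"
  by (simp add: fourier_coeff_def[abs_def])

lemma ncps_radius_fourier: "1 \<le> ncps_radius (fourier_coeff T)"
  by (simp add: fourier_coeff_eq ncps_radius_ell2)

lemma nc_eval_fourier: "X \<in> op_ball 1 \<Longrightarrow> nc_eval (fourier_coeff T) X = calculus X (T (ell2_basis []))"
  by (simp add: fourier_coeff_eq calculus_apply)

lemma nc_eval_fourier_algebra:
  assumes X: "X \<in> op_ball 1"
  shows "nc_eval (fourier_coeff id_blinfun) X = id_blinfun"
    "nc_eval (fourier_coeff (S + T)) X = nc_eval (fourier_coeff S) X + nc_eval (fourier_coeff T) X"
    "nc_eval (fourier_coeff (z *\<^sub>C T)) X = z *\<^sub>C nc_eval (fourier_coeff T) X"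
    "S \<in> left_multipliers \<Longrightarrow>
      nc_eval (fourier_coeff (S o\<^sub>L T)) X = nc_eval (fourier_coeff S) X o\<^sub>L nc_eval (fourier_coeff T) X"
  using calculus_multiplier[OF X, of S "T (ell2_basis [])"]
  by (simp_all add: nc_eval_fourier[OF X] calculus_basis[OF X] blinfun.add_left blinfun.add_right
      calculus_scaleC[OF X])

section \<open>Abel summation of multipliers\<close>

lemma eventually_at_left_1: "\<forall>\<^sub>F r in at_left (1::real). 0 < r \<and> r < 1"
  using eventually_at_left_real[of 0 "1::real"] by (simp add: greaterThanLessThan_def)

text \<open>Summation by parts: with t_n the n-th partial sum minus s, the power series equals s
  plus (1 - r) times the series of r^n t_n. This uses the decay of t_n and no absolute convergence
  of v.\<close>

lemma Abel_limit:
  fixes v :: "nat \<Rightarrow> 'a::banach"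
  assumes v: "v sums s"
  shows "((\<lambda>r. suminf (\<lambda>k. r ^ k *\<^sub>R v k)) \<longlongrightarrow> s) (at_left (1::real))"
proof -
  define t where "t n = (\<Sum>k\<le>n. v k) - s" for n
  have t0: "t \<longlonglongrightarrow> 0"
    using v unfolding sums_def_le t_def by (rule LIM_zero)
  then obtain C where C: "\<And>n. norm (t n) \<le> C"
    using convergent_imp_Bseq[of t] by (auto simp: Bseq_def convergent_def)
  have st: "summable (\<lambda>n. norm (r ^ n *\<^sub>R t n))" if "0 < r" "r < 1" for r
  proof (rule summable_comparison_test)
    show "summable (\<lambda>n. C * r ^ n)"
      using that by (intro summable_mult summable_geometric) simp
    show "\<exists>N. \<forall>n\<ge>N. norm (norm (r ^ n *\<^sub>R t n)) \<le> C * r ^ n"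
      using that C by (auto simp: mult.commute[of C] intro!: mult_left_mono)
  qed
  have eq: "suminf (\<lambda>k. r ^ k *\<^sub>R v k) = s + (1 - r) *\<^sub>R suminf (\<lambda>n. r ^ n *\<^sub>R t n)" if r: "0 < r" "r < 1" for r
  proof -
    let ?T = "suminf (\<lambda>n. r ^ n *\<^sub>R t n)"
    \<comment> \<open>The shift of t by one place; the value -s belongs to the empty partial sum and
      makes t_n - t'_n = v_n hold at n = 0 too.\<close>
    define t' where "t' n = (case n of 0 \<Rightarrow> - s | Suc m \<Rightarrow> t m)" for n
    have T: "(\<lambda>n. r ^ n *\<^sub>R t n) sums ?T"
      by (rule summable_sums[OF summable_norm_cancel[OF st[OF r]]])
    then have "(\<lambda>n. r *\<^sub>R (r ^ n *\<^sub>R t n)) sums (r *\<^sub>R ?T)"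
      by (rule sums_scaleR_right)
    then have "(\<lambda>n. r ^ Suc n *\<^sub>R t' (Suc n)) sums (r *\<^sub>R ?T)"
      by (simp add: t'_def)
    then have "(\<lambda>n. r ^ n *\<^sub>R t' n) sums (r *\<^sub>R ?T + r ^ 0 *\<^sub>R t' 0)"
      by (rule sums_Suc)
    from sums_diff[OF T this] have "(\<lambda>n. r ^ n *\<^sub>R t n - r ^ n *\<^sub>R t' n) sums (s + (1 - r) *\<^sub>R ?T)"
      by (simp add: t'_def algebra_simps)
    moreover have "r ^ n *\<^sub>R t n - r ^ n *\<^sub>R t' n = r ^ n *\<^sub>R v n" for n
    proof -
      have "t n - t' n = v n"
        by (cases n) (simp_all add: t_def t'_def)
      then show ?thesis by (metis scaleR_diff_right)
    qed
    ultimately show ?thesis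
      by (simp add: sums_iff)
  qed
  have "((\<lambda>r. (1 - r) *\<^sub>R suminf (\<lambda>n. r ^ n *\<^sub>R t n)) \<longlongrightarrow> 0) (at_left (1::real))"
  proof (rule tendstoI)
    fix e :: real assume e: "0 < e"
    \<comment> \<open>After multiplication by 1 - r, the terms from N on contribute at most e/2, and
      the first N at most (1 - r) K, which tends to 0.\<close>
    obtain N where N: "\<And>n. N \<le> n \<Longrightarrow> norm (t n) < e / 2"
      using LIMSEQ_D[OF t0, of "e / 2"] e by auto
    define K where "K = (\<Sum>n<N. norm (t n))"
    have "((\<lambda>r. (1 - r) * K) \<longlongrightarrow> (1 - 1) * K) (at_left (1::real))"
      by (intro tendsto_intros)
    then have "\<forall>\<^sub>F r in at_left 1. (1 - r) * K < e / 2"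
      by (rule order_tendstoD(2)) (use e in simp)
    then show "\<forall>\<^sub>F r in at_left 1. dist ((1 - r) *\<^sub>R suminf (\<lambda>n. r ^ n *\<^sub>R t n)) 0 < e"
      using eventually_at_left_1
    proof eventually_elim
      case (elim r)
      then have r: "0 < r" "r < 1" by auto
      note s = st[OF r]
      have "norm (suminf (\<lambda>n. r ^ n *\<^sub>R t n)) \<le> suminf (\<lambda>n. norm (r ^ n *\<^sub>R t n))"
        by (rule summable_norm[OF s])
      also have "\<dots> = suminf (\<lambda>n. norm (r ^ (n + N) *\<^sub>R t (n + N))) + (\<Sum>n<N. norm (r ^ n *\<^sub>R t n))"
        by (rule suminf_split_initial_segment[OF s])
      also have "(\<Sum>n<N. norm (r ^ n *\<^sub>R t n)) \<le> K"
        unfolding K_def using r by (intro sum_mono) (simp add: mult_left_le_one_le power_le_one)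
      also have "suminf (\<lambda>n. norm (r ^ (n + N) *\<^sub>R t (n + N))) \<le> suminf (\<lambda>n. r ^ n * (e / 2))"
      proof (rule suminf_le)
        show "summable (\<lambda>n. norm (r ^ (n + N) *\<^sub>R t (n + N)))"
          using s by (rule summable_ignore_initial_segment)
        show "summable (\<lambda>n. r ^ n * (e / 2))"
          using r by (intro summable_mult2 summable_geometric) simp
        fix n
        have "r ^ (n + N) * norm (t (n + N)) \<le> r ^ n * (e / 2)"
          using r N[of "n + N"] by (intro mult_mono power_decreasing) simp_all
        then show "norm (r ^ (n + N) *\<^sub>R t (n + N)) \<le> r ^ n * (e / 2)"
          using r by simp
      qed
      also have "suminf (\<lambda>n. r ^ n * (e / 2)) = (e / 2) / (1 - r)"
      proof -
        have "suminf (\<lambda>n. r ^ n * (e / 2)) = suminf (\<lambda>n. r ^ n) * (e / 2)"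
          using r by (intro suminf_mult2[symmetric] summable_geometric) simp
        then show ?thesis using r by (simp add: suminf_geometric)
      qed
      finally have "norm (suminf (\<lambda>n. r ^ n *\<^sub>R t n)) \<le> (e / 2) / (1 - r) + K" by simp
      then have "(1 - r) * norm (suminf (\<lambda>n. r ^ n *\<^sub>R t n)) \<le> (1 - r) * ((e / 2) / (1 - r) + K)"
        using r by (intro mult_left_mono) simp_all
      also have "\<dots> = e / 2 + (1 - r) * K"
      proof -
        have *: "q * (x / q + K) = x + q * K" if "q \<noteq> 0" for q x :: real
          using that by (simp add: distrib_left)
        show ?thesis by (rule *) (use r in simp)
      qed
      finally show ?case
        using elim r by simp
    qed
  qed
  then have "((\<lambda>r. s + (1 - r) *\<^sub>R suminf (\<lambda>n. r ^ n *\<^sub>R t n)) \<longlongrightarrow> s + 0) (at_left (1::real))"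
    by (intro tendsto_add tendsto_const)
  moreover have "\<forall>\<^sub>F r in at_left 1. s + (1 - r) *\<^sub>R suminf (\<lambda>n. r ^ n *\<^sub>R t n) = suminf (\<lambda>k. r ^ k *\<^sub>R v k)"
    using eventually_at_left_1 by eventually_elim (simp add: eq)
  ultimately show ?thesis
    by (auto intro: Lim_transform_eventually)
qed

section \<open>The row of scaled creation operators\<close>

lemma cinner_left_creation:
  "cinner (left_creation i x) (left_creation j y) = (if i = j then cinner x y else 0)"
proof (cases "i = j")
  case True
  have "cinner (left_creation i x) (left_creation i y)
      = (\<Sum>\<^sub>\<infinity>w\<in>range ((#) i). ell2_coeff (left_creation i x) w * cnj (ell2_coeff (left_creation i y) w))"
    unfolding cinner_ell2_def
    by (rule infsum_cong_neutral) (auto simp: left_creation_coeff split: list.splits)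
  also have "\<dots> = cinner x y"
    unfolding cinner_ell2_def by (subst infsum_reindex) (auto simp: o_def left_creation_coeff)
  finally show ?thesis using True by simp
next
  case False
  then have "ell2_coeff (left_creation i x) w * cnj (ell2_coeff (left_creation j y) w) = 0" for w
    by (simp add: left_creation_coeff split: list.splits)
  then have "cinner (left_creation i x) (left_creation j y) = (\<Sum>\<^sub>\<infinity>w\<in>(UNIV :: 'a list set). 0)"
    unfolding cinner_ell2_def by (intro infsum_cong)
  then show ?thesis using False by simp
qed

text \<open>Let v be the sum of S_i S_i^* x. Isometry and orthogonality of the ranges give |v|^2 =
  s, while duality gives <v, x> = s; Cauchy-Schwarz then yields s \<le> |x| sqrt s.\<close>

lemma sum_norm_adj_left_creation_le:
  "(\<Sum>i\<in>UNIV. (norm (adj (left_creation i) x))\<^sup>2) \<le> (norm x)\<^sup>2"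
  for x :: "'n::finite list ell2"
proof -
  define s where "s = (\<Sum>i\<in>UNIV. (norm (adj (left_creation i) x))\<^sup>2)"
  define v where "v = (\<Sum>i\<in>UNIV. left_creation i (adj (left_creation i) x))"
  have s0: "0 \<le> s" by (simp add: s_def sum_nonneg)
  have "cinner v v = (\<Sum>i\<in>UNIV. \<Sum>j\<in>UNIV. if j = i then cinner (adj (left_creation i) x) (adj (left_creation i) x) else 0)"
    unfolding v_def cinner.sum_left unfolding cinner.sum_right
    by (intro sum.cong refl) (simp add: cinner_left_creation)
  also have "\<dots> = complex_of_real s"
    by (simp add: s_def cinner_self)
  finally have "norm v = sqrt s"
    using s0 by (simp only: cinner_self of_real_eq_iff) (metis norm_ge_zero real_sqrt_unique)
  moreover have "cinner v x = complex_of_real s"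
    by (simp add: v_def s_def cinner.sum_left cinner_adj cinner_self)
  then have "s \<le> norm v * norm x"
    using norm_cinner_le[of v x] s0 by simp
  ultimately have "sqrt s * sqrt s \<le> norm x * sqrt s"
    using s0 by (simp add: mult.commute)
  then have "sqrt s \<le> norm x"
    using s0 by (cases "s = 0") (auto intro: mult_right_le_imp_le[of _ "sqrt s"])
  then have "(sqrt s)\<^sup>2 \<le> (norm x)\<^sup>2" using s0 by (intro power_mono) simp_all
  then show ?thesis using s0 by (simp add: s_def)
qed

lemma adj_scaleR: "clinear_op A \<Longrightarrow> adj (r *\<^sub>R A) = r *\<^sub>R adj A"
  by (rule adj_eqI) (simp_all add: clinear_op_intros blinfun.scaleR_left cinner_scaleR cinner_adj)

lemma scaled_creation_in_ball:
  assumes "0 \<le> r" "r < 1"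
  shows "(\<lambda>i. r *\<^sub>R left_creation i) \<in> op_ball 1"
proof -
  have "row_norm (\<lambda>i. r *\<^sub>R left_creation i :: 'a list ell2 \<Rightarrow>\<^sub>L 'a list ell2) \<le> r"
  proof (rule row_norm_leI[OF assms(1)])
    fix x :: "'a list ell2"
    have "(\<Sum>i\<in>UNIV. (norm (adj (r *\<^sub>R left_creation i) x))\<^sup>2)
        = r\<^sup>2 * (\<Sum>i\<in>UNIV. (norm (adj (left_creation i) x))\<^sup>2)"
      by (simp add: adj_scaleR blinfun.scaleR_left power_mult_distrib sum_distrib_left)
    also have "\<dots> \<le> r\<^sup>2 * (norm x)\<^sup>2"
      by (intro mult_left_mono sum_norm_adj_left_creation_le) simp
    finally show "(\<Sum>i\<in>UNIV. (norm (adj (r *\<^sub>R left_creation i) x))\<^sup>2) \<le> r\<^sup>2 * (norm x)\<^sup>2" .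
  qed
  then show ?thesis using assms(2) by (simp add: op_ball_iff clinear_op_intros)
qed

section \<open>Series of creation operators at the vacuum vector\<close>

lemma op_word_creation_basis: "op_word left_creation \<alpha> (ell2_basis \<beta>) = ell2_basis (\<alpha> @ \<beta>)"
  by (induction \<alpha>) (simp_all add: left_creation_basis)

lemma nc_term_creation_vacuum:
  "nc_term c left_creation k (ell2_basis []) = (\<Sum>\<alpha> | length \<alpha> = k. c \<alpha> *\<^sub>C ell2_basis \<alpha>)"
  by (simp add: nc_term_def sum_blinfun_apply op_word_creation_basis)

lemma nc_term_creation_coeff:
  "ell2_coeff (nc_term c left_creation k (ell2_basis [])) w = (if length w = k then c w else 0)"
  for c :: "'n::finite ncps"
proof -
  have "ell2_coeff (nc_term c left_creation k (ell2_basis [])) w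
      = (\<Sum>\<alpha> | length \<alpha> = k. if \<alpha> = w then c w else 0)"
    unfolding nc_term_creation_vacuum ell2_coeff_sum
    by (intro sum.cong refl) (auto simp: ell2_coeff_basis)
  then show ?thesis by (simp add: sum.delta)
qed

text \<open>At the creation operators the vacuum vector sees the full l2 norm of a homogeneous part,
  which is how convergence there controls the radius.\<close>

lemma norm_nc_term_creation_vacuum:
  "norm (nc_term c left_creation k (ell2_basis [])) = hom_norm c k"
  unfolding hom_norm_def nc_term_creation_vacuum
  by (simp flip: norm_sum_ell2_basis[OF finite_words])

lemma nc_eval_creation_coeff:
  assumes "summable (nc_term c (\<lambda>i. r *\<^sub>R left_creation i))"
  shows "ell2_coeff (nc_eval c (\<lambda>i. r *\<^sub>R left_creation i) (ell2_basis [])) w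
    = c w * complex_of_real r ^ length w"
proof -
  have "bounded_linear (\<lambda>A. ell2_coeff (blinfun_apply A (ell2_basis [])) w)"
    by (rule bounded_linear_compose[OF bounded_linear_ell2_coeff blinfun.bounded_linear_left])
  from bounded_linear.sums[OF this summable_sums[OF assms]]
  have "(\<lambda>k. ell2_coeff (nc_term c (\<lambda>i. r *\<^sub>R left_creation i) k (ell2_basis [])) w)
      sums ell2_coeff (nc_eval c (\<lambda>i. r *\<^sub>R left_creation i) (ell2_basis [])) w"
    by (simp add: nc_eval_def)
  moreover have "(\<lambda>k. ell2_coeff (nc_term c (\<lambda>i. r *\<^sub>R left_creation i) k (ell2_basis [])) w)
      = (\<lambda>k. if k = length w then c w * complex_of_real r ^ k else 0)"
    by (auto simp: fun_eq_iff nc_term_scaleR blinfun.scaleR_left nc_term_creation_coeff)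
  ultimately have "(\<lambda>k. if k = length w then c w * complex_of_real r ^ k else 0)
      sums ell2_coeff (nc_eval c (\<lambda>i. r *\<^sub>R left_creation i) (ell2_basis [])) w" by simp
  from sums_unique2[OF this sums_single] show ?thesis .
qed

lemma nc_eval_creation_multiplier:
  assumes "summable (nc_term c (\<lambda>i. r *\<^sub>R left_creation i))"
  shows "nc_eval c (\<lambda>i. r *\<^sub>R left_creation i) \<in> left_multipliers"
proof -
  have "nc_eval c (\<lambda>i. r *\<^sub>R left_creation i) \<in> wot_algebra left_creation"
    unfolding nc_eval_def
    by (intro wot_algebra_suminf assms wot_algebra_nc_term wot_algebra_scaleR wot_algebra_gen) simp_all
  then show ?thesis
    using wot_algebra_subset_left_multipliers[of left_creation] left_multipliers_intros(5) by blast
qed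

lemma multiplier_basis: "T \<in> left_multipliers \<Longrightarrow> T (ell2_basis \<beta>) = right_mult \<beta> (T (ell2_basis []))"
  unfolding left_multipliers_iff by blast

text \<open>The unconditional expansion of c regrouped by degree: every finite set of words is
  eventually contained in the words shorter than N.\<close>

lemma nc_term_vacuum_sums:
  fixes c :: "'n::finite list ell2"
  shows "(\<lambda>k. nc_term (ell2_coeff c) left_creation k (ell2_basis [])) sums c"
proof -
  have "\<forall>\<^sub>F N in sequentially. F \<subseteq> {\<alpha>. length \<alpha> < N}" if F: "finite F" for F :: "'n list set"
  proof -
    obtain N where "\<forall>n\<in>length ` F. n < N"
      using finite_nat_set_iff_bounded[of "length ` F"] finite_imageI[OF F, of length] by blast
    then show ?thesis by (intro eventually_sequentiallyI[of N]) fastforce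
  qed
  then have "filterlim (\<lambda>N. {\<alpha> :: 'n list. length \<alpha> < N}) (finite_subsets_at_top UNIV) sequentially"
    unfolding filterlim_finite_subsets_at_top by (auto elim: eventually_mono)
  from filterlim_compose[OF ell2_has_sum[of c, unfolded has_sum_def] this] show ?thesis
    by (simp add: sums_def nc_term_creation_vacuum sum_words_by_length)
qed

text \<open>Abel's theorem settles the vacuum vector. The approximants are left multipliers, so
  their values at e_\<beta> arise from those at the vacuum by the continuous map
  \<open>right_mult\<close>.\<close>

lemma nc_eval_creation_tendsto:
  fixes c :: "'n::finite list ell2"
  shows "((\<lambda>r. nc_eval (ell2_coeff c) (\<lambda>i. r *\<^sub>R left_creation i) (ell2_basis \<beta>)) \<longlongrightarrow> right_mult \<beta> c) (at_left 1)"
proof -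
  let ?P = "\<lambda>r. nc_eval (ell2_coeff c) (\<lambda>i. r *\<^sub>R left_creation i)"
  have s: "summable (nc_term (ell2_coeff c) (\<lambda>i. r *\<^sub>R left_creation i))" if "0 < r" "r < 1" for r
    using that by (intro summable_nc_term ncps_radius_ell2 scaled_creation_in_ball) simp_all
  have "((\<lambda>r. right_mult \<beta> (suminf (\<lambda>k. r ^ k *\<^sub>R nc_term (ell2_coeff c) left_creation k (ell2_basis []))))
      \<longlongrightarrow> right_mult \<beta> c) (at_left 1)"
    by (intro blinfun.tendsto tendsto_const Abel_limit nc_term_vacuum_sums)
  moreover have "\<forall>\<^sub>F r in at_left 1. right_mult \<beta> (suminf (\<lambda>k. r ^ k *\<^sub>R nc_term (ell2_coeff c) left_creation k (ell2_basis [])))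
      = ?P r (ell2_basis \<beta>)"
    using eventually_at_left_1
  proof eventually_elim
    case (elim r)
    then have "?P r (ell2_basis []) = suminf (\<lambda>k. r ^ k *\<^sub>R nc_term (ell2_coeff c) left_creation k (ell2_basis []))"
      unfolding nc_eval_def
      by (subst bounded_linear.suminf[OF blinfun.bounded_linear_left s])
        (simp_all add: nc_term_scaleR blinfun.scaleR_left)
    then show ?case
      using elim multiplier_basis[OF nc_eval_creation_multiplier[OF s], of r \<beta>] by simp
  qed
  ultimately show ?thesis by (rule Lim_transform_eventually)
qed

section \<open>Radial limits and the analytic Toeplitz algebra\<close>

lemma abel_term_eq:
  "nc_term (\<lambda>\<alpha>. c \<alpha> * complex_of_real r ^ length \<alpha>) X = nc_term c (\<lambda>i. r *\<^sub>R X i)"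
  by (simp add: fun_eq_iff nc_term_simps nc_term_scaleR)

lemma abel_sums_iff:
  "abel_sums c X L \<longleftrightarrow> (\<forall>r. 0 \<le> r \<and> r < 1 \<longrightarrow> summable (nc_term c (\<lambda>i. r *\<^sub>R X i))) \<and>
    limitin strong_operator_topology (\<lambda>r. nc_eval c (\<lambda>i. r *\<^sub>R X i)) L (at_left 1)"
  by (simp add: abel_sums_def nc_eval_def abel_term_eq)

text \<open>The von Neumann inequality bounds the approximants by |T| uniformly in r, so their
  convergence on multiples of basis vectors extends to all vectors.\<close>

theorem multiplier_abel_sums:
  fixes T :: "'n::finite list ell2 \<Rightarrow>\<^sub>L 'n list ell2"
  assumes T: "T \<in> left_multipliers"
  shows "abel_sums (fourier_coeff T) left_creation T"
  unfolding abel_sums_iff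
proof (intro conjI allI impI)
  show "summable (nc_term (fourier_coeff T) (\<lambda>i. r *\<^sub>R left_creation i))" if "0 \<le> r \<and> r < 1" for r
    using that by (intro summable_nc_term ncps_radius_fourier scaled_creation_in_ball) simp_all
  let ?P = "\<lambda>r. nc_eval (fourier_coeff T) (\<lambda>i. r *\<^sub>R left_creation i)"
  show "limitin strong_operator_topology ?P T (at_left 1)"
    unfolding limitin_sot_iff
  proof
    fix x
    show "((\<lambda>r. ?P r x) \<longlongrightarrow> T x) (at_left 1)"
    proof (rule tendsto_ell2_of_basis[where C = "norm T"])
      show "\<forall>\<^sub>F r in at_left 1. norm (?P r) \<le> norm T"
        using eventually_at_left_1
        by eventually_elim (auto intro!: von_Neumann_inequality T scaled_creation_in_ball)
      fix \<beta> z
      have "((\<lambda>r. ?P r (ell2_basis \<beta>)) \<longlongrightarrow> T (ell2_basis \<beta>)) (at_left 1)"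
        unfolding multiplier_basis[OF T, of \<beta>] fourier_coeff_eq
        by (rule nc_eval_creation_tendsto)
      then have "((\<lambda>r. z *\<^sub>C ?P r (ell2_basis \<beta>)) \<longlongrightarrow> z *\<^sub>C T (ell2_basis \<beta>)) (at_left 1)"
        by (intro scaleC.tendsto tendsto_const)
      moreover have "\<forall>\<^sub>F r in at_left 1. z *\<^sub>C ?P r (ell2_basis \<beta>) = ?P r (z *\<^sub>C ell2_basis \<beta>)"
        using eventually_at_left_1
        by eventually_elim
          (simp add: clinear_opD[OF clinear_op_nc_eval[OF ncps_radius_fourier scaled_creation_in_ball]])
      ultimately show "((\<lambda>r. ?P r (z *\<^sub>C ell2_basis \<beta>)) \<longlongrightarrow> T (z *\<^sub>C ell2_basis \<beta>)) (at_left 1)"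
        using T by (auto simp: left_multipliers_commute clinear_opD intro: Lim_transform_eventually)
    qed
  qed
qed

text \<open>The radial approximants of T are norm-convergent series in the left creations, so each
  weak closure step stays inside the algebra generated by X.\<close>

lemma wot_algebra_contains_multipliers:
  fixes X :: "'n::finite \<Rightarrow> 'n list ell2 \<Rightarrow>\<^sub>L 'n list ell2"
  assumes X: "\<And>i. clinear_op (X i)" and S: "\<And>i. left_creation i \<in> wot_algebra X"
  shows "left_multipliers \<subseteq> wot_algebra X"
proof
  fix T :: "'n list ell2 \<Rightarrow>\<^sub>L 'n list ell2" assume T: "T \<in> left_multipliers"
  note abel = multiplier_abel_sums[OF T, unfolded abel_sums_iff]
  show "T \<in> wot_algebra X"
  proof (rule wot_algebra_sot_limit)
    show "limitin strong_operator_topology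
        (\<lambda>r. nc_eval (fourier_coeff T) (\<lambda>i. r *\<^sub>R left_creation i)) T (at_left 1)"
      using abel by blast
    show "\<forall>\<^sub>F r in at_left 1. nc_eval (fourier_coeff T) (\<lambda>i. r *\<^sub>R left_creation i) \<in> wot_algebra X"
      using eventually_at_left_1
    proof eventually_elim
      case (elim r)
      show ?case
        unfolding nc_eval_def
        by (intro wot_algebra_suminf wot_algebra_nc_term wot_algebra_scaleR S X)
          (use abel elim in auto)
    qed
  qed simp
qed

lemma wot_algebra_left_creation: "wot_algebra left_creation = (left_multipliers :: ('n::finite list ell2 \<Rightarrow>\<^sub>L _) set)"
  by (intro equalityI wot_algebra_subset_left_multipliers wot_algebra_contains_multipliers
      wot_algebra_gen left_multipliers_intros) simp_all

text \<open>A converse to the von Neumann inequality. The bound at the vacuum vector makes c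
  square-summable; the columns obtained by appending \<beta> are limits of columns of uniformly
  bounded operators, and \<open>synthesis_operator\<close> assembles them into one operator.\<close>

lemma multiplier_of_bounded_series:
  fixes c :: "'n::finite ncps"
  assumes c: "1 \<le> ncps_radius c"
    and bound: "\<And>r. 0 < r \<Longrightarrow> r < 1 \<Longrightarrow> norm (nc_eval c (\<lambda>i. r *\<^sub>R left_creation i)) \<le> C"
  shows "\<exists>T\<in>left_multipliers. fourier_coeff T = c"
proof -
  let ?P = "\<lambda>r. nc_eval c (\<lambda>i. r *\<^sub>R left_creation i)"
  have s: "summable (nc_term c (\<lambda>i. r *\<^sub>R left_creation i))" if "0 < r" "r < 1" for r
    using that by (intro summable_nc_term c scaled_creation_in_ball) simp_all
  have C: "0 \<le> C" by (rule order_trans[OF norm_ge_zero bound[of "1 / 2"]]) simp_all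
  have "(\<Sum>w\<in>F. (cmod (c w))\<^sup>2) \<le> C\<^sup>2" if F: "finite F" for F
  proof (rule tendsto_upperbound)
    have "((\<lambda>r. \<Sum>w\<in>F. (cmod (c w * complex_of_real r ^ length w))\<^sup>2)
        \<longlongrightarrow> (\<Sum>w\<in>F. (cmod (c w * complex_of_real 1 ^ length w))\<^sup>2)) (at_left 1)"
      by (intro tendsto_intros)
    then show "((\<lambda>r. \<Sum>w\<in>F. (cmod (c w * complex_of_real r ^ length w))\<^sup>2)
        \<longlongrightarrow> (\<Sum>w\<in>F. (cmod (c w))\<^sup>2)) (at_left 1)" by simp
    show "\<forall>\<^sub>F r in at_left 1. (\<Sum>w\<in>F. (cmod (c w * complex_of_real r ^ length w))\<^sup>2) \<le> C\<^sup>2"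
      using eventually_at_left_1
    proof eventually_elim
      case (elim r)
      have "(\<Sum>w\<in>F. (cmod (c w * complex_of_real r ^ length w))\<^sup>2) \<le> (norm (?P r (ell2_basis [])))\<^sup>2"
        using sum_ell2_coeff_le[OF F, of "?P r (ell2_basis [])"] elim
        by (simp add: nc_eval_creation_coeff s)
      also have "norm (?P r (ell2_basis [])) \<le> norm (?P r) * norm (ell2_basis [] :: 'n list ell2)"
        by (rule norm_blinfun)
      then have "norm (?P r (ell2_basis [])) \<le> C"
        using bound[of r] elim by simp
      then have "(norm (?P r (ell2_basis [])))\<^sup>2 \<le> C\<^sup>2"
        by (intro power_mono) simp_all
      finally show ?case .
    qed
  qed simp
  then obtain b where b: "ell2_coeff b = c"
    using Abs_ell2_of_bound by blast
  have lim: "((\<lambda>r. ?P r (ell2_basis \<beta>)) \<longlongrightarrow> right_mult \<beta> b) (at_left 1)" for \<beta>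
    using nc_eval_creation_tendsto[of b \<beta>] by (simp add: b)
  have "(norm (\<Sum>\<beta>\<in>F. x \<beta> *\<^sub>C right_mult \<beta> b))\<^sup>2 \<le> C\<^sup>2 * (\<Sum>\<beta>\<in>F. (cmod (x \<beta>))\<^sup>2)"
    if F: "finite F" for F and x :: "'n list \<Rightarrow> complex"
  proof (rule tendsto_upperbound)
    show "((\<lambda>r. (norm (\<Sum>\<beta>\<in>F. x \<beta> *\<^sub>C ?P r (ell2_basis \<beta>)))\<^sup>2)
        \<longlongrightarrow> (norm (\<Sum>\<beta>\<in>F. x \<beta> *\<^sub>C right_mult \<beta> b))\<^sup>2) (at_left 1)"
      by (intro tendsto_intros scaleC.tendsto lim)
    show "\<forall>\<^sub>F r in at_left 1. (norm (\<Sum>\<beta>\<in>F. x \<beta> *\<^sub>C ?P r (ell2_basis \<beta>)))\<^sup>2 \<le> C\<^sup>2 * (\<Sum>\<beta>\<in>F. (cmod (x \<beta>))\<^sup>2)"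
      using eventually_at_left_1
    proof eventually_elim
      case (elim r)
      have "clinear_op (?P r)"
        using elim by (intro clinear_op_nc_eval c scaled_creation_in_ball) simp_all
      then have "(\<Sum>\<beta>\<in>F. x \<beta> *\<^sub>C ?P r (ell2_basis \<beta>)) = ?P r (\<Sum>\<beta>\<in>F. x \<beta> *\<^sub>C ell2_basis \<beta>)"
        by (simp add: blinfun.sum_right clinear_opD)
      moreover have "norm \<dots> \<le> C * norm (\<Sum>\<beta>\<in>F. x \<beta> *\<^sub>C ell2_basis \<beta> :: 'n list ell2)"
        using elim by (intro order_trans[OF norm_blinfun] mult_right_mono bound) simp_all
      ultimately have "(norm (\<Sum>\<beta>\<in>F. x \<beta> *\<^sub>C ?P r (ell2_basis \<beta>)))\<^sup>2
          \<le> (C * norm (\<Sum>\<beta>\<in>F. x \<beta> *\<^sub>C ell2_basis \<beta> :: 'n list ell2))\<^sup>2"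
        by (intro power_mono) simp_all
      then show ?case by (simp add: power_mult_distrib norm_sum_ell2_basis[OF F])
    qed
  qed simp
  from synthesis_operator[OF this C] obtain T :: "'n list ell2 \<Rightarrow>\<^sub>L 'n list ell2"
    where T: "clinear_op T" "\<And>\<beta>. T (ell2_basis \<beta>) = right_mult \<beta> b" by metis
  have "T (ell2_basis []) = b" by (simp add: T(2) right_mult_simps)
  with T have "T \<in> left_multipliers" "fourier_coeff T = c"
    by (simp_all add: left_multipliers_iff fourier_coeff_eq b)
  then show ?thesis by blast
qed

section \<open>Infinite-dimensional Hilbert spaces\<close>

lemma infinite_orthonormal_sequence:
  assumes inf: "\<nexists>B :: 'h::chilbert_space set. finite B \<and> span B = UNIV"
  shows "\<exists>b :: nat \<Rightarrow> 'h. \<forall>m n. cinner (b m) (b n) = (if m = n then 1 else 0)"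
proof -
  have "\<exists>b :: nat \<Rightarrow> 'h. \<forall>n. norm (b n) = 1 \<and> (\<forall>m<n. cinner (b n) (b m) = 0)"
  proof (rule dependent_wellorder_choice)
    fix n :: nat and f :: "nat \<Rightarrow> 'h"
    assume f: "\<And>y. y < n \<Longrightarrow> norm (f y) = 1 \<and> (\<forall>m<y. cinner (f y) (f m) = 0)"
    have orth: "cinner (f i) (f j) = (if i = j then 1 else 0)" if "i < n" "j < n" for i j
    proof (cases i j rule: linorder_cases)
      case less
      then have "cinner (f j) (f i) = 0" using f[OF that(2)] by blast
      then show ?thesis using less cinner_commute[of "f i" "f j"] by simp
    next
      case equal
      then show ?thesis using f[OF that(1)] by (simp add: cinner_self)
    next
      case greater
      then show ?thesis using f[OF that(1)] by auto
    qed
    define res where "res x = x - (\<Sum>m<n. cinner x (f m) *\<^sub>C f m)" for x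
    have res_orth: "cinner (res x) (f m) = 0" if "m < n" for x m
    proof -
      have "(\<Sum>k<n. cinner x (f k) * cinner (f k) (f m)) = (\<Sum>k<n. if k = m then cinner x (f k) else 0)"
        using that by (intro sum.cong) (simp_all add: orth)
      then show ?thesis
        using that by (simp add: res_def cinner.diff_left cinner.sum_left cinner_scaleC_left)
    qed
    have "\<exists>x. res x \<noteq> 0"
    proof (rule ccontr)
      assume "\<not> ?thesis"
      then have x: "x = (\<Sum>m<n. cinner x (f m) *\<^sub>C f m)" for x
        by (simp add: res_def)
      \<comment> \<open>\<open>span\<close> is the real span, so both f_m and i f_m are needed to
        absorb complex coefficients.\<close>
      define B where "B = f ` {..<n} \<union> (\<lambda>m. \<i> *\<^sub>C f m) ` {..<n}"
      have "x \<in> span B" for x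
      proof -
        have "cinner x (f m) *\<^sub>C f m = Re (cinner x (f m)) *\<^sub>R f m + Im (cinner x (f m)) *\<^sub>R (\<i> *\<^sub>C f m)" for m
          unfolding scaleR_scaleC scaleC_scaleC scaleC_add_left[symmetric]
          by (simp add: complex_eq[symmetric] mult.commute)
        moreover have "f m \<in> span B" "\<i> *\<^sub>C f m \<in> span B" if "m < n" for m
          using that by (auto intro!: span_base simp: B_def)
        ultimately have "cinner x (f m) *\<^sub>C f m \<in> span B" if "m < n" for m
          using that by (simp add: span_add span_scale)
        then show ?thesis
          by (subst x) (auto intro: span_sum)
      qed
      then have "finite B \<and> span B = UNIV" by (auto simp: B_def)
      with inf show False by blast
    qed
    then obtain x where "res x \<noteq> 0" by blast
    then have "norm (res x /\<^sub>R norm (res x)) = 1 \<and> (\<forall>m<n. cinner (res x /\<^sub>R norm (res x)) (f m) = 0)"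
      by (simp add: cinner_scaleR res_orth)
    then show "\<exists>r. norm r = 1 \<and> (\<forall>m<n. cinner r (f m) = 0)" by blast
  qed auto
  then obtain b :: "nat \<Rightarrow> 'h" where b: "\<And>n. norm (b n) = 1" "\<And>n m. m < n \<Longrightarrow> cinner (b n) (b m) = 0"
    by blast
  have "cinner (b m) (b n) = (if m = n then 1 else 0)" for m n
  proof (cases m n rule: linorder_cases)
    case less
    then show ?thesis using b(2)[OF less] cinner_commute[of "b m" "b n"] by simp
  qed (simp_all add: b cinner_self)
  then show ?thesis by blast
qed

lemma norm_adj_le: "clinear_op A \<Longrightarrow> norm (adj A x) \<le> norm A * norm x"
proof (rule norm_le_cinner)
  assume A: "clinear_op A"
  fix y
  have "cmod (cinner (adj A x) y) \<le> norm x * norm (A y)"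
    by (simp add: cinner_adj'[OF A] norm_cinner_le)
  also have "\<dots> \<le> norm x * (norm A * norm y)"
    by (intro mult_left_mono norm_blinfun) simp
  finally show "cmod (cinner (adj A x) y) \<le> norm A * norm x * norm y"
    by (simp add: mult_ac)
qed simp

text \<open>Words over a finite alphabet are countable, so \<open>to_nat\<close> assigns to distinct
  words distinct members of an orthonormal sequence, and these become the images of the basis
  vectors.\<close>

lemma fock_isometry:
  assumes "\<nexists>B :: 'h::chilbert_space set. finite B \<and> span B = UNIV"
  obtains V :: "'n::finite list ell2 \<Rightarrow>\<^sub>L 'h::chilbert_space"
  where "clinear_op V" "norm V \<le> 1" "\<And>x. adj V (V x) = x" "\<And>x. norm (V x) = norm x"
proof -
  obtain b :: "nat \<Rightarrow> 'h" where b: "\<And>m n. cinner (b m) (b n) = (if m = n then 1 else 0)"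
    using infinite_orthonormal_sequence[OF assms] by blast
  define v where "v \<alpha> = b (to_nat \<alpha>)" for \<alpha> :: "'n list"
  have v: "cinner (v \<alpha>) (v \<beta>) = (if \<alpha> = \<beta> then 1 else 0)" for \<alpha> \<beta>
    by (simp add: v_def b)
  have bound: "(norm (\<Sum>\<alpha>\<in>F. c \<alpha> *\<^sub>C v \<alpha>))\<^sup>2 \<le> 1\<^sup>2 * (\<Sum>\<alpha>\<in>F. (cmod (c \<alpha>))\<^sup>2)" if "finite F" for F c
    using norm_sum_orthonormal[OF that, of v c] by (simp add: v)
  have "\<exists>V :: 'n list ell2 \<Rightarrow>\<^sub>L 'h. clinear_op V \<and> (\<forall>\<alpha>. V (ell2_basis \<alpha>) = v \<alpha>) \<and> norm V \<le> 1 \<and>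
      (\<forall>y \<alpha>. ell2_coeff (adj V y) \<alpha> = cinner y (v \<alpha>))"
    by (rule synthesis_operator[of v 1, OF bound zero_le_one]) blast+
  then obtain V :: "'n list ell2 \<Rightarrow>\<^sub>L 'h" where V: "clinear_op V" "\<And>\<alpha>. V (ell2_basis \<alpha>) = v \<alpha>" "norm V \<le> 1"
    "\<And>y \<alpha>. ell2_coeff (adj V y) \<alpha> = cinner y (v \<alpha>)"
    by blast
  have "adj V o\<^sub>L V = id_blinfun"
    by (rule clinear_op_ell2_eqI)
      (auto intro!: clinear_op_intros clinear_op_adj ell2_eqI simp: V v ell2_coeff_basis)
  then have id: "adj V (V x) = x" for x
    by (metis blinfun_apply_blinfun_compose id_blinfun.rep_eq)
  have "norm (V x) = norm x" for x
  proof -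
    have "complex_of_real ((norm (V x))\<^sup>2) = complex_of_real ((norm x)\<^sup>2)"
      by (simp only: cinner_self[symmetric] cinner_adj[OF V(1)] id)
    then show ?thesis
      by (simp only: of_real_eq_iff power2_eq_iff_nonneg norm_ge_zero)
  qed
  with V id show ?thesis by (intro that)
qed

text \<open>For an isometry V this is a copy of r S_i on the range of V and 0 on its orthogonal
  complement, so V intertwines it with r S_i.\<close>

definition transported_creation ::
    "('n::finite list ell2 \<Rightarrow>\<^sub>L 'h::chilbert_space) \<Rightarrow> real \<Rightarrow> 'n \<Rightarrow> 'h \<Rightarrow>\<^sub>L 'h"
  where "transported_creation V r i = r *\<^sub>R (V o\<^sub>L left_creation i o\<^sub>L adj V)"

context
  fixes V :: "'n::finite list ell2 \<Rightarrow>\<^sub>L 'h::chilbert_space"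
  assumes Vc: "clinear_op V" and V1: "norm V \<le> 1" and VV: "\<And>x. adj V (V x) = x"
    and Vn: "\<And>x. norm (V x) = norm x"
begin

lemma transported_creation_in_ball:
  assumes "0 \<le> r" "r < 1"
  shows "transported_creation V r \<in> op_ball 1"
proof -
  note [intro!] = clinear_op_intros clinear_op_adj Vc
  have c: "clinear_op (transported_creation V r i)" for i
    unfolding transported_creation_def by auto
  have adj: "adj (transported_creation V r i) x = r *\<^sub>R V (adj (left_creation i) (adj V x))" for i x
  proof -
    have "adj (transported_creation V r i) = r *\<^sub>R (V o\<^sub>L adj (left_creation i) o\<^sub>L adj V)"
      by (rule adj_eqI[OF c])
        (simp add: transported_creation_def blinfun.scaleR_left cinner_scaleR cinner_adj Vc cinner_adj')
    then show ?thesis by (simp add: blinfun.scaleR_left)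
  qed
  have "row_norm (transported_creation V r) \<le> r"
  proof (rule row_norm_leI[OF assms(1)])
    fix x
    have "(\<Sum>i\<in>UNIV. (norm (adj (transported_creation V r i) x))\<^sup>2)
        = r\<^sup>2 * (\<Sum>i\<in>UNIV. (norm (adj (left_creation i) (adj V x)))\<^sup>2)"
      by (simp add: adj Vn power_mult_distrib sum_distrib_left)
    also have "\<dots> \<le> r\<^sup>2 * (norm (adj V x))\<^sup>2"
      by (intro mult_left_mono sum_norm_adj_left_creation_le) simp
    also have "norm (adj V x) \<le> 1 * norm x"
      by (rule order_trans[OF norm_adj_le[OF Vc] mult_right_mono[OF V1]]) simp
    then have "r\<^sup>2 * (norm (adj V x))\<^sup>2 \<le> r\<^sup>2 * (norm x)\<^sup>2"
      by (intro mult_left_mono power_mono) simp_all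
    finally show "(\<Sum>i\<in>UNIV. (norm (adj (transported_creation V r i) x))\<^sup>2) \<le> r\<^sup>2 * (norm x)\<^sup>2" .
  qed
  then show ?thesis using assms(2) c by (simp add: op_ball_iff)
qed

lemma nc_term_transported:
  "nc_term c (transported_creation V r) k (V x) = V (nc_term c (\<lambda>i. r *\<^sub>R left_creation i) k x)"
proof -
  have "op_word (transported_creation V r) \<alpha> (V x) = V (op_word (\<lambda>i. r *\<^sub>R left_creation i) \<alpha> x)" for \<alpha>
    by (induction \<alpha>) (simp_all add: transported_creation_def blinfun.scaleR_left blinfun.scaleR_right VV)
  then show ?thesis
    by (simp add: nc_term_def sum_blinfun_apply blinfun.sum_right clinear_opD[OF Vc])
qed

lemma nc_eval_transported:
  assumes "1 \<le> ncps_radius c" "0 \<le> r" "r < 1"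
  shows "nc_eval c (transported_creation V r) (V x) = V (nc_eval c (\<lambda>i. r *\<^sub>R left_creation i) x)"
proof -
  have "summable (nc_term c (transported_creation V r))" "summable (nc_term c (\<lambda>i. r *\<^sub>R left_creation i))"
    using assms by (auto intro!: summable_nc_term transported_creation_in_ball scaled_creation_in_ball)
  then have "(\<lambda>k. nc_term c (transported_creation V r) k (V x)) sums nc_eval c (transported_creation V r) (V x)"
    and "(\<lambda>k. V (nc_term c (\<lambda>i. r *\<^sub>R left_creation i) k x)) sums V (nc_eval c (\<lambda>i. r *\<^sub>R left_creation i) x)"
    by (auto simp: nc_eval_def intro!: summable_sums
        bounded_linear.sums[OF blinfun.bounded_linear_left] bounded_linear.sums[OF blinfun.bounded_linear_right])
  then show ?thesis
    unfolding nc_term_transported by (rule sums_unique2)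
qed

text \<open>Terms of a convergent series are bounded, and the vector
  \<open>V (ell2_basis [])\<close> reads the number \<open>hom_norm c k * r ^ k\<close> off the k-th
  term.\<close>

lemma transported_radius_ge_one:
  assumes "\<And>X :: 'n \<Rightarrow> 'h \<Rightarrow>\<^sub>L 'h. X \<in> op_ball 1 \<Longrightarrow> summable (nc_term c X)"
  shows "1 \<le> ncps_radius c"
proof (rule ncps_radius_ge_one)
  fix r :: real assume r: "0 < r" "r < 1"
  have "summable (nc_term c (transported_creation V r))"
    using r by (intro assms transported_creation_in_ball) simp_all
  then have "Bseq (nc_term c (transported_creation V r))"
    by (intro convergent_imp_Bseq) (auto simp: convergent_def dest: summable_LIMSEQ_zero)
  then obtain C where C: "\<And>k. norm (nc_term c (transported_creation V r) k) \<le> C"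
    by (auto simp: Bseq_def)
  have "hom_norm c k * r ^ k \<le> C" for k
  proof -
    have "hom_norm c k * r ^ k = norm (nc_term c (transported_creation V r) k (V (ell2_basis [])))"
      using r by (simp add: nc_term_transported Vn nc_term_scaleR blinfun.scaleR_left
          norm_nc_term_creation_vacuum)
    also have "\<dots> \<le> norm (nc_term c (transported_creation V r) k) * norm (V (ell2_basis []))"
      by (rule norm_blinfun)
    finally show ?thesis using C[of k] by (simp add: Vn)
  qed
  then show "\<exists>C. \<forall>k. hom_norm c k * r ^ k \<le> C" by blast
qed

lemma transported_bounded_multiplier:
  assumes c: "1 \<le> ncps_radius c"
    and bound: "\<And>X :: 'n \<Rightarrow> 'h \<Rightarrow>\<^sub>L 'h. X \<in> op_ball 1 \<Longrightarrow> norm (nc_eval c X) \<le> C"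
  shows "\<exists>T\<in>left_multipliers. fourier_coeff T = c"
proof (rule multiplier_of_bounded_series[OF c])
  fix r :: real assume r: "0 < r" "r < 1"
  have X: "transported_creation V r \<in> op_ball 1"
    using r by (intro transported_creation_in_ball) simp_all
  show "norm (nc_eval c (\<lambda>i. r *\<^sub>R left_creation i)) \<le> C"
  proof (rule norm_blinfun_bound)
    show "0 \<le> C" by (rule order_trans[OF norm_ge_zero bound[OF X]])
    fix x
    have "norm (nc_eval c (\<lambda>i. r *\<^sub>R left_creation i) x) = norm (nc_eval c (transported_creation V r) (V x))"
      using r by (simp add: nc_eval_transported c Vn)
    also have "\<dots> \<le> norm (nc_eval c (transported_creation V r)) * norm (V x)"
      by (rule norm_blinfun)
    also have "\<dots> \<le> C * norm x"
      unfolding Vn by (intro mult_right_mono bound X) simp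
    finally show "norm (nc_eval c (\<lambda>i. r *\<^sub>R left_creation i) x) \<le> C * norm x" .
  qed
qed

lemma transported_unique:
  assumes c: "1 \<le> ncps_radius c" and d: "1 \<le> ncps_radius d"
    and eq: "\<And>X :: 'n \<Rightarrow> 'h \<Rightarrow>\<^sub>L 'h. X \<in> op_ball 1 \<Longrightarrow> nc_eval c X = nc_eval d X"
  shows "c = d"
proof
  fix w
  \<comment> \<open>Any radius strictly between 0 and 1 serves: the coefficient at w appears with
    the nonzero factor (1/2)^|w|.\<close>
  let ?X = "\<lambda>i. (1 / 2) *\<^sub>R left_creation i :: 'n list ell2 \<Rightarrow>\<^sub>L 'n list ell2"
  have "V (nc_eval c ?X (ell2_basis [])) = V (nc_eval d ?X (ell2_basis []))"
    using eq[OF transported_creation_in_ball[of "1 / 2"]] c d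
    by (simp add: nc_eval_transported[symmetric])
  then have "nc_eval c ?X (ell2_basis []) = nc_eval d ?X (ell2_basis [])"
    by (metis VV)
  moreover have "?X \<in> op_ball 1"
    by (rule scaled_creation_in_ball) simp_all
  ultimately show "c w = d w"
    using nc_eval_creation_coeff[OF summable_nc_term[OF c], of "1 / 2" w]
      nc_eval_creation_coeff[OF summable_nc_term[OF d], of "1 / 2" w] by simp
qed

end

text \<open>One inclusion is the von Neumann inequality; the other tests a bounded function at the
  transported creations, where its bound becomes a bound on the radial approximants.\<close>

lemma Hinf_ball_eq:
  assumes "\<nexists>B :: 'h::chilbert_space set. finite B \<and> span B = UNIV"
  shows "(Hinf_ball TYPE('h) :: 'n::finite ncps set) = fourier_coeff ` left_multipliers"
proof (intro equalityI subsetI)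
  fix \<phi> :: "'n ncps" assume "\<phi> \<in> Hinf_ball TYPE('h)"
  then have \<phi>: "1 \<le> ncps_radius \<phi>"
    and "bounded (nc_eval \<phi> ` (op_ball 1 :: ('n \<Rightarrow> 'h \<Rightarrow>\<^sub>L 'h) set))"
    by (simp_all add: Hinf_ball_def)
  then obtain C where "\<And>X :: 'n \<Rightarrow> 'h \<Rightarrow>\<^sub>L 'h. X \<in> op_ball 1 \<Longrightarrow> norm (nc_eval \<phi> X) \<le> C"
    by (auto simp: bounded_iff)
  then show "\<phi> \<in> fourier_coeff ` left_multipliers"
    using fock_isometry[OF assms] transported_bounded_multiplier[OF _ _ _ _ \<phi>] by (metis imageI)
next
  fix \<phi> :: "'n ncps" assume "\<phi> \<in> fourier_coeff ` left_multipliers"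
  then show "\<phi> \<in> Hinf_ball TYPE('h)"
    by (auto simp: Hinf_ball_def ncps_radius_fourier bounded_iff intro!: von_Neumann_inequality)
qed

section \<open>Values of tuples of series\<close>

lemma radially_summable_eventually:
  "radially_summable c X \<Longrightarrow> \<forall>\<^sub>F r in at_left 1. summable (nc_term c (\<lambda>i. r *\<^sub>R X i))"
  unfolding radially_summable_def eventually_at_left_field by blast

text \<open>Strong convergence makes the series converge at each vector, where Abel's theorem
  applies. \<open>tuple_value\<close> prefers the SOT value whenever it exists, so this agreement is
  needed to identify it from radial data.\<close>

lemma sot_sums_rad_sums_unique:
  assumes sot: "sot_sums c X L" and rad: "rad_sums c X L'"
  shows "L = L'"
proof (rule blinfun_eqI)
  fix x
  have "(\<lambda>k. nc_term c X k x) sums L x"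
    using sot by (simp add: sot_sums_def limitin_sot_iff sums_def sum_blinfun_apply)
  then have 1: "((\<lambda>r. suminf (\<lambda>k. r ^ k *\<^sub>R nc_term c X k x)) \<longlongrightarrow> L x) (at_left 1)"
    by (rule Abel_limit)
  have 2: "((\<lambda>r. nc_eval c (\<lambda>i. r *\<^sub>R X i) x) \<longlongrightarrow> L' x) (at_left 1)"
    using rad by (simp add: rad_sums_def limitin_sot_iff)
  have "\<forall>\<^sub>F r in at_left 1. nc_eval c (\<lambda>i. r *\<^sub>R X i) x = suminf (\<lambda>k. r ^ k *\<^sub>R nc_term c X k x)"
  proof (rule eventually_mono)
    show "\<forall>\<^sub>F r in at_left 1. summable (nc_term c (\<lambda>i. r *\<^sub>R X i))"
      using rad by (intro radially_summable_eventually) (simp add: rad_sums_def)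
    fix r :: real assume "summable (nc_term c (\<lambda>i. r *\<^sub>R X i))"
    then show "nc_eval c (\<lambda>i. r *\<^sub>R X i) x = suminf (\<lambda>k. r ^ k *\<^sub>R nc_term c X k x)"
      unfolding nc_eval_def
      by (subst bounded_linear.suminf[OF blinfun.bounded_linear_left]) (simp_all add: nc_term_scaleR blinfun.scaleR_left)
  qed
  from Lim_transform_eventually[OF 2 this] show "L x = L' x"
    using 1 tendsto_unique[OF _ 1] by simp
qed

lemma sot_sums_unique: "sot_sums c X L \<Longrightarrow> sot_sums c X L' \<Longrightarrow> L = L'"
  unfolding sot_sums_def by (erule limitin_sot_unique, assumption) simp

lemma rad_sums_unique: "rad_sums c X L \<Longrightarrow> rad_sums c X L' \<Longrightarrow> L = L'"
  unfolding rad_sums_def by (elim conjE, erule limitin_sot_unique, assumption) simp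

lemma tuple_value_sums:
  assumes "X \<in> conv_sot f \<union> conv_rad f"
  shows "sot_sums (f j) X (tuple_value f X j) \<or> rad_sums (f j) X (tuple_value f X j)"
proof (cases "X \<in> conv_sot f")
  case True
  then have "\<exists>L. sot_sums (f j) X L" by (simp add: conv_sot_def)
  then have "sot_sums (f j) X (THE L. sot_sums (f j) X L)"
    using sot_sums_unique by (metis theI)
  with True show ?thesis by (simp add: tuple_value_def)
next
  case False
  with assms have "\<exists>L. rad_sums (f j) X L" by (simp add: conv_rad_def)
  then have "rad_sums (f j) X (THE L. rad_sums (f j) X L)"
    using rad_sums_unique by (metis theI)
  with False show ?thesis by (simp add: tuple_value_def)
qed

lemma tuple_value_eqI:
  assumes X: "\<And>i. clinear_op (X i)"
    and L: "(\<forall>j. sot_sums (f j) X (L j)) \<or> (\<forall>j. rad_sums (f j) X (L j))"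
  shows "X \<in> conv_sot f \<union> conv_rad f" "tuple_value f X = L"
proof -
  show *: "X \<in> conv_sot f \<union> conv_rad f"
    using X L by (auto simp: conv_sot_def conv_rad_def BH_iff)
  show "tuple_value f X = L"
  proof
    fix j
    show "tuple_value f X j = L j"
      using tuple_value_sums[OF *, of j] L sot_sums_unique rad_sums_unique sot_sums_rad_sums_unique
      by metis
  qed
qed

text \<open>Applied to the universal model, this places f_j(M_Z), that is S_j, in the algebra
  generated by M_Z.\<close>

lemma tuple_value_in_wot_algebra:
  assumes "X \<in> conv_sot f \<union> conv_rad f"
  shows "tuple_value f X j \<in> wot_algebra X"
proof -
  have X: "clinear_op (X i)" for i
    using assms by (auto simp: conv_sot_def conv_rad_def BH_iff)
  from tuple_value_sums[OF assms, of j] show ?thesis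
  proof
    assume "sot_sums (f j) X (tuple_value f X j)"
    then show ?thesis
      unfolding sot_sums_def
      by (rule wot_algebra_sot_limit)
        (auto intro!: always_eventually wot_algebra_sum wot_algebra_nc_term wot_algebra_gen X)
  next
    assume rad: "rad_sums (f j) X (tuple_value f X j)"
    show ?thesis
    proof (rule wot_algebra_sot_limit)
      show "limitin strong_operator_topology (\<lambda>r. nc_eval (f j) (\<lambda>i. r *\<^sub>R X i)) (tuple_value f X j) (at_left 1)"
        using rad by (simp add: rad_sums_def)
      show "\<forall>\<^sub>F r in at_left 1. nc_eval (f j) (\<lambda>i. r *\<^sub>R X i) \<in> wot_algebra X"
        using radially_summable_eventually[of "f j" X] rad
        by (auto simp: rad_sums_def nc_eval_def elim!: eventually_mono
            intro!: wot_algebra_suminf wot_algebra_nc_term wot_algebra_scaleR wot_algebra_gen X)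
    qed simp
  qed
qed

lemma clinear_op_tuple_value:
  assumes "X \<in> conv_sot f \<union> conv_rad f"
  shows "clinear_op (tuple_value f X j)"
  using tuple_value_in_wot_algebra[OF assms] assms
  by (auto simp: conv_sot_def conv_rad_def BH_iff intro: clinear_op_wot_algebra)

section \<open>Composition of formal power series\<close>

lemma ncps_mult_Nil: "ncps_mult p q [] = p [] * q []"
  by (simp add: ncps_mult_def)

text \<open>Recursion through the left derivative of p at the letter x; it replaces sums over
  cutting points by structural induction on the word, as in associativity.\<close>

lemma ncps_mult_Cons: "ncps_mult p q (x # w) = p [] * q (x # w) + ncps_mult (\<lambda>u. p (x # u)) q w"
  by (simp add: ncps_mult_def sum.atMost_Suc_shift del: sum.atMost_Suc)

lemma ncps_mult_sum_left:
  "ncps_mult (\<lambda>w. \<Sum>i\<in>I. z i * p i w) q w = (\<Sum>i\<in>I. z i * ncps_mult (p i) q w)"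
  unfolding ncps_mult_def sum_distrib_right sum_distrib_left
  by (subst sum.swap) (simp add: mult.assoc)

lemma ncps_mult_add_left: "ncps_mult (\<lambda>w. z * p w + q w) r w = z * ncps_mult p r w + ncps_mult q r w"
  by (simp add: ncps_mult_def distrib_right sum.distrib sum_distrib_left mult.assoc)

lemma ncps_mult_assoc: "ncps_mult (ncps_mult p q) r = ncps_mult p (ncps_mult q r)"
proof
  fix w show "ncps_mult (ncps_mult p q) r w = ncps_mult p (ncps_mult q r) w"
  proof (induction w arbitrary: p)
    case (Cons x w)
    have "ncps_mult (ncps_mult p q) r (x # w)
        = p [] * q [] * r (x # w) + (p [] * ncps_mult (\<lambda>u. q (x # u)) r w + ncps_mult (ncps_mult (\<lambda>u. p (x # u)) q) r w)"
      by (simp add: ncps_mult_Cons ncps_mult_Nil ncps_mult_add_left)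
    also have "\<dots> = ncps_mult p (ncps_mult q r) (x # w)"
      by (simp add: Cons.IH ncps_mult_Cons algebra_simps)
    finally show ?case .
  qed (simp add: ncps_mult_Nil)
qed

lemma ncps_mult_one_left [simp]: "ncps_mult ncps_one q = q"
proof
  fix w show "ncps_mult ncps_one q w = q w"
  proof (cases w)
    case (Cons x v)
    have "ncps_mult (\<lambda>u. ncps_one (x # u)) q v = 0"
      by (simp add: ncps_mult_def ncps_one_def)
    then show ?thesis by (simp add: Cons ncps_mult_Cons ncps_one_def)
  qed (simp add: ncps_mult_Nil ncps_one_def)
qed

lemma ncps_mult_one_right [simp]: "ncps_mult p ncps_one = p"
proof
  fix w show "ncps_mult p ncps_one w = p w"
    by (induction w arbitrary: p) (simp_all add: ncps_mult_Nil ncps_mult_Cons ncps_one_def)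
qed

lemma ncps_mult_var_left:
  "ncps_mult (ncps_var j) b w = (case w of [] \<Rightarrow> 0 | i # v \<Rightarrow> if i = j then b v else 0)"
proof (cases w)
  case (Cons i v)
  have "(\<lambda>u. ncps_var j (i # u)) = (\<lambda>u. (if i = j then 1 else 0) * ncps_one u + 0)"
    by (auto simp: fun_eq_iff ncps_var_def ncps_one_def)
  then have "ncps_mult (\<lambda>u. ncps_var j (i # u)) b v = (if i = j then b v else 0)"
    by (simp only: ncps_mult_add_left[of _ _ "\<lambda>_. 0"]) (simp add: ncps_mult_def[of "\<lambda>_. 0"])
  then show ?thesis by (simp add: Cons ncps_mult_Cons ncps_var_def)
qed (simp add: ncps_mult_Nil ncps_var_def)

lemma ncps_mult_var_right:
  "ncps_mult b (ncps_var j) w = (if w \<noteq> [] \<and> last w = j then b (butlast w) else 0)"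
proof (induction w arbitrary: b)
  case (Cons i v)
  then show ?case
    by (cases "v = []") (simp_all add: ncps_mult_Cons ncps_mult_Nil ncps_var_def)
qed (simp add: ncps_mult_Nil ncps_var_def)

lemma ell2_coeff_left_creation: "ell2_coeff (left_creation j b) = ncps_mult (ncps_var j) (ell2_coeff b)"
  by (simp add: fun_eq_iff ncps_mult_var_left left_creation_coeff)

lemma ell2_coeff_right_creation: "ell2_coeff (right_creation j b) = ncps_mult (ell2_coeff b) (ncps_var j)"
  by (simp add: fun_eq_iff ncps_mult_var_right right_creation_coeff)

lemma ncps_word_Nil [simp]: "ncps_word f [] = ncps_one"
  and ncps_word_Cons [simp]: "ncps_word f (i # \<alpha>) = ncps_mult (f i) (ncps_word f \<alpha>)"
  by (simp_all add: ncps_word_def)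

lemma ncps_word_append: "ncps_word f (\<alpha> @ \<beta>) = ncps_mult (ncps_word f \<alpha>) (ncps_word f \<beta>)"
  by (induction \<alpha>) (simp_all add: ncps_mult_assoc)

lemma ncps_word_var: "ncps_word ncps_var \<alpha> = (\<lambda>w. if w = \<alpha> then 1 else 0)"
  by (induction \<alpha>) (auto simp: fun_eq_iff ncps_one_def ncps_mult_var_left split: list.splits)

lemma ell2_coeff_basis_eq: "ell2_coeff (ell2_basis \<alpha>) = ncps_word ncps_var \<alpha>"
  by (simp add: fun_eq_iff ncps_word_var ell2_coeff_basis)

text \<open>\<open>Sum_any\<close> returns 0 on infinite support, so algebraic identities for
  \<open>ncps_compose\<close> need every coefficient to be a genuine finite sum.\<close>

definition composable :: "'n ncps \<Rightarrow> ('n \<Rightarrow> 'n ncps) \<Rightarrow> bool"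
  where "composable b f \<longleftrightarrow> (\<forall>w. finite {\<alpha>. b \<alpha> * ncps_word f \<alpha> w \<noteq> 0})"

lemma composable_polynomial: "nc_polynomial b \<Longrightarrow> composable b f"
  unfolding composable_def nc_polynomial_def by (auto elim: finite_subset[rotated])

lemma ncps_compose_eq_sum:
  assumes "finite A" "{\<alpha>. b \<alpha> * ncps_word f \<alpha> w \<noteq> 0} \<subseteq> A"
  shows "ncps_compose b f w = (\<Sum>\<alpha>\<in>A. b \<alpha> * ncps_word f \<alpha> w)"
  unfolding ncps_compose_def by (rule Sum_any.expand_superset[OF assms])

lemma ncps_compose_sum:
  assumes I: "finite I" and p: "\<And>i. i \<in> I \<Longrightarrow> composable (p i) f"
  shows "ncps_compose (\<lambda>\<alpha>. \<Sum>i\<in>I. z i * p i \<alpha>) f = (\<lambda>w. \<Sum>i\<in>I. z i * ncps_compose (p i) f w)"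
proof
  fix w
  define A where "A = (\<Union>i\<in>I. {\<alpha>. p i \<alpha> * ncps_word f \<alpha> w \<noteq> 0})"
  have A: "finite A" using I p by (auto simp: A_def composable_def)
  have zero: "p i \<alpha> * ncps_word f \<alpha> w = 0" if "\<alpha> \<notin> A" "i \<in> I" for \<alpha> i
    using that unfolding A_def by blast
  have "{\<alpha>. (\<Sum>i\<in>I. z i * p i \<alpha>) * ncps_word f \<alpha> w \<noteq> 0} \<subseteq> A"
  proof
    fix \<alpha> assume \<alpha>: "\<alpha> \<in> {\<alpha>. (\<Sum>i\<in>I. z i * p i \<alpha>) * ncps_word f \<alpha> w \<noteq> 0}"
    show "\<alpha> \<in> A"
    proof (rule ccontr)
      assume "\<alpha> \<notin> A"
      then have "(\<Sum>i\<in>I. z i * p i \<alpha>) * ncps_word f \<alpha> w = 0"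
        unfolding sum_distrib_right using zero by (intro sum.neutral) auto
      with \<alpha> show False by blast
    qed
  qed
  then have "ncps_compose (\<lambda>\<alpha>. \<Sum>i\<in>I. z i * p i \<alpha>) f w
      = (\<Sum>\<alpha>\<in>A. (\<Sum>i\<in>I. z i * p i \<alpha>) * ncps_word f \<alpha> w)"
    by (rule ncps_compose_eq_sum[OF A])
  also have "\<dots> = (\<Sum>i\<in>I. z i * (\<Sum>\<alpha>\<in>A. p i \<alpha> * ncps_word f \<alpha> w))"
    unfolding sum_distrib_right sum_distrib_left by (subst sum.swap) (simp add: mult.assoc)
  also have "\<dots> = (\<Sum>i\<in>I. z i * ncps_compose (p i) f w)"
    using zero by (intro sum.cong refl) (subst ncps_compose_eq_sum[OF A], auto)
  finally show "ncps_compose (\<lambda>\<alpha>. \<Sum>i\<in>I. z i * p i \<alpha>) f w = (\<Sum>i\<in>I. z i * ncps_compose (p i) f w)" .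
qed

lemma ncps_compose_diff:
  assumes "composable p f" "composable q f"
  shows "ncps_compose (\<lambda>\<alpha>. p \<alpha> - q \<alpha>) f = (\<lambda>w. ncps_compose p f w - ncps_compose q f w)"
proof -
  have "(\<lambda>\<alpha>. p \<alpha> - q \<alpha>) = (\<lambda>\<alpha>. \<Sum>i\<in>UNIV. (if i then 1 else - 1) * (if i then p else q) \<alpha>)"
    by (simp add: UNIV_bool)
  moreover have "ncps_compose \<dots> f
      = (\<lambda>w. \<Sum>i\<in>UNIV. (if i then 1 else - 1) * ncps_compose (if i then p else q) f w)"
    by (rule ncps_compose_sum) (use assms in auto)
  ultimately show ?thesis by (simp add: UNIV_bool)
qed

text \<open>Common core of multiplying by a letter on either side: g attaches the letter j, the
  index k runs over the cuts of w, m k is the coefficient of f_j on one piece, and t k is the other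
  piece.\<close>

lemma ncps_compose_reindex:
  assumes b: "composable b f" and g: "inj g"
    and c: "\<And>\<alpha>. c (g \<alpha>) = b \<alpha>" "\<And>\<beta>. \<beta> \<notin> range g \<Longrightarrow> c \<beta> = 0"
    and word: "\<And>\<alpha>. ncps_word f (g \<alpha>) w = (\<Sum>k\<le>n. m k * ncps_word f \<alpha> (t k))"
  shows "ncps_compose c f w = (\<Sum>k\<le>(n::nat). m k * ncps_compose b f (t k))"
proof -
  define A where "A = (\<Union>k\<le>n. {\<alpha>. b \<alpha> * ncps_word f \<alpha> (t k) \<noteq> 0})"
  have A: "finite A" using b by (auto simp: A_def composable_def)
  have zero: "b \<alpha> * ncps_word f \<alpha> (t k) = 0" if "\<alpha> \<notin> A" "k \<le> n" for \<alpha> k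
    using that unfolding A_def by blast
  have zero': "b \<alpha> * ncps_word f (g \<alpha>) w = 0" if "\<alpha> \<notin> A" for \<alpha>
    unfolding word sum_distrib_left
    using zero[OF that] by (intro sum.neutral) (auto simp: mult.left_commute)
  have "ncps_compose c f w = (\<Sum>\<beta>\<in>g ` A. c \<beta> * ncps_word f \<beta> w)"
  proof (rule ncps_compose_eq_sum)
    show "{\<beta>. c \<beta> * ncps_word f \<beta> w \<noteq> 0} \<subseteq> g ` A"
    proof
      fix \<beta> assume \<beta>: "\<beta> \<in> {\<beta>. c \<beta> * ncps_word f \<beta> w \<noteq> 0}"
      then obtain \<alpha> where "\<beta> = g \<alpha>" using c(2) by fastforce
      with \<beta> zero'[of \<alpha>] c(1) show "\<beta> \<in> g ` A" by auto
    qed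
  qed (use A in simp)
  also have "\<dots> = (\<Sum>\<alpha>\<in>A. b \<alpha> * ncps_word f (g \<alpha>) w)"
    by (subst sum.reindex) (use g in \<open>auto simp: c(1) intro: inj_on_subset\<close>)
  also have "\<dots> = (\<Sum>k\<le>n. m k * (\<Sum>\<alpha>\<in>A. b \<alpha> * ncps_word f \<alpha> (t k)))"
    unfolding word sum_distrib_left by (subst sum.swap) (simp add: mult_ac)
  also have "\<dots> = (\<Sum>k\<le>n. m k * ncps_compose b f (t k))"
    by (intro sum.cong refl arg_cong[of _ _ "(*) _"] ncps_compose_eq_sum[OF A, symmetric]) (auto simp: A_def)
  finally show ?thesis .
qed

lemma ncps_compose_var_left:
  assumes "composable b f"
  shows "ncps_compose (ncps_mult (ncps_var j) b) f = ncps_mult (f j) (ncps_compose b f)"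
  unfolding ncps_mult_def[of "f j"]
  by (rule ext, rule ncps_compose_reindex[OF assms, of "(#) j"])
    (auto simp: ncps_mult_var_left ncps_mult_def[of "f j"] split: list.splits)

lemma ncps_compose_var_right:
  assumes "composable b f"
  shows "ncps_compose (ncps_mult b (ncps_var j)) f = ncps_mult (ncps_compose b f) (f j)"
proof -
  have "\<beta> \<in> range (\<lambda>\<alpha>. \<alpha> @ [j])" if "\<beta> \<noteq> []" "last \<beta> = j" for \<beta>
    using that by (metis append_butlast_last_id rangeI)
  then show ?thesis
    unfolding ncps_mult_def[of _ "f j"] mult.commute[of _ "f j _"]
    by (intro ext ncps_compose_reindex[OF assms, of "\<lambda>\<alpha>. \<alpha> @ [j]"])
      (auto simp: ncps_mult_var_right ncps_word_append ncps_mult_def[of _ "f j"] mult.commute inj_on_def)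
qed

lemma ncps_compose_basis: "ncps_compose (ell2_coeff (ell2_basis \<alpha>)) f = ncps_word f \<alpha>"
proof
  fix w
  have "ncps_compose (ell2_coeff (ell2_basis \<alpha>)) f w
      = (\<Sum>\<beta>\<in>{\<alpha>}. ell2_coeff (ell2_basis \<alpha>) \<beta> * ncps_word f \<beta> w)"
    by (rule ncps_compose_eq_sum) (auto simp: ell2_coeff_basis split: if_splits)
  then show "ncps_compose (ell2_coeff (ell2_basis \<alpha>)) f w = ncps_word f \<alpha> w"
    by (simp add: ell2_coeff_basis)
qed

section \<open>Substitution into polynomials\<close>

lemma nc_polynomial_mult:
  assumes "nc_polynomial p" "nc_polynomial q"
  shows "nc_polynomial (ncps_mult p q)"
proof -
  have "{w. ncps_mult p q w \<noteq> 0} \<subseteq> (\<lambda>(u, v). u @ v) ` ({u. p u \<noteq> 0} \<times> {v. q v \<noteq> 0})"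
  proof
    fix w assume "w \<in> {w. ncps_mult p q w \<noteq> 0}"
    then obtain k where "p (take k w) * q (drop k w) \<noteq> 0"
      unfolding ncps_mult_def by (auto elim: sum.not_neutral_contains_not_neutral)
    then show "w \<in> (\<lambda>(u, v). u @ v) ` ({u. p u \<noteq> 0} \<times> {v. q v \<noteq> 0})"
      by (intro image_eqI[of _ _ "(take k w, drop k w)"]) auto
  qed
  then show ?thesis
    using assms finite_subset unfolding nc_polynomial_def by blast
qed

lemma nc_polynomial_basic: "nc_polynomial ncps_one" "nc_polynomial (ncps_var i)"
  by (auto simp: nc_polynomial_def ncps_one_def ncps_var_def)

lemma nc_polynomial_word: "(\<And>i. nc_polynomial (f i)) \<Longrightarrow> nc_polynomial (ncps_word f \<alpha>)"
  by (induction \<alpha>) (simp_all add: nc_polynomial_mult nc_polynomial_basic)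

lemma polynomial_expansion:
  assumes "nc_polynomial p"
  shows "p = (\<lambda>w. \<Sum>\<alpha> | p \<alpha> \<noteq> 0. p \<alpha> * ncps_word ncps_var \<alpha> w)"
proof
  fix w
  have "(\<Sum>\<alpha> | p \<alpha> \<noteq> 0. p \<alpha> * ncps_word ncps_var \<alpha> w) = (\<Sum>\<alpha> | p \<alpha> \<noteq> 0. if \<alpha> = w then p w else 0)"
    by (intro sum.cong refl) (auto simp: ncps_word_var)
  also have "\<dots> = p w"
    using assms by (simp add: sum.delta nc_polynomial_def)
  finally show "p w = (\<Sum>\<alpha> | p \<alpha> \<noteq> 0. p \<alpha> * ncps_word ncps_var \<alpha> w)" by simp
qed

lemma ncps_compose_polynomial:
  assumes "nc_polynomial p"
  shows "ncps_compose p g = (\<lambda>w. \<Sum>\<alpha> | p \<alpha> \<noteq> 0. p \<alpha> * ncps_word g \<alpha> w)"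
  by (rule ext, rule ncps_compose_eq_sum) (use assms in \<open>auto simp: nc_polynomial_def\<close>)

lemma ncps_compose_mult:
  assumes p: "nc_polynomial p" and q: "nc_polynomial q"
  shows "ncps_compose (ncps_mult p q) g = ncps_mult (ncps_compose p g) (ncps_compose q g)"
proof -
  have word: "ncps_compose (ncps_mult (ncps_word ncps_var \<alpha>) q) g = ncps_mult (ncps_word g \<alpha>) (ncps_compose q g)" for \<alpha>
    by (induction \<alpha>)
      (simp_all add: ncps_mult_assoc ncps_compose_var_left composable_polynomial nc_polynomial_mult
        nc_polynomial_word nc_polynomial_basic q)
  have "ncps_mult p q = (\<lambda>w. \<Sum>\<alpha> | p \<alpha> \<noteq> 0. p \<alpha> * ncps_mult (ncps_word ncps_var \<alpha>) q w)"
    by (subst polynomial_expansion[OF p]) (simp add: fun_eq_iff ncps_mult_sum_left)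
  then have "ncps_compose (ncps_mult p q) g
      = (\<lambda>w. \<Sum>\<alpha> | p \<alpha> \<noteq> 0. p \<alpha> * ncps_mult (ncps_word g \<alpha>) (ncps_compose q g) w)"
    using p by (simp add: ncps_compose_sum composable_polynomial nc_polynomial_mult nc_polynomial_word
        nc_polynomial_basic q word nc_polynomial_def[of p])
  also have "\<dots> = ncps_mult (ncps_compose p g) (ncps_compose q g)"
    by (simp add: fun_eq_iff ncps_compose_polynomial[OF p] ncps_mult_sum_left)
  finally show ?thesis .
qed

lemma ncps_compose_left_inverse:
  assumes f: "\<And>j. nc_polynomial (f j)" and fg: "\<And>j. ncps_compose (f j) g = ncps_var j"
    and b: "nc_polynomial b"
  shows "ncps_compose (ncps_compose b f) g = b"
proof -
  have "ncps_compose (ncps_word f \<alpha>) g = ncps_word ncps_var \<alpha>" for \<alpha>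
  proof (induction \<alpha>)
    case Nil
    show ?case
      using ncps_compose_basis[of "[]" g] by (simp add: ell2_coeff_basis_eq)
  qed (simp add: ncps_compose_mult f nc_polynomial_word fg)
  then have "ncps_compose (ncps_compose b f) g = (\<lambda>w. \<Sum>\<alpha> | b \<alpha> \<noteq> 0. b \<alpha> * ncps_word ncps_var \<alpha> w)"
    using b by (simp add: ncps_compose_polynomial[OF b] ncps_compose_sum composable_polynomial
        nc_polynomial_word f nc_polynomial_def[of b])
  then show ?thesis using polynomial_expansion[OF b] by simp
qed

section \<open>Series without constant term\<close>

context
  fixes f :: "'n::finite \<Rightarrow> 'n ncps"
  assumes f0: "\<And>j. f j [] = 0"
begin

lemma ncps_word_short: "length w < length \<alpha> \<Longrightarrow> ncps_word f \<alpha> w = 0"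
proof (induction \<alpha> arbitrary: w)
  case (Cons i \<alpha>)
  have "f i (take k w) * ncps_word f \<alpha> (drop k w) = 0" if "k \<le> length w" for k
    using that Cons by (cases k) (simp_all add: f0)
  then have "ncps_mult (f i) (ncps_word f \<alpha>) w = 0"
    unfolding ncps_mult_def by (intro sum.neutral) simp
  then show ?case by simp
qed simp

lemma composable_no_constant: "composable b f"
  unfolding composable_def
proof
  fix w
  have "{\<alpha>. b \<alpha> * ncps_word f \<alpha> w \<noteq> 0} \<subseteq> {\<alpha>. length \<alpha> < Suc (length w)}"
    using ncps_word_short not_less_eq by fastforce
  then show "finite {\<alpha>. b \<alpha> * ncps_word f \<alpha> w \<noteq> 0}"
    by (rule finite_subset) (rule finite_short_words)
qed

text \<open>A cut after more than one letter leaves a remainder too short for f_\<alpha>, and an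
  empty first piece is excluded by f(0) = 0. Hence only the Jacobian acts in lowest degree.\<close>

lemma ncps_word_linear_part:
  assumes "length \<alpha> = length w"
  shows "ncps_word f (i # \<alpha>) (x # w) = f i [x] * ncps_word f \<alpha> w"
proof -
  have "ncps_mult (\<lambda>u. f i (x # u)) (ncps_word f \<alpha>) w
      = (\<Sum>k\<le>length w. if k = 0 then f i [x] * ncps_word f \<alpha> w else 0)"
    unfolding ncps_mult_def
    using assms by (intro sum.cong refl) (auto simp: ncps_word_short)
  then show ?thesis by (simp add: ncps_mult_Cons f0)
qed

text \<open>In lowest degree substitution is the k-fold tensor power of the Jacobian; the induction
  strips off one tensor factor and inverts it.\<close>

lemma homogeneous_injective:
  assumes det: "det (\<chi> i j. f i [j]) \<noteq> 0"
    and zero: "\<And>w. length w = k \<Longrightarrow> (\<Sum>\<alpha> | length \<alpha> = k. b \<alpha> * ncps_word f \<alpha> w) = 0"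
    and \<alpha>: "length \<alpha> = k"
  shows "b \<alpha> = 0"
  using zero \<alpha>
proof (induction k arbitrary: b \<alpha>)
  case 0
  have "{\<alpha> :: 'n list. length \<alpha> = 0} = {[]}" by auto
  with 0(1)[of "[]"] 0(2) show ?case by (simp add: ncps_one_def)
next
  case (Suc k)
  define J where "J = (\<chi> i j. f i [j])"
  have "invertible J" using det by (simp add: invertible_det_nz J_def)
  then obtain K where K: "J ** K = mat 1" by (auto simp: invertible_def)
  obtain l \<gamma> where \<alpha>: "\<alpha> = l # \<gamma>" "length \<gamma> = k"
    using Suc.prems(2) by (auto simp: length_Suc_conv)
  \<comment> \<open>For fixed x, the contraction of b with column x of J in the first letter
    satisfies the hypothesis in degree k. So J annihilates the row vector with entries b(i\<gamma>),
    and multiplying by K recovers that vector as 0.\<close>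
  have vJ: "(\<Sum>i\<in>UNIV. b (i # \<gamma>) * f i [x]) = 0" for x
  proof (rule Suc.IH[OF _ \<alpha>(2)])
    fix w :: "'n list" assume w: "length w = k"
    have "(\<Sum>\<beta> | length \<beta> = k. (\<Sum>i\<in>UNIV. b (i # \<beta>) * f i [x]) * ncps_word f \<beta> w)
        = (\<Sum>i\<in>UNIV. \<Sum>\<beta> | length \<beta> = k. b (i # \<beta>) * (f i [x] * ncps_word f \<beta> w))"
      unfolding sum_distrib_right by (subst sum.swap) (simp add: mult.assoc)
    also have "\<dots> = (\<Sum>i\<in>UNIV. \<Sum>\<beta> | length \<beta> = k. b (i # \<beta>) * ncps_word f (i # \<beta>) (x # w))"
      by (intro sum.cong refl) (simp add: ncps_word_linear_part w del: ncps_word_Cons)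
    also have "\<dots> = 0"
      using Suc.prems(1)[of "x # w"] w by (simp add: sum_words_Suc del: ncps_word_Cons)
    finally show "(\<Sum>\<beta> | length \<beta> = k. (\<Sum>i\<in>UNIV. b (i # \<beta>) * f i [x]) * ncps_word f \<beta> w) = 0" .
  qed
  have "b (l # \<gamma>) = (\<Sum>i\<in>UNIV. if i = l then b (l # \<gamma>) else 0)"
    by (simp add: sum.delta)
  also have "\<dots> = (\<Sum>i\<in>UNIV. b (i # \<gamma>) * (J ** K) $ i $ l)"
    by (intro sum.cong refl) (simp add: K mat_def)
  also have "\<dots> = (\<Sum>x\<in>UNIV. (\<Sum>i\<in>UNIV. b (i # \<gamma>) * f i [x]) * K $ x $ l)"
    unfolding matrix_matrix_mult_def sum_distrib_right
    by (subst sum.swap) (simp add: J_def sum_distrib_left mult.assoc)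
  also have "\<dots> = 0" by (simp add: vJ)
  finally show ?case by (simp add: \<alpha>)
qed

text \<open>Induction on length: shorter coefficients already vanish, longer words have no term in
  this degree, and the homogeneous case remains.\<close>

lemma ncps_compose_injective:
  assumes det: "det (\<chi> i j. f i [j]) \<noteq> 0" and zero: "ncps_compose b f = (\<lambda>_. 0)"
  shows "b \<alpha> = 0"
proof (induction "length \<alpha>" arbitrary: \<alpha> rule: less_induct)
  case less
  show ?case
  proof (rule homogeneous_injective[OF det _ refl])
    fix w :: "'n list" assume w: "length w = length \<alpha>"
    have "ncps_compose b f w = (\<Sum>\<beta> | length \<beta> = length \<alpha>. b \<beta> * ncps_word f \<beta> w)"
    proof (rule ncps_compose_eq_sum)
      show "{\<beta>. b \<beta> * ncps_word f \<beta> w \<noteq> 0} \<subseteq> {\<beta>. length \<beta> = length \<alpha>}"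
      proof
        fix \<beta> assume "\<beta> \<in> {\<beta>. b \<beta> * ncps_word f \<beta> w \<noteq> 0}"
        then have "\<not> length \<beta> < length \<alpha>" "\<not> length w < length \<beta>"
          using less ncps_word_short by auto
        then show "\<beta> \<in> {\<beta>. length \<beta> = length \<alpha>}" using w by simp
      qed
    qed simp
    then show "(\<Sum>\<beta> | length \<beta> = length \<alpha>. b \<beta> * ncps_word f \<beta> w) = 0"
      by (simp add: zero)
  qed
qed

end

section \<open>The universal model\<close>

lemma composable_ell2_diff:
  assumes "composable (ell2_coeff b) f" "composable (ell2_coeff d) f"
    and "ncps_compose (ell2_coeff b) f = ncps_compose (ell2_coeff d) f"
  shows "ncps_compose (ell2_coeff (b - d)) f = (\<lambda>_. 0)"
  using ncps_compose_diff[OF assms(1,2)] assms(3) by (simp add: fun_eq_iff ell2_coeff_simps(3)[abs_def])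

text \<open>All that is needed of the model property. It holds in each of the three cases because
  substituting \<open>f\<close> is injective on coordinate vectors.\<close>

definition universal_model ::
    "('n::finite \<Rightarrow> 'n ncps) \<Rightarrow> ('n \<Rightarrow> 'n list ell2) \<Rightarrow> ('n \<Rightarrow> 'n list ell2 \<Rightarrow>\<^sub>L 'n list ell2) \<Rightarrow> bool"
  where "universal_model f a M \<longleftrightarrow> (\<forall>i. M i \<in> left_multipliers \<and> M i (ell2_basis []) = a i) \<and>
    M \<in> conv_sot f \<union> conv_rad f \<and> tuple_value f M = left_creation"

section \<open>The three cases of the model property\<close>

lemma universal_model_S:
  assumes "model_S f a M"
  shows "universal_model f a M"
proof -
  have f0: "f j [] = 0" and det: "det (\<chi> i j. f i [j]) \<noteq> 0"
    and a: "ncps_compose (ell2_coeff (a i)) f = ncps_var i"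
    and Mc: "clinear_op (M i)"
    and M: "ncps_compose (ell2_coeff (M i b)) f = ncps_mult (ncps_var i) (ncps_compose (ell2_coeff b) f)"
    and conv: "M \<in> conv_sot f \<union> conv_rad f"
    and tv: "ncps_compose (ell2_coeff (tuple_value f M j b)) f = ncps_mult (f j) (ncps_compose (ell2_coeff b) f)"
    for i j b
    using assms by (auto simp: model_S_def BH_iff)
  note comp [simp] = composable_no_constant[of f, OF f0]
  have inj: "b = d" if "ncps_compose (ell2_coeff b) f = ncps_compose (ell2_coeff d) f" for b d
    using ncps_compose_injective[of f, OF f0 det composable_ell2_diff[OF comp comp that]]
    by (intro ell2_eqI) simp
  \<comment> \<open>Both sides represent the product of Z_i, the series of x and f_j, bracketed
    differently.\<close>
  have "M i (right_creation j x) = right_creation j (M i x)" for i j x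
    by (rule inj) (simp add: M ell2_coeff_right_creation ncps_compose_var_right ncps_mult_assoc)
  moreover have "M i (ell2_basis []) = a i" for i
    by (rule inj) (simp add: M a ncps_compose_basis)
  moreover have "tuple_value f M j = left_creation j" for j
    by (rule blinfun_eqI, rule inj) (simp add: tv ell2_coeff_left_creation ncps_compose_var_left)
  ultimately show ?thesis
    using conv Mc by (simp add: universal_model_def left_multipliers_commute fun_eq_iff)
qed

lemma sot_sums_polynomial:
  assumes p: "nc_polynomial p"
  shows "sot_sums p X (\<Sum>\<alpha> | p \<alpha> \<noteq> 0. p \<alpha> *\<^sub>C op_word X \<alpha>)"
proof -
  have fin: "finite {\<alpha>. p \<alpha> \<noteq> 0}" using p by (simp add: nc_polynomial_def)
  then obtain N where N: "\<And>\<alpha>. p \<alpha> \<noteq> 0 \<Longrightarrow> length \<alpha> < N"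
    using finite_nat_set_iff_bounded[of "length ` {\<alpha>. p \<alpha> \<noteq> 0}"] by auto
  have "(\<Sum>k<n. nc_term p X k) = (\<Sum>\<alpha> | p \<alpha> \<noteq> 0. p \<alpha> *\<^sub>C op_word X \<alpha>)" if "N \<le> n" for n
  proof -
    have "(\<Sum>k<n. nc_term p X k) = (\<Sum>\<alpha> | length \<alpha> < n. p \<alpha> *\<^sub>C op_word X \<alpha>)"
      by (simp add: nc_term_def sum_words_by_length)
    also have "\<dots> = (\<Sum>\<alpha> | p \<alpha> \<noteq> 0. p \<alpha> *\<^sub>C op_word X \<alpha>)"
      using N that by (intro sum.mono_neutral_right) (fastforce simp: scaleC_blinfun.zero_left)+
    finally show ?thesis .
  qed
  then have "\<forall>\<^sub>F n in sequentially. (\<Sum>\<alpha> | p \<alpha> \<noteq> 0. p \<alpha> *\<^sub>C op_word X \<alpha>) = (\<Sum>k<n. nc_term p X k)"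
    by (intro eventually_sequentiallyI[of N]) simp
  then have "(\<lambda>n. \<Sum>k<n. nc_term p X k) \<longlonglongrightarrow> (\<Sum>\<alpha> | p \<alpha> \<noteq> 0. p \<alpha> *\<^sub>C op_word X \<alpha>)"
    by (rule Lim_transform_eventually[OF tendsto_const])
  then show ?thesis
    unfolding sot_sums_def by (rule tendsto_imp_limitin_sot)
qed

text \<open>Injectivity of substitution is available only for finitely supported coordinates, so
  each identity is checked at basis vectors and extended by continuity. In this case f_j(M_Z) is not
  prescribed by the model property; it is computed as a finite sum of words in M.\<close>

lemma universal_model_A:
  assumes "model_A f a M"
  shows "universal_model f a M"
proof -
  have f: "nc_polynomial (f j)" for j
    using assms by (simp add: model_A_def)
  obtain g where fg: "\<And>j. ncps_compose (f j) g = ncps_var j"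
    using assms unfolding model_A_def by blast
  have a: "nc_polynomial (ell2_coeff (a i))" "ncps_compose (ell2_coeff (a i)) f = ncps_var i"
    and Mc: "clinear_op (M i)" for i
    using assms by (auto simp: model_A_def BH_iff)
  have M: "nc_polynomial (ell2_coeff (M i b))"
    "ncps_compose (ell2_coeff (M i b)) f = ncps_mult (ncps_var i) (ncps_compose (ell2_coeff b) f)"
    if "nc_polynomial (ell2_coeff b)" for i b
    using assms that by (auto simp: model_A_def)
  note comp = composable_polynomial
  have inj: "b = d" if "nc_polynomial (ell2_coeff b)" "nc_polynomial (ell2_coeff d)"
    "ncps_compose (ell2_coeff b) f = ncps_compose (ell2_coeff d) f" for b d
  proof -
    have "ell2_coeff b = ncps_compose (ncps_compose (ell2_coeff b) f) g"
      by (rule ncps_compose_left_inverse[OF f fg that(1), symmetric])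
    also have "\<dots> = ell2_coeff d"
      unfolding that(3) by (rule ncps_compose_left_inverse[OF f fg that(2)])
    finally show ?thesis by (simp only: ell2_coeff_inject)
  qed
  have poly_basis: "nc_polynomial (ell2_coeff (ell2_basis \<beta>))" for \<beta>
    by (simp add: ell2_coeff_basis_eq nc_polynomial_word nc_polynomial_basic)
  have poly_right: "nc_polynomial (ell2_coeff (right_creation j b))" if "nc_polynomial (ell2_coeff b)" for j b
    by (simp add: ell2_coeff_right_creation nc_polynomial_mult nc_polynomial_basic that)
  have "M i o\<^sub>L right_creation j = right_creation j o\<^sub>L M i" for i j
  proof (rule clinear_op_ell2_eqI)
    fix \<beta>
    show "(M i o\<^sub>L right_creation j) (ell2_basis \<beta>) = (right_creation j o\<^sub>L M i) (ell2_basis \<beta>)"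
      by (rule inj)
        (simp_all add: poly_basis poly_right M ell2_coeff_right_creation ncps_compose_var_right comp
          ncps_mult_assoc nc_polynomial_mult nc_polynomial_basic)
  qed (auto intro!: clinear_op_intros Mc)
  then have "M i (right_creation j x) = right_creation j (M i x)" for i j x
    by (metis blinfun_apply_blinfun_compose)
  moreover have "M i (ell2_basis []) = a i" for i
    by (rule inj) (simp_all add: M a poly_basis ncps_compose_basis)
  moreover define L where "L j = (\<Sum>\<alpha> | f j \<alpha> \<noteq> 0. f j \<alpha> *\<^sub>C op_word M \<alpha>)" for j
  have "\<forall>j. sot_sums (f j) M (L j)"
    by (simp add: L_def sot_sums_polynomial f)
  then have "M \<in> conv_sot f \<union> conv_rad f" "tuple_value f M = L"
    using tuple_value_eqI[of M f L, OF Mc] by blast+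
  moreover have "L j = left_creation j" for j
  proof (rule clinear_op_ell2_eqI)
    show "clinear_op (L j)"
      unfolding L_def by (intro clinear_op_sum clinear_op_intros clinear_op_word Mc)
    fix \<beta>
    \<comment> \<open>In coordinates M_\<alpha> e_\<beta> stands for Z_\<alpha> f_\<beta>; summing
      with the coefficients of f_j gives f_j f_\<beta>.\<close>
    have word: "nc_polynomial (ell2_coeff (op_word M \<alpha> (ell2_basis \<beta>)))"
      "ncps_compose (ell2_coeff (op_word M \<alpha> (ell2_basis \<beta>))) f = ncps_mult (ncps_word ncps_var \<alpha>) (ncps_word f \<beta>)" for \<alpha>
      by (induction \<alpha>) (simp_all add: poly_basis ncps_compose_basis M ncps_mult_assoc)
    have coeff: "ell2_coeff (L j (ell2_basis \<beta>))
        = (\<lambda>w. \<Sum>\<alpha> | f j \<alpha> \<noteq> 0. f j \<alpha> * ell2_coeff (op_word M \<alpha> (ell2_basis \<beta>)) w)"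
      by (simp add: fun_eq_iff L_def sum_blinfun_apply ell2_coeff_sum)
    have fin: "finite {\<alpha>. f j \<alpha> \<noteq> 0}" using f by (simp add: nc_polynomial_def)
    show "L j (ell2_basis \<beta>) = left_creation j (ell2_basis \<beta>)"
    proof (rule inj)
      have "{w. ell2_coeff (L j (ell2_basis \<beta>)) w \<noteq> 0}
          \<subseteq> (\<Union>\<alpha>\<in>{\<alpha>. f j \<alpha> \<noteq> 0}. {w. ell2_coeff (op_word M \<alpha> (ell2_basis \<beta>)) w \<noteq> 0})"
      proof
        fix w assume "w \<in> {w. ell2_coeff (L j (ell2_basis \<beta>)) w \<noteq> 0}"
        then have "(\<Sum>\<alpha> | f j \<alpha> \<noteq> 0. f j \<alpha> * ell2_coeff (op_word M \<alpha> (ell2_basis \<beta>)) w) \<noteq> 0"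
          by (simp add: coeff)
        from sum.not_neutral_contains_not_neutral[OF this]
        show "w \<in> (\<Union>\<alpha>\<in>{\<alpha>. f j \<alpha> \<noteq> 0}. {w. ell2_coeff (op_word M \<alpha> (ell2_basis \<beta>)) w \<noteq> 0})"
          by auto
      qed
      then show "nc_polynomial (ell2_coeff (L j (ell2_basis \<beta>)))"
        unfolding nc_polynomial_def
        by (rule finite_subset) (use fin word(1) in \<open>auto simp: nc_polynomial_def\<close>)
      show "nc_polynomial (ell2_coeff (left_creation j (ell2_basis \<beta>)))"
        by (simp add: left_creation_basis poly_basis)
      have "ncps_compose (ell2_coeff (L j (ell2_basis \<beta>))) f
          = (\<lambda>w. \<Sum>\<alpha> | f j \<alpha> \<noteq> 0. f j \<alpha> * ncps_mult (ncps_word ncps_var \<alpha>) (ncps_word f \<beta>) w)"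
        unfolding coeff by (subst ncps_compose_sum[OF fin]) (simp_all add: comp word)
      also have "\<dots> = ncps_mult (f j) (ncps_word f \<beta>)"
        by (subst (3) polynomial_expansion[OF f[of j]]) (simp add: fun_eq_iff ncps_mult_sum_left)
      finally show "ncps_compose (ell2_coeff (L j (ell2_basis \<beta>))) f
          = ncps_compose (ell2_coeff (left_creation j (ell2_basis \<beta>))) f"
        by (simp add: left_creation_basis ncps_compose_basis)
    qed
  qed simp
  ultimately show ?thesis
    using Mc by (simp add: universal_model_def left_multipliers_commute fun_eq_iff)
qed

text \<open>Coordinate vectors are compared through the values of the functions they represent,
  which separate them because G o f vanishes only for G = 0. Right creation becomes multiplication
  by f_j(X) on the right and so commutes with multiplication by X_i on the left.\<close>

lemma universal_model_F:
  fixes f :: "'n::finite \<Rightarrow> 'n ncps"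
  assumes "model_F TYPE('h::chilbert_space) f a M"
  shows "universal_model f a M"
proof -
  obtain \<gamma> where F: "\<forall>X\<in>(op_ball \<gamma> :: ('n \<Rightarrow> 'h \<Rightarrow>\<^sub>L 'h) set). (\<lambda>j. nc_eval (f j) X) \<in> op_ball 1"
    and ne: "\<forall>G. 1 \<le> ncps_radius G \<and> G \<noteq> (\<lambda>_. 0) \<longrightarrow>
      (\<exists>X\<in>(op_ball \<gamma> :: ('n \<Rightarrow> 'h \<Rightarrow>\<^sub>L 'h) set). nc_eval G (\<lambda>j. nc_eval (f j) X) \<noteq> 0)"
    and a: "\<forall>i. \<forall>X\<in>(op_ball \<gamma> :: ('n \<Rightarrow> 'h \<Rightarrow>\<^sub>L 'h) set). nc_eval (ell2_coeff (a i)) (\<lambda>j. nc_eval (f j) X) = X i"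
    and Mc: "\<forall>i. clinear_op (M i)"
    and M: "\<forall>i b. \<forall>X\<in>(op_ball \<gamma> :: ('n \<Rightarrow> 'h \<Rightarrow>\<^sub>L 'h) set). nc_eval (ell2_coeff (M i b)) (\<lambda>j. nc_eval (f j) X)
      = X i o\<^sub>L nc_eval (ell2_coeff b) (\<lambda>j. nc_eval (f j) X)"
    and conv: "M \<in> conv_sot f \<union> conv_rad f"
    and tv: "\<forall>j b. \<forall>X\<in>(op_ball \<gamma> :: ('n \<Rightarrow> 'h \<Rightarrow>\<^sub>L 'h) set). nc_eval (ell2_coeff (tuple_value f M j b)) (\<lambda>j. nc_eval (f j) X)
      = nc_eval (f j) X o\<^sub>L nc_eval (ell2_coeff b) (\<lambda>j. nc_eval (f j) X)"
    using assms unfolding model_F_def Let_def BH_iff by blast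
  define F where "F X j = nc_eval (f j) X" for X :: "'n \<Rightarrow> 'h \<Rightarrow>\<^sub>L 'h" and j
  define B where "B = (op_ball \<gamma> :: ('n \<Rightarrow> 'h \<Rightarrow>\<^sub>L 'h) set)"
  have FB: "F X \<in> op_ball 1" if "X \<in> B" for X
    using F that by (simp add: F_def[abs_def] B_def)
  have a': "calculus (F X) (a i) = X i" if "X \<in> B" for X i
    using a that calculus_apply[OF FB[OF that], of "a i"] by (simp add: F_def[abs_def] B_def)
  have M': "calculus (F X) (M i b) = X i o\<^sub>L calculus (F X) b" if "X \<in> B" for X i b
    using M that calculus_apply[OF FB[OF that], of "M i b"] calculus_apply[OF FB[OF that], of b]
    by (simp add: F_def[abs_def] B_def)
  have tv': "calculus (F X) (tuple_value f M j b) = F X j o\<^sub>L calculus (F X) b" if "X \<in> B" for X j b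
    using tv that calculus_apply[OF FB[OF that], of "tuple_value f M j b"] calculus_apply[OF FB[OF that], of b]
    by (simp add: F_def[abs_def] B_def)
  have inj: "b = d" if eq: "\<And>X. X \<in> B \<Longrightarrow> calculus (F X) b = calculus (F X) d" for b d
  proof (rule ccontr)
    assume "b \<noteq> d"
    then have "ell2_coeff (b - d) \<noteq> (\<lambda>_. 0)"
      by (metis ell2_coeff_simps(1) ell2_eqI right_minus_eq)
    then obtain X where X: "X \<in> B" "nc_eval (ell2_coeff (b - d)) (F X) \<noteq> 0"
      using ne ncps_radius_ell2[of "b - d"] by (auto simp: F_def[abs_def] B_def)
    then have "calculus (F X) (b - d) \<noteq> 0"
      by (simp add: calculus_apply FB)
    with eq[OF X(1)] show False by (simp add: blinfun.diff_right)
  qed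
  have right: "calculus (F X) (right_creation j b) = calculus (F X) b o\<^sub>L F X j" if "X \<in> B" for X j b
    using calculus_right_mult[OF FB[OF that], of "[j]" b] by (simp add: right_mult_def)
  have left: "calculus (F X) (left_creation j b) = F X j o\<^sub>L calculus (F X) b" if "X \<in> B" for X j b
    using calculus_multiplier[OF FB[OF that] left_multipliers_intros(5), of j b]
    by (simp add: left_creation_basis calculus_basis[OF FB[OF that]])
  have "M i (right_creation j x) = right_creation j (M i x)" for i j x
    by (rule inj) (rule blinfun_eqI, simp add: M' right)
  moreover have "M i (ell2_basis []) = a i" for i
    by (rule inj) (simp add: M' a' calculus_basis[OF FB])
  moreover have "tuple_value f M j = left_creation j" for j
    by (rule blinfun_eqI, rule inj) (simp add: tv' left)
  ultimately show ?thesis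
    using conv Mc by (simp add: universal_model_def left_multipliers_commute fun_eq_iff)
qed

lemma model_property_universal:
  "model_property TYPE('h::chilbert_space) f a M \<Longrightarrow> universal_model f a M"
  unfolding model_property_def
  using universal_model_A universal_model_S universal_model_F by blast

section \<open>Bounded functions on the domain\<close>

lemma nc_domain_value:
  "Y \<in> nc_domain f a \<Longrightarrow> tuple_value f Y \<in> op_ball 1"
  by (auto simp: nc_domain_def op_ball_iff intro: clinear_op_tuple_value)

lemma sums_imp_sot_sums: "nc_term c X sums L \<Longrightarrow> sot_sums c X L"
  unfolding sot_sums_def sums_def by (rule tendsto_imp_limitin_sot)

text \<open>Evaluating at \<open>W\<close> the symbols of the operators in \<open>f\<^sub>j(M\<^sub>Z) = S\<^sub>j\<close> gives \<open>f(g(W)) = W\<close>; norm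
  convergence is preserved since evaluation is norm continuous.\<close>

lemma nc_domain_onto:
  fixes W :: "'n::finite \<Rightarrow> 'h::chilbert_space \<Rightarrow>\<^sub>L 'h"
  assumes um: "universal_model f a M" and conv: "model_norm_conv f M" and W: "W \<in> op_ball 1"
  shows "\<exists>Y\<in>nc_domain f a. tuple_value f Y = W"
proof -
  have M: "M i \<in> left_multipliers" "M i (ell2_basis []) = a i" for i
    using um by (simp_all add: universal_model_def)
  then have Mc: "clinear_op (M i)" for i by (simp add: left_multipliers_commute)
  have tv: "tuple_value f M = left_creation" using um by (simp add: universal_model_def)
  \<comment> \<open>This is g(W): the coordinates of Z_i are the coefficients of g_i.\<close>
  define Y where "Y i = calculus W (a i)" for i
  have Yc: "clinear_op (Y i)" for i by (simp add: Y_def clinear_op_calculus[OF W])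
  \<comment> \<open>Evaluation of the symbol at W as an operation on operators. It is multiplicative
    on left multipliers and sends M_i to Y_i and S_j to W_j.\<close>
  define \<Lambda> :: "('n list ell2 \<Rightarrow>\<^sub>L 'n list ell2) \<Rightarrow> 'h \<Rightarrow>\<^sub>L 'h" where "\<Lambda> T = calculus W (blinfun_apply T (ell2_basis []))" for T
  interpret \<Lambda>: bounded_linear \<Lambda>
    unfolding \<Lambda>_def by (rule bounded_linear_compose[OF blinfun.bounded_linear_right blinfun.bounded_linear_left])
  have \<Lambda>_word: "\<Lambda> (op_word M \<alpha>) = op_word Y \<alpha>" for \<alpha>
  proof (induction \<alpha>)
    case (Cons i \<alpha>)
    then show ?case
      using calculus_multiplier[OF W M(1), of i "op_word M \<alpha> (ell2_basis [])"]
      by (simp add: \<Lambda>_def M(2) Y_def)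
  qed (simp add: \<Lambda>_def calculus_basis[OF W])
  have \<Lambda>_term: "\<Lambda> (nc_term c M k) = nc_term c Y k" for c k
  proof -
    have "\<Lambda> (z *\<^sub>C T) = z *\<^sub>C \<Lambda> T" for z T
      by (simp add: \<Lambda>_def calculus_scaleC[OF W])
    then show ?thesis by (simp add: nc_term_def \<Lambda>.sum \<Lambda>_word)
  qed
  have \<Lambda>_creation: "\<Lambda> (left_creation j) = W j" for j
    by (simp add: \<Lambda>_def left_creation_basis calculus_basis[OF W])
  have "(\<forall>j. sot_sums (f j) Y (W j)) \<or> (\<forall>j. rad_sums (f j) Y (W j))"
    using conv unfolding model_norm_conv_def
  proof
    assume s: "\<forall>j. summable (nc_term (f j) M)"
    then have sot: "sot_sums (f j) M (suminf (nc_term (f j) M))" for j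
      by (intro sums_imp_sot_sums summable_sums) simp
    \<comment> \<open>The norm sum is also a strong sum, hence the value of f at M, which is already
      known to be the left creation.\<close>
    have "tuple_value f M = (\<lambda>j. suminf (nc_term (f j) M))"
      by (rule tuple_value_eqI(2)[OF Mc]) (use sot in blast)
    then have eq: "suminf (nc_term (f j) M) = left_creation j" for j
      by (metis tv)
    have "nc_term (f j) Y sums W j" for j
      using \<Lambda>.sums[OF summable_sums[of "nc_term (f j) M"]] s by (simp add: \<Lambda>_term eq \<Lambda>_creation)
    then show ?thesis by (simp add: sums_imp_sot_sums)
  next
    assume rad: "\<forall>j. radially_summable (f j) M \<and>
      ((\<lambda>r. nc_eval (f j) (\<lambda>i. r *\<^sub>R M i)) \<longlongrightarrow> tuple_value f M j) (at_left 1)"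
    have \<Lambda>_scaled: "\<Lambda> (nc_term c (\<lambda>i. r *\<^sub>R M i) k) = nc_term c (\<lambda>i. r *\<^sub>R Y i) k" for c r k
      by (simp add: nc_term_scaleR \<Lambda>.scaleR \<Lambda>_term)
    have sums: "nc_term c (\<lambda>i. r *\<^sub>R Y i) sums \<Lambda> (nc_eval c (\<lambda>i. r *\<^sub>R M i))"
      if "summable (nc_term c (\<lambda>i. r *\<^sub>R M i))" for c r
      using \<Lambda>.sums[OF summable_sums[OF that]] by (simp add: \<Lambda>_scaled nc_eval_def)
    have "rad_sums (f j) Y (W j)" for j
      unfolding rad_sums_def
    proof
      show "radially_summable (f j) Y"
      proof -
        obtain \<delta> where \<delta>: "0 < \<delta>" "\<delta> < 1"
          "\<And>r. \<delta> < r \<Longrightarrow> r < 1 \<Longrightarrow> summable (nc_term (f j) (\<lambda>i. r *\<^sub>R M i))"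
          using rad unfolding radially_summable_def by metis
        have "summable (nc_term (f j) (\<lambda>i. r *\<^sub>R Y i))" if "\<delta> < r" "r < 1" for r
          by (rule sums_summable[OF sums[OF \<delta>(3)[OF that]]])
        with \<delta>(1,2) show ?thesis unfolding radially_summable_def by blast
      qed
      have "((\<lambda>r. \<Lambda> (nc_eval (f j) (\<lambda>i. r *\<^sub>R M i))) \<longlongrightarrow> \<Lambda> (left_creation j)) (at_left 1)"
        using rad by (intro \<Lambda>.tendsto) (simp add: tv)
      moreover have "\<forall>\<^sub>F r in at_left 1. \<Lambda> (nc_eval (f j) (\<lambda>i. r *\<^sub>R M i)) = nc_eval (f j) (\<lambda>i. r *\<^sub>R Y i)"
        using radially_summable_eventually[of "f j" M] rad
        by (auto elim!: eventually_mono dest!: sums simp: nc_eval_def sums_iff)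
      ultimately have "((\<lambda>r. nc_eval (f j) (\<lambda>i. r *\<^sub>R Y i)) \<longlongrightarrow> W j) (at_left 1)"
        unfolding \<Lambda>_creation by (rule Lim_transform_eventually)
      then show "limitin strong_operator_topology (\<lambda>r. nc_eval (f j) (\<lambda>i. r *\<^sub>R Y i)) (W j) (at_left 1)"
        by (rule tendsto_imp_limitin_sot)
    qed
    then show ?thesis by blast
  qed
  note Y = tuple_value_eqI[of Y f W, OF Yc this]
  \<comment> \<open>Since f(Y) = W, the requirement g(f(Y)) = Y of the domain is the definition of
    Y.\<close>
  have "sot_sums (ell2_coeff (a i)) W (Y i)" for i
    using summable_sums[OF summable_nc_term[OF ncps_radius_ell2 W], of "a i"]
    by (intro sums_imp_sot_sums) (simp add: Y_def calculus_apply[OF W] nc_eval_def)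
  then have "Y \<in> nc_domain f a"
    using Y W by (simp add: nc_domain_def op_ball_iff)
  with Y(2) show ?thesis by blast
qed

text \<open>The isomorphism is built in the direction from multipliers to functions, where the
  algebraic identities hold pointwise by the functional calculus; \<Phi> is its inverse. That f maps
  the domain onto the ball gives injectivity.\<close>

lemma Hinf_domain_isomorphism:
  fixes f :: "'n::finite \<Rightarrow> 'n ncps" and a :: "'n \<Rightarrow> 'n list ell2"
  assumes inf: "\<nexists>B :: 'h::chilbert_space set. finite B \<and> span B = UNIV"
    and um: "universal_model f a M" and conv: "model_norm_conv f M"
  defines "D \<equiv> (nc_domain f a :: ('n \<Rightarrow> 'h \<Rightarrow>\<^sub>L 'h) set)"
    and "H \<equiv> (Hinf_domain f a :: (('n \<Rightarrow> 'h \<Rightarrow>\<^sub>L 'h) \<Rightarrow> 'h \<Rightarrow>\<^sub>L 'h) set)"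
  shows "H = compose_on_domain f a ` Hinf_ball TYPE('h)"
    and "\<exists>\<Phi>. algebra_isomorphism D H left_multipliers \<Phi> \<and>
      (\<forall>\<phi>\<in>Hinf_ball TYPE('h). abel_sums \<phi> left_creation (\<Phi> (compose_on_domain f a \<phi>)))"
proof -
  define \<Psi> :: "('n list ell2 \<Rightarrow>\<^sub>L 'n list ell2) \<Rightarrow> ('n \<Rightarrow> 'h \<Rightarrow>\<^sub>L 'h) \<Rightarrow> 'h \<Rightarrow>\<^sub>L 'h"
    where "\<Psi> T = compose_on_domain f a (fourier_coeff T)" for T
  have \<Psi>: "\<Psi> T = (\<lambda>Y\<in>D. nc_eval (fourier_coeff T) (tuple_value f Y))" for T
    by (simp add: \<Psi>_def compose_on_domain_def D_def)
  have ball: "tuple_value f Y \<in> op_ball 1" if "Y \<in> D" for Y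
    using that nc_domain_value by (simp add: D_def)
  have onto: "\<exists>Y\<in>D. tuple_value f Y = W" if "W \<in> op_ball 1" for W
    using nc_domain_onto[OF um conv that] by (simp add: D_def)
  obtain V :: "'n list ell2 \<Rightarrow>\<^sub>L 'h" where V: "clinear_op V" "norm V \<le> 1" "\<And>x. adj V (V x) = x"
    "\<And>x. norm (V x) = norm x"
    by (rule fock_isometry[OF inf]) blast
  have HB: "(Hinf_ball TYPE('h) :: 'n ncps set) = fourier_coeff ` left_multipliers"
    by (rule Hinf_ball_eq[OF inf])
  show H: "H = compose_on_domain f a ` Hinf_ball TYPE('h)"
  proof (intro equalityI subsetI)
    fix F assume "F \<in> H"
    then obtain c where ext: "F \<in> extensional D" and c: "\<And>Y. Y \<in> D \<Longrightarrow> nc_term c (tuple_value f Y) sums F Y"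
      and bd: "bounded (F ` D)"
      by (auto simp: H_def Hinf_domain_def D_def)
    \<comment> \<open>Convergence at f(Y) for every Y in the domain is convergence on the whole
      ball, hence also at the transported creations, which detect the radius.\<close>
    have "summable (nc_term c W)" if "W \<in> op_ball 1" for W :: "'n \<Rightarrow> 'h \<Rightarrow>\<^sub>L 'h"
      using onto[OF that] c sums_summable by blast
    then have rad: "1 \<le> ncps_radius c"
      by (rule transported_radius_ge_one[OF V])
    have F: "F Y = nc_eval c (tuple_value f Y)" if "Y \<in> D" for Y
      using c[OF that] by (simp add: nc_eval_def sums_iff)
    have "nc_eval c ` (op_ball 1 :: ('n \<Rightarrow> 'h \<Rightarrow>\<^sub>L 'h) set) \<subseteq> F ` D"
      using onto F by force
    then have "c \<in> Hinf_ball TYPE('h)"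
      using rad bd bounded_subset by (auto simp: Hinf_ball_def)
    moreover have "F = compose_on_domain f a c"
      using ext F by (auto simp: compose_on_domain_def D_def[symmetric] fun_eq_iff extensional_def)
    ultimately show "F \<in> compose_on_domain f a ` Hinf_ball TYPE('h)" by blast
  next
    fix F :: "('n \<Rightarrow> 'h \<Rightarrow>\<^sub>L 'h) \<Rightarrow> 'h \<Rightarrow>\<^sub>L 'h"
    assume "F \<in> compose_on_domain f a ` Hinf_ball TYPE('h)"
    then obtain \<phi> where \<phi>: "\<phi> \<in> Hinf_ball TYPE('h)" and F: "F = compose_on_domain f a \<phi>" by blast
    have rad: "1 \<le> ncps_radius \<phi>" and bd: "bounded (nc_eval \<phi> ` (op_ball 1 :: ('n \<Rightarrow> 'h \<Rightarrow>\<^sub>L 'h) set))"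
      using \<phi> by (simp_all add: Hinf_ball_def)
    have FY: "F Y = nc_eval \<phi> (tuple_value f Y)" if "Y \<in> D" for Y
      using that by (simp add: F compose_on_domain_def D_def)
    have "nc_term \<phi> (tuple_value f Y) sums F Y" if "Y \<in> D" for Y
      unfolding FY[OF that] nc_eval_def by (rule summable_sums[OF summable_nc_term[OF rad ball[OF that]]])
    moreover have "F ` D \<subseteq> nc_eval \<phi> ` op_ball 1"
      using FY ball by auto
    then have "bounded (F ` D)" using bd bounded_subset by blast
    moreover have "F \<in> extensional D" by (simp add: F compose_on_domain_def D_def)
    ultimately show "F \<in> H" by (auto simp: H_def Hinf_domain_def D_def)
  qed
  then have img: "H = \<Psi> ` left_multipliers"
    by (auto simp: HB \<Psi>_def image_image)
  have inj: "inj_on \<Psi> left_multipliers"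
  proof (rule inj_onI)
    fix S T assume S: "S \<in> left_multipliers" and T: "T \<in> left_multipliers" and eq: "\<Psi> S = \<Psi> T"
    have "fourier_coeff S = fourier_coeff T"
    proof (rule transported_unique[OF V ncps_radius_fourier ncps_radius_fourier])
      fix W :: "'n \<Rightarrow> 'h \<Rightarrow>\<^sub>L 'h" assume "W \<in> op_ball 1"
      then obtain Y where Y: "Y \<in> D" "tuple_value f Y = W" using onto by blast
      then show "nc_eval (fourier_coeff S) W = nc_eval (fourier_coeff T) W"
        using fun_cong[OF eq, of Y] by (simp add: \<Psi>)
    qed
    then show "S = T" by (rule left_multipliers_eqI[OF S T])
  qed
  have bij: "bij_betw \<Psi> left_multipliers H"
    using inj img by (simp add: bij_betw_def)
  define \<Phi> where "\<Phi> = inv_into left_multipliers \<Psi>"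
  have \<Phi>\<Psi>: "\<Phi> (\<Psi> T) = T" if "T \<in> left_multipliers" for T
    unfolding \<Phi>_def by (rule bij_betw_inv_into_left[OF bij that])
  have one: "\<Psi> id_blinfun = (\<lambda>Y\<in>D. id_blinfun)"
    unfolding \<Psi> by (rule restrict_ext) (simp add: nc_eval_fourier_algebra(1)[OF ball])
  have add: "\<Psi> (S + T) = (\<lambda>Y\<in>D. \<Psi> S Y + \<Psi> T Y)" for S T
    unfolding \<Psi> by (rule restrict_ext) (simp add: nc_eval_fourier_algebra(2)[OF ball])
  have scale: "\<Psi> (z *\<^sub>C T) = (\<lambda>Y\<in>D. z *\<^sub>C \<Psi> T Y)" for z T
    unfolding \<Psi> by (rule restrict_ext) (simp add: nc_eval_fourier_algebra(3)[OF ball])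
  have mult: "\<Psi> (S o\<^sub>L T) = (\<lambda>Y\<in>D. \<Psi> S Y o\<^sub>L \<Psi> T Y)" if "S \<in> left_multipliers" for S T
    unfolding \<Psi> by (rule restrict_ext) (simp add: nc_eval_fourier_algebra(4)[OF ball that])
  have "algebra_isomorphism D H left_multipliers \<Phi>"
    unfolding algebra_isomorphism_def function_algebra_def
  proof (intro conjI operator_algebra_left_multipliers ballI allI)
    show "(\<lambda>Y\<in>D. id_blinfun) \<in> H" "\<Phi> (\<lambda>Y\<in>D. id_blinfun) = id_blinfun"
      by (simp_all add: one[symmetric] \<Phi>\<Psi> left_multipliers_intros img)
    show "bij_betw \<Phi> H left_multipliers"
      unfolding \<Phi>_def by (rule bij_betw_inv_into[OF bij])
    fix F z assume "F \<in> H"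
    then obtain S where S: "S \<in> left_multipliers" "F = \<Psi> S" by (auto simp: img)
    show "(\<lambda>Y\<in>D. z *\<^sub>C F Y) \<in> H" "\<Phi> (\<lambda>Y\<in>D. z *\<^sub>C F Y) = z *\<^sub>C \<Phi> F"
      by (simp_all add: S scale[symmetric] \<Phi>\<Psi> left_multipliers_intros img)
    fix G assume "G \<in> H"
    then obtain T where T: "T \<in> left_multipliers" "G = \<Psi> T" by (auto simp: img)
    show "(\<lambda>Y\<in>D. F Y + G Y) \<in> H" "\<Phi> (\<lambda>Y\<in>D. F Y + G Y) = \<Phi> F + \<Phi> G"
      by (simp_all add: S T add[symmetric] \<Phi>\<Psi> left_multipliers_intros img)
    show "(\<lambda>Y\<in>D. F Y o\<^sub>L G Y) \<in> H" "\<Phi> (\<lambda>Y\<in>D. F Y o\<^sub>L G Y) = \<Phi> F o\<^sub>L \<Phi> G"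
      by (simp_all add: S T mult[symmetric] \<Phi>\<Psi> left_multipliers_intros img)
  qed
  moreover have "abel_sums \<phi> left_creation (\<Phi> (compose_on_domain f a \<phi>))" if \<phi>: "\<phi> \<in> Hinf_ball TYPE('h)" for \<phi>
  proof -
    obtain T where T: "T \<in> left_multipliers" "\<phi> = fourier_coeff T"
      using \<phi> unfolding HB by blast
    then show ?thesis
      using multiplier_abel_sums[OF T(1)] \<Phi>\<Psi>[OF T(1)] by (simp add: \<Psi>_def)
  qed
  ultimately show "\<exists>\<Phi>. algebra_isomorphism D H left_multipliers \<Phi> \<and>
      (\<forall>\<phi>\<in>Hinf_ball TYPE('h). abel_sums \<phi> left_creation (\<Phi> (compose_on_domain f a \<phi>)))"
    by blast
qed

theorem theorem6p1:
  fixes f :: "'n::finite \<Rightarrow> 'n ncps"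
    and a :: "'n \<Rightarrow> 'n list ell2"
    and M :: "'n \<Rightarrow> 'n list ell2 \<Rightarrow>\<^sub>L 'n list ell2"
  assumes separable: "separable_space (euclidean :: 'h::chilbert_space topology)"
    and infinite_dim: "\<nexists>B :: 'h set. finite B \<and> span B = UNIV"
    and model: "model_property TYPE('h) f a M"
  shows "wot_algebra M = left_multipliers \<and>
    (model_norm_conv f M \<longrightarrow>
      (Hinf_domain f a :: (('n \<Rightarrow> 'h \<Rightarrow>\<^sub>L 'h) \<Rightarrow> 'h \<Rightarrow>\<^sub>L 'h) set) =
        compose_on_domain f a ` Hinf_ball TYPE('h) \<and>
      (\<exists>\<Phi>. algebra_isomorphism (nc_domain f a :: ('n \<Rightarrow> 'h \<Rightarrow>\<^sub>L 'h) set)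
          (Hinf_domain f a) (wot_algebra M) \<Phi> \<and>
        (\<forall>\<phi>\<in>Hinf_ball TYPE('h).
          abel_sums \<phi> (tuple_value f M) (\<Phi> (compose_on_domain f a \<phi>))))) \<and>
    (\<forall>\<psi>\<in>wot_algebra M. \<exists>!\<phi>. \<phi> \<in> wot_algebra left_creation \<and>
      abel_sums (fourier_coeff \<phi>) (tuple_value f M) \<psi>)"
proof -
  have um: "universal_model f a M" by (rule model_property_universal[OF model])
  then have M: "M i \<in> left_multipliers" and conv: "M \<in> conv_sot f \<union> conv_rad f"
    and tv: "tuple_value f M = left_creation" for i
    by (simp_all add: universal_model_def)
  have Mc: "clinear_op (M i)" for i using M[of i] by (simp add: left_multipliers_commute)
  have "left_creation i \<in> wot_algebra M" for i
    using tuple_value_in_wot_algebra[OF conv, of i] by (simp add: tv)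
  then have alg: "wot_algebra M = left_multipliers"
    by (intro equalityI wot_algebra_subset_left_multipliers wot_algebra_contains_multipliers Mc M)
  \<comment> \<open>As f(M_Z) consists of the left creations, the series of \<phi> already sums to
    \<phi> itself, and uniqueness of strong limits leaves \<psi> as the only candidate.\<close>
  have "\<exists>!\<phi>. \<phi> \<in> left_multipliers \<and> abel_sums (fourier_coeff \<phi>) left_creation \<psi>"
    if "\<psi> \<in> left_multipliers" for \<psi> :: "'n list ell2 \<Rightarrow>\<^sub>L 'n list ell2"
  proof (rule ex1I[of _ \<psi>])
    fix \<phi> assume \<phi>: "\<phi> \<in> left_multipliers \<and> abel_sums (fourier_coeff \<phi>) left_creation \<psi>"
    then have "abel_sums (fourier_coeff \<phi>) left_creation \<phi>" by (simp add: multiplier_abel_sums)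
    with \<phi> show "\<phi> = \<psi>"
      unfolding abel_sums_iff by (elim conjE, intro limitin_sot_unique) auto
  qed (simp add: that multiplier_abel_sums)
  then show ?thesis
    using Hinf_domain_isomorphism[OF infinite_dim um] by (simp add: alg tv wot_algebra_left_creation)
qed

end
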